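(* The following order bounds are sharp. If $f$ and $g$ are simple of order $n$ and $m$, respectively, and $r$ is a rational function, then: (a) $\int f(x)\,dx$ is simple of order $\le n+1$; (b) $f'$ is simple of order $\le n$; (c) $f+g$ is simple of order $\le n+m$; (d) $f\cdot g$ is simple of order $\le n\,m$; (e) $f\circ r$ is simple of order $\le n$; (f) $f\circ x^{p/q}$ ($p,q\in\mathbb{Z}$) is simple of order $\le n\,q$. The sharpness is seen by the following example functions, where for $n,q\in\mathbb{N}$ we put $f_n(x):=\sum_{k=1}^{n}e^{x^k}$ and $f_{nq}(x):=\sum_{k=1}^{n}e^{x^{kq+1}}$: (a) For each $n$ the function $f_n$ is simple of order $n$, and $\int f_n$ is simple of order $n+1$. (b) For each $n$ the function $f_n$ is simple of order $n$, and $f_n'$ is simple of order $n$, too. (c) For each $n,m\in\mathbb{N}$ there are functions $f$ and $g$ that are simple of order $n$ and $m$, respectively, such that $h:=f+g$ is simple of order $n+m$. Indeed, example functions of that type are $f(x):=\sum_{k=1}^{n}e^{x^k}$ and $g(x):=\sum_{k=n+1}^{n+m}e^{x^k}$. (d) For each $n,m\in\mathbb{N}$ there are functions $f$ and $g$ that are simple of order $n$ and $m$, respectively, such that $h:=f\,g$ is simple of order $n\,m$. Indeed, example functions of that type are $f(x):=\sum_{k=1}^{n}e^{x^k}$ and $g(x):=\sum_{k=n+1}^{n+m}e^{x^k}$. (e) For each $n$ the function $f_n$ is simple of order $n$, and for each rational function $r$ the function $f_n\circ r$ is simple of order $n$, too. (f) For each $n$ the function $f_{nq}$ is simple of order $n$,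 and for each $p\in\mathbb{N}$ the function $f_{nq}\circ x^{p/q}$ is simple of order $n\,q$.
   Context: Let $K$ be one of $\mathbb{Q},\mathbb{R},\mathbb{C}$, and $\mathbb{N}=\{1,2,\ldots\}$. A homogeneous linear ordinary differential equation $\sum_{k=0}^{N}p_k(x)\,y^{(k)}(x)=0$ whose coefficients $p_k$ are polynomials in $x$ over $K$, with $p_N\not\equiv 0$, is called a simple differential equation of order $N$. A function satisfying some simple differential equation is called simple; its order is the least order of a simple differential equation that it satisfies. Here $f\circ x^{p/q}$ denotes the function $x\mapsto f(x^{p/q})$, and $\int f$ denotes an antiderivative of $f$.
   Formalization: Functions and branches of x^{p/q} are taken smooth on open domains, r has coefficients in K, and q ≥ 1 in (f). The examples exclude, since they fail there: the antiderivative e^x for n = 1 in (a), constant r for n ≥ 2 in (e), and p/q not in lowest terms in (f). *)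

theory Defs
  imports "HOL-Analysis.Analysis"
begin

text \<open>
  Functions are represented as total functions \<open>f :: 'a \<Rightarrow> 'a\<close> of which only the restriction to an
  open set \<open>D\<close> matters. The sort \<open>{real_normed_field, banach}\<close> has, up to isomorphism, exactly the
  two members \<open>real\<close> and \<open>complex\<close> (Gelfand--Mazur). The coefficient field \<open>K\<close> is a subset of \<open>'a\<close>.

  Solutions are taken to be infinitely differentiable on \<open>D\<close>. For \<open>complex\<close> this is the same as
  holomorphic. For \<open>real\<close> it only matters at the zeros of the leading coefficient, where
  a solution that is merely \<open>N\<close> times differentiable can be too rough to be a solution of
  any equation of higher order: \<open>x * \<bar>x\<bar>\<close> solves \<open>x y' = 2 y\<close> but has no second derivative at \<open>0\<close>.
\<close>

definition smooth_on :: "'a::real_normed_field set \<Rightarrow> ('a \<Rightarrow> 'a) \<Rightarrow> bool" where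
  "smooth_on D f \<longleftrightarrow> (\<forall>k. \<forall>x\<in>D. (deriv ^^ k) f field_differentiable at x)"

definition poly_over :: "'a::zero set \<Rightarrow> 'a poly \<Rightarrow> bool" where
  "poly_over K p \<longleftrightarrow> (\<forall>i. coeff p i \<in> K)"

definition satisfies_simple_ode ::
    "'a::real_normed_field set \<Rightarrow> 'a set \<Rightarrow> nat \<Rightarrow> ('a \<Rightarrow> 'a) \<Rightarrow> bool" where
  "satisfies_simple_ode K D N f \<longleftrightarrow>
     smooth_on D f \<and>
     (\<exists>p :: nat \<Rightarrow> 'a poly. (\<forall>k\<le>N. poly_over K (p k)) \<and> p N \<noteq> 0 \<and>
        (\<forall>x\<in>D. (\<Sum>k\<le>N. poly (p k) x * (deriv ^^ k) f x) = 0))"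

definition simple :: "'a::real_normed_field set \<Rightarrow> 'a set \<Rightarrow> ('a \<Rightarrow> 'a) \<Rightarrow> bool" where
  "simple K D f \<longleftrightarrow> (\<exists>N. satisfies_simple_ode K D N f)"

definition simple_order :: "'a::real_normed_field set \<Rightarrow> 'a set \<Rightarrow> ('a \<Rightarrow> 'a) \<Rightarrow> nat" where
  "simple_order K D f = (LEAST N. satisfies_simple_ode K D N f)"

definition simple_of_order ::
    "'a::real_normed_field set \<Rightarrow> 'a set \<Rightarrow> nat \<Rightarrow> ('a \<Rightarrow> 'a) \<Rightarrow> bool" where
  "simple_of_order K D n f \<longleftrightarrow> simple K D f \<and> simple_order K D f = n"

definition simple_of_order_le ::
    "'a::real_normed_field set \<Rightarrow> 'a set \<Rightarrow> nat \<Rightarrow> ('a \<Rightarrow> 'a) \<Rightarrow> bool" where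
  "simple_of_order_le K D n f \<longleftrightarrow> simple K D f \<and> simple_order K D f \<le> n"

definition antiderivative_on ::
    "'a::real_normed_field set \<Rightarrow> ('a \<Rightarrow> 'a) \<Rightarrow> ('a \<Rightarrow> 'a) \<Rightarrow> bool" where
  "antiderivative_on D f F \<longleftrightarrow> (\<forall>x\<in>D. (F has_field_derivative f x) (at x))"

text \<open>
  The power \<open>x\<^bsup>p/q\<^esup>\<close> is multivalued; \<open>s\<close> is a smooth branch of it on \<open>E\<close>. The principal
  branches given by \<open>powr\<close> are instances, see the two lemmas at the end.
\<close>

definition power_branch ::
    "int \<Rightarrow> nat \<Rightarrow> 'a::real_normed_field set \<Rightarrow> ('a \<Rightarrow> 'a) \<Rightarrow> bool" where
  "power_branch p q E s \<longleftrightarrow>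
     smooth_on E s \<and> (\<forall>x\<in>E. s x ^ q = x powi p) \<and> (p < 0 \<longrightarrow> 0 \<notin> E)"

definition exp_sum :: "nat \<Rightarrow> 'a::{real_normed_field,banach} \<Rightarrow> 'a" where
  "exp_sum n x = (\<Sum>k=1..n. exp (x ^ k))"

definition exp_sum_mult :: "nat \<Rightarrow> nat \<Rightarrow> 'a::{real_normed_field,banach} \<Rightarrow> 'a" where
  "exp_sum_mult n q x = (\<Sum>k=1..n. exp (x ^ (k * q + 1)))"

lemma smooth_onI:
  assumes "open D"
    and "\<And>x. x \<in> D \<Longrightarrow> g 0 x = f x"
    and der: "\<And>k x. x \<in> D \<Longrightarrow> (g k has_field_derivative g (Suc k) x) (at x)"
  shows "smooth_on D f"
proof -
  have eq: "\<forall>x\<in>D. (deriv ^^ k) f x = g k x" for k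
  proof (induction k)
    case 0
    then show ?case using assms(2) by simp
  next
    case (Suc k)
    show ?case
    proof
      fix x assume "x \<in> D"
      have "((deriv ^^ k) f has_field_derivative g (Suc k) x) (at x)"
        using has_field_derivative_transform_within_open[OF der[OF \<open>x \<in> D\<close>] \<open>open D\<close> \<open>x \<in> D\<close>]
          Suc.IH by metis
      then show "(deriv ^^ Suc k) f x = g (Suc k) x" by (simp add: DERIV_imp_deriv)
    qed
  qed
  show ?thesis
    unfolding smooth_on_def field_differentiable_def
    using has_field_derivative_transform_within_open[OF der _ _] eq \<open>open D\<close> by metis
qed

lemma power_branch_powr_real:
  assumes "q > 0"
  shows "power_branch p q {0<..} (\<lambda>x::real. x powr (of_int p / of_nat q))"
proof -
  let ?a = "of_int p / of_nat q :: real"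
  have "smooth_on {0<..} (\<lambda>x::real. x powr ?a)"
    by (rule smooth_onI[where g = "\<lambda>k x. (\<Prod>i<k. ?a - of_nat i) * x powr (?a - of_nat k)"])
       (auto intro!: derivative_eq_intros simp: algebra_simps)
  moreover have "(x powr ?a) ^ q = x powi p" if "x > 0" for x :: real
    using that assms by (simp add: powr_realpow [symmetric] powr_powr powr_real_of_int')
  ultimately show ?thesis by (auto simp: power_branch_def)
qed

lemma power_branch_powr_complex:
  assumes "q > 0"
  shows "power_branch p q (- \<real>\<^sub>\<le>\<^sub>0) (\<lambda>z::complex. z powr (of_int p / of_nat q))"
proof -
  let ?a = "of_int p / of_nat q :: complex"
  have "smooth_on (- \<real>\<^sub>\<le>\<^sub>0) (\<lambda>z::complex. z powr ?a)"
    by (rule smooth_onI[where g = "\<lambda>k z. (\<Prod>i<k. ?a - of_nat i) * z powr (?a - of_nat k)"])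
       (auto intro!: derivative_eq_intros simp: algebra_simps)
  moreover have "(z powr ?a) ^ q = z powi p" if "z \<notin> \<real>\<^sub>\<le>\<^sub>0" for z :: complex
  proof -
    have nz: "z \<noteq> 0" using that by auto
    have "(z powr ?a) ^ q = exp (of_nat q * (?a * ln z))"
      using nz by (simp add: powr_def flip: exp_of_nat_mult)
    also have "\<dots> = exp (of_int p * ln z)" using assms by simp
    also have "\<dots> = z powi p" using nz by (simp add: exp_power_int [symmetric])
    finally show ?thesis .
  qed
  ultimately show ?thesis by (auto simp: power_branch_def)
qed

end

theory Submission
  imports Defs "HOL-Computational_Algebra.Polynomial_Factorial"
begin

text \<open>
  The polynomials \<open>K[x]\<close> act on the smooth functions on an open set \<open>D\<close> without torsion: a nonzero polynomial
  has finitely many roots, and a continuous function that vanishes off a finite set vanishes. This holds whether or not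
  \<open>D\<close> is connected. The order of a simple function is therefore the dimension over the field \<open>K(x)\<close> of the space
  spanned by all its derivatives.

  Upper bounds come from exhibiting a space of the right dimension that is closed under differentiation
  (\<open>ode_of_rat_span\<close>). For sums and products this is the sum and the product of the given spaces. For
  compositions \<open>f \<circ> s\<close> with an algebraic function \<open>s\<close> it is spanned by the products of the derivatives of \<open>f\<close> at \<open>s\<close>
  with a basis of \<open>K(x)[s]\<close>; that the leading coefficient at \<open>s\<close> is invertible in this algebra follows from its finite dimension
  (\<open>order_compose_le\<close>).

  Lower bounds rest on two kinds of independence. Exponentials of rational functions that do not differ by constants
  are linearly independent over the rational functions (\<open>exponentials_independent_over_polys\<close>), because a nonzero
  logarithmic derivative is not the derivative of a rational function. Hence an equation satisfied by a sum of such
  exponentials is satisfied by every term, and an equation of order \<open>N\<close> has at most \<open>N\<close> solutions that are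
  independent over the constants (\<open>solutions_dependent_over_constants\<close>). Together they show that a sum of \<open>n\<close>
  exponentials with nonzero rational coefficients has order exactly \<open>n\<close>, which settles the examples for
  derivatives, sums, products and rational substitutions. In the product of the two example functions the exponents are the
  \<open>n m\<close> distinct polynomials \<open>x^k + x^l\<close>.

  Two examples need more. For the antiderivative, an equation of order at most \<open>n\<close> would force a
  rational solution of \<open>y' + k x^(k - 1) y = 1\<close> for all \<open>k\<close> up to \<open>n\<close>, as in Liouville's theory of elementary integration
  (\<open>order_antiderivative_exp_sum_ge\<close>). For branches of \<open>x^(p/q)\<close> there are only \<open>n\<close> terms but the
  order is \<open>n q\<close>. Substituting \<open>x = w^q\<close>, each term yields an edge of the Newton polygon of
  the equation. The \<open>n\<close> edges have distinct slopes, and as these have denominator \<open>q\<close>, each edge has length at least \<open>q\<close>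
  (\<open>order_exp_sum_mult_power_branch_ge\<close>).
\<close>

section \<open>Derivatives of rational functions\<close>

text \<open>
  Multiplicities at a fixed prime polynomial replace the poles of a rational function: over the reals a
  denominator need not have a root, but it always has a prime factor.
\<close>

lemma exists_prime_factor_poly:
  fixes B :: "'a::field poly"
  assumes "degree B > 0"
  shows "\<exists>\<pi>. prime_elem \<pi> \<and> \<pi> dvd B \<and> degree \<pi> > 0"
  using assms
proof (induction "degree B" arbitrary: B rule: less_induct)
  case less
  show ?case
  proof (cases "irreducible B")
    case True
    then have "prime_elem B" by (rule field_poly_irreducible_imp_prime)
    then show ?thesis using less.prems dvd_refl by blast
  next
    case False
    have "B \<noteq> 0" using less.prems by auto
    then have "\<not> is_unit B" using less.prems by (simp add: is_unit_iff_degree)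
    with False obtain a b where ab: "B = a * b" "\<not> is_unit a" "\<not> is_unit b"
      using \<open>B \<noteq> 0\<close> irreducibleI[of B] by blast
    then have nz: "a \<noteq> 0" "b \<noteq> 0" using \<open>B \<noteq> 0\<close> by auto
    then have "degree a > 0" "degree b > 0" using ab by (auto simp: is_unit_iff_degree)
    then have "degree a < degree B" using nz by (simp add: ab(1) degree_mult_eq)
    then obtain \<pi> where "prime_elem \<pi>" "\<pi> dvd a" "degree \<pi> > 0"
      using less.hyps \<open>degree a > 0\<close> by blast
    then show ?thesis using ab(1) by (meson dvd_mult2)
  qed
qed

lemma prime_not_dvd_pderiv:
  fixes \<pi> :: "'a::field_char_0 poly"
  assumes "degree \<pi> > 0"
  shows "\<not> \<pi> dvd pderiv \<pi>"
proof
  assume "\<pi> dvd pderiv \<pi>"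
  moreover have "pderiv \<pi> \<noteq> 0" using assms by (simp add: pderiv_eq_0_iff)
  ultimately have "degree \<pi> \<le> degree (pderiv \<pi>)" by (rule dvd_imp_degree_le)
  with assms show False by (simp add: degree_pderiv)
qed

text \<open>
  Differentiation lowers the degree. The expression is the numerator of the derivative of \<open>u / v\<close>, so
  rational functions have derivatives that decay faster at infinity than they do themselves.
\<close>

lemma degree_wronskian_less:
  fixes u v :: "'a::field_char_0 poly"
  assumes "pderiv u * v - pderiv v * u \<noteq> 0"
  shows "degree (pderiv u * v - pderiv v * u) < degree u + degree v"
proof -
  have *: "degree (pderiv f * g) < degree f + degree g" if "pderiv f * g \<noteq> 0" for f g :: "'a poly"
  proof -
    have "degree f > 0" using that by (auto simp: pderiv_eq_0_iff)
    then show ?thesis using that by (simp add: degree_mult_eq degree_pderiv)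
  qed
  consider "pderiv u * v = 0" | "pderiv v * u = 0" | "pderiv u * v \<noteq> 0" "pderiv v * u \<noteq> 0" by blast
  then show ?thesis
  proof cases
    case 1
    then have "pderiv v * u \<noteq> 0" using assms by auto
    then have "degree (pderiv v * u) < degree v + degree u" by (rule *)
    then show ?thesis by (simp only: 1 diff_0 degree_minus add.commute)
  next
    case 2
    then have "pderiv u * v \<noteq> 0" using assms by auto
    then have "degree (pderiv u * v) < degree u + degree v" by (rule *)
    then show ?thesis by (simp only: 2 diff_0_right)
  next
    case 3
    have "degree (pderiv v * u) < degree u + degree v" using *[of v u] 3(2) by linarith
    then show ?thesis using *[of u v] 3(1) by (intro degree_diff_less)
  qed
qed

text \<open>
  In other words, a rational function with derivative \<open>0\<close> is constant. The multiple of \<open>B\<close> that cancels the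
  coefficient of \<open>A\<close> at the degree of \<open>B\<close> leaves a remainder \<open>U\<close> with the same property, and comparing
  leading coefficients forces a nonzero \<open>U\<close> to have the degree of \<open>B\<close>.
\<close>

lemma wronskian_eq_0_imp_proportional:
  fixes A B :: "'a::field_char_0 poly"
  assumes "pderiv A * B = A * pderiv B" "B \<noteq> 0"
  shows "\<exists>c. A = smult c B"
proof -
  define c where "c = coeff A (degree B) / lead_coeff B"
  define U where "U = A - smult c B"
  have top: "coeff U (degree B) = 0" using assms(2) by (simp add: U_def c_def)
  have eq: "pderiv U * B = U * pderiv B"
    using assms(1) by (simp add: U_def pderiv_diff pderiv_smult algebra_simps)
  have "U = 0"
  proof (rule ccontr)
    assume nz: "U \<noteq> 0"
    have "degree U = degree B"
    proof -
      have "coeff (pderiv U * B) (degree U + degree B - 1) = of_nat (degree U) * lead_coeff U * lead_coeff B"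
      proof (cases "degree U = 0")
        case True
        then have "pderiv U = 0" by (simp add: pderiv_eq_0_iff)
        then show ?thesis by (simp add: True)
      next
        case False
        then have "degree U + degree B - 1 = degree (pderiv U) + degree B" by (simp add: degree_pderiv)
        then show ?thesis using False by (simp only: coeff_mult_degree_sum) (simp add: degree_pderiv coeff_pderiv)
      qed
      moreover have "coeff (U * pderiv B) (degree U + degree B - 1) = lead_coeff U * (of_nat (degree B) * lead_coeff B)"
      proof (cases "degree B = 0")
        case True
        then have "pderiv B = 0" by (simp add: pderiv_eq_0_iff)
        then show ?thesis by (simp add: True)
      next
        case False
        then have "degree U + degree B - 1 = degree U + degree (pderiv B)" by (simp add: degree_pderiv)
        then show ?thesis using False by (simp only: coeff_mult_degree_sum) (simp add: degree_pderiv coeff_pderiv)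
      qed
      ultimately have "of_nat (degree U) * (lead_coeff U * lead_coeff B) = of_nat (degree B) * (lead_coeff U * lead_coeff B)"
        unfolding eq by (simp add: mult_ac)
      then have "(of_nat (degree U) :: 'a) = of_nat (degree B)" using nz assms(2) by simp
      then show ?thesis by (simp only: of_nat_eq_iff)
    qed
    then have "lead_coeff U = 0" using top by simp
    then show False using nz by simp
  qed
  then show ?thesis by (auto simp: U_def)
qed

lemma prime_power_cofactor:
  fixes p x :: "'a::field poly"
  assumes "degree p > 0" "x \<noteq> 0"
  obtains e y where "x = p ^ e * y" "\<not> p dvd y"
proof -
  have "\<exists>e y. x = p ^ e * y \<and> \<not> p dvd y"
    using assms(2)
  proof (induction "degree x" arbitrary: x rule: less_induct)
    case less
    show ?case
    proof (cases "p dvd x")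
      case False
      then have "x = p ^ 0 * x \<and> \<not> p dvd x" by simp
      then show ?thesis by blast
    next
      case True
      then obtain z where z: "x = p * z" by blast
      then have "z \<noteq> 0" "degree z < degree x" using less.prems assms(1) by (auto simp: degree_mult_eq)
      then obtain e y where "z = p ^ e * y" "\<not> p dvd y" using less.hyps by blast
      then have "x = p ^ Suc e * y \<and> \<not> p dvd y" using z by (simp add: mult_ac)
      then show ?thesis by blast
    qed
  qed
  then show thesis using that by blast
qed

text \<open>
  The hypothesis says that the logarithmic derivative of \<open>u / v\<close> equals the derivative of \<open>A / B\<close>, as would
  be the case if \<open>u / v\<close> were a multiple of \<open>exp (A / B)\<close>. A logarithmic derivative has at most simple
  poles, a derivative of a rational function has none of order one, so there are no poles at all. The
  argument is a descent: a prime factor of \<open>B\<close> has to divide \<open>A\<close> and can be cancelled. When \<open>B\<close> has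
  become constant, the left side is too small at infinity.
\<close>

lemma log_derivative_eq_rational_derivative_imp_0:
  fixes A B u v :: "'a::field_char_0 poly"
  assumes "u \<noteq> 0" "v \<noteq> 0" "B \<noteq> 0"
    and "(pderiv u * v - pderiv v * u) * B\<^sup>2 = u * v * (pderiv A * B - A * pderiv B)"
  shows "pderiv A * B = A * pderiv B"
  using assms(3,4)
proof (induction "degree B" arbitrary: A B rule: less_induct)
  case less
  show ?case
  proof (cases "degree B = 0")
    case True
    then obtain b where b: "B = [:b:]" "b \<noteq> 0" using less.prems by (metis degree_eq_zeroE pCons_0_0)
    have eq: "smult b (pderiv u * v - pderiv v * u) = u * v * pderiv A"
    proof -
      have "smult b (smult b (pderiv u * v - pderiv v * u)) = smult b (u * v * pderiv A)"
        using less.prems(2) b by (simp add: power2_eq_square pderiv_pCons mult_ac)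
      then show ?thesis using b by (metis smult_cancel)
    qed
    have "pderiv A = 0"
    proof (rule ccontr)
      assume "pderiv A \<noteq> 0"
      then have nz: "u * v * pderiv A \<noteq> 0" using assms by simp
      then have "pderiv u * v - pderiv v * u \<noteq> 0" using eq by auto
      from degree_wronskian_less[OF this]
      have "degree (u * v * pderiv A) < degree u + degree v" using b by (simp flip: eq)
      then show False using nz by (simp add: degree_mult_eq)
    qed
    then show ?thesis using b by (simp add: pderiv_pCons)
  next
    case False
    then obtain p where p: "prime_elem p" "p dvd B" "degree p > 0"
      using exists_prime_factor_poly by blast
    have p0: "p \<noteq> 0" using p by auto
    have "p dvd A"
    proof (rule ccontr)
      assume nA: "\<not> p dvd A"
      obtain e B0 where B: "B = p ^ e * B0" "\<not> p dvd B0"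
        using prime_power_cofactor[OF p(3) less.prems(1)] .
      obtain a u0 where u: "u = p ^ a * u0" "\<not> p dvd u0"
        using prime_power_cofactor[OF p(3) assms(1)] .
      obtain b v0 where v: "v = p ^ b * v0" "\<not> p dvd v0"
        using prime_power_cofactor[OF p(3) assms(2)] .
      have "e \<noteq> 0" using B p by (metis mult_1 power_0)
      then obtain e' where e: "e = Suc e'" using not0_implies_Suc by blast
      \<comment> \<open>Multiplying by \<open>p\<close> avoids the exponent \<open>k - 1\<close>, and with it a special case for \<open>k = 0\<close>.\<close>
      have pd: "p * pderiv (p ^ k * w) = p ^ k * (of_nat k * pderiv p * w + p * pderiv w)" for k and w :: "'a poly"
        by (cases k) (simp_all add: pderiv_mult pderiv_power_Suc of_nat_poly algebra_simps del: power_Suc,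
          simp_all add: algebra_simps)
      have W1: "p * (pderiv u * v - pderiv v * u) = p ^ (a + b) *
          ((of_nat a * pderiv p * u0 + p * pderiv u0) * v0 - (of_nat b * pderiv p * v0 + p * pderiv v0) * u0)"
      proof -
        have "p * (pderiv u * v - pderiv v * u) = (p * pderiv u) * v - (p * pderiv v) * u"
          by (simp add: algebra_simps)
        also have "\<dots> = p ^ a * (of_nat a * pderiv p * u0 + p * pderiv u0) * v -
            p ^ b * (of_nat b * pderiv p * v0 + p * pderiv v0) * u"
          by (simp only: u(1) v(1) pd)
        finally show ?thesis by (simp add: u(1) v(1) power_add algebra_simps)
      qed
      have W2: "p * (pderiv A * B - A * pderiv B) = p ^ e *
          (p * pderiv A * B0 - A * (of_nat e * pderiv p * B0 + p * pderiv B0))"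
      proof -
        have "p * (pderiv A * B - A * pderiv B) = p * pderiv A * B - A * (p * pderiv B)"
          by (simp add: algebra_simps)
        also have "\<dots> = p * pderiv A * B - A * (p ^ e * (of_nat e * pderiv p * B0 + p * pderiv B0))"
          by (simp only: B(1) pd)
        finally show ?thesis by (simp add: B(1) algebra_simps)
      qed
      define X where "X = (of_nat a * pderiv p * u0 + p * pderiv u0) * v0 - (of_nat b * pderiv p * v0 + p * pderiv v0) * u0"
      have "p ^ (a + b) * p ^ e * (p ^ e * X * B0\<^sup>2) =
        p * ((pderiv u * v - pderiv v * u) * B\<^sup>2)"
      proof -
        have "p * ((pderiv u * v - pderiv v * u) * B\<^sup>2) = (p ^ (a + b) * X) * B\<^sup>2"
          using W1 by (simp add: X_def mult.assoc [symmetric])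
        then show ?thesis by (simp add: B(1) power2_eq_square algebra_simps)
      qed
      also have "\<dots> = u * v * (p * (pderiv A * B - A * pderiv B))"
        using less.prems(2) by (simp add: mult_ac)
      also have "\<dots> = p ^ (a + b) * p ^ e * (u0 * v0 * (p * pderiv A * B0 - A * (of_nat e * pderiv p * B0 + p * pderiv B0)))"
        by (simp only: W2 u(1) v(1)) (simp add: power_add mult_ac)
      finally have "p ^ e * X * B0\<^sup>2 = u0 * v0 * (p * pderiv A * B0 - A * (of_nat e * pderiv p * B0 + p * pderiv B0))"
        using p0 by simp
      \<comment> \<open>The pole of order \<open>e + 1\<close> on the right side has the coefficient below, which must
        therefore be divisible by \<open>p\<close>; none of its factors is.\<close>
      then have "u0 * v0 * A * of_nat e * pderiv p * B0 =
          p * (u0 * v0 * (pderiv A * B0 - A * pderiv B0) - p ^ e' * X * B0\<^sup>2)"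
        by (simp add: e algebra_simps)
      then have "p dvd u0 * v0 * A * of_nat e * pderiv p * B0" by simp
      then have "p dvd (of_nat e :: 'a poly) \<or> p dvd pderiv p"
        using u(2) v(2) B(2) nA by (auto simp: prime_elem_dvd_mult_iff[OF p(1)])
      moreover have "\<not> p dvd (of_nat e :: 'a poly)"
      proof
        assume "p dvd (of_nat e :: 'a poly)"
        then have "degree p \<le> degree (of_nat e :: 'a poly)" by (rule dvd_imp_degree_le) (simp add: e del: of_nat_Suc)
        then show False using p(3) by simp
      qed
      ultimately show False using prime_not_dvd_pderiv[OF p(3)] by blast
    qed
    then obtain A1 where A1: "A = p * A1" by blast
    obtain B1 where B1: "B = p * B1" using p(2) by blast
    have "B1 \<noteq> 0" using less.prems B1 by auto
    have red: "pderiv A * B - A * pderiv B = p\<^sup>2 * (pderiv A1 * B1 - A1 * pderiv B1)"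
      by (simp add: A1 B1 pderiv_mult power2_eq_square algebra_simps)
    have "p\<^sup>2 * ((pderiv u * v - pderiv v * u) * B1\<^sup>2) = p\<^sup>2 * (u * v * (pderiv A1 * B1 - A1 * pderiv B1))"
      using less.prems(2) unfolding red by (simp add: B1 power_mult_distrib mult_ac)
    then have "(pderiv u * v - pderiv v * u) * B1\<^sup>2 = u * v * (pderiv A1 * B1 - A1 * pderiv B1)"
      using p0 by simp
    moreover have "degree B1 < degree B" using \<open>B1 \<noteq> 0\<close> p0 p(3) by (simp add: B1 degree_mult_eq)
    ultimately have "pderiv A1 * B1 = A1 * pderiv B1" using less.hyps \<open>B1 \<noteq> 0\<close> by blast
    then show ?thesis using red by simp
  qed
qed

text \<open>
  Liouville's argument that \<open>exp (x ^ (k + 1))\<close> has no elementary integral, for which \<open>c = k + 1\<close>: if \<open>G / b\<close> times this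
  exponential were a primitive of it, then \<open>G / b\<close> would solve \<open>y' + c x^k y = 1\<close>. The degrees give
  \<open>degree b = k + degree G\<close>, so \<open>b\<close> is not constant, and a prime factor of \<open>b\<close> that does not divide \<open>G\<close>
  would be a pole of higher order in \<open>y'\<close> than in \<open>y\<close>. Hence it can be cancelled, and the descent never ends.
\<close>

lemma exp_monomial_no_rational_primitive:
  fixes b G :: "'a::field_char_0 poly"
  assumes "b \<noteq> 0" "c \<noteq> 0" "k \<ge> 1"
  shows "b * pderiv G - pderiv b * G + monom c k * b * G \<noteq> b\<^sup>2"
  using assms(1)
proof (induction "degree b" arbitrary: b G rule: less_induct)
  case less
  show ?case
  proof
    assume eq: "b * pderiv G - pderiv b * G + monom c k * b * G = b\<^sup>2"
    have "G \<noteq> 0" using eq less.prems by auto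
    have deg: "degree b = k + degree G"
    proof -
      have L: "degree (monom c k * b * G) = k + degree b + degree G"
        using \<open>G \<noteq> 0\<close> less.prems assms(2) by (simp add: degree_mult_eq degree_monom_eq)
      have "degree (b * pderiv G - pderiv b * G) < degree (monom c k * b * G)"
      proof (cases "b * pderiv G - pderiv b * G = 0")
        case True then show ?thesis using L assms by simp
      next
        case False
        then have "degree (pderiv G * b - pderiv b * G) < degree G + degree b"
          by (intro degree_wronskian_less) (simp add: mult.commute)
        then show ?thesis using L by (simp add: mult.commute)
      qed
      then have "degree (b\<^sup>2) = k + degree b + degree G"
        using degree_add_eq_right[of "b * pderiv G - pderiv b * G"] L eq by metis
      then show ?thesis using less.prems by (simp add: degree_power_eq)
    qed
    then have "degree b > 0" using assms by simp
    then obtain p where p: "prime_elem p" "p dvd b" "degree p > 0"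
      using exists_prime_factor_poly by blast
    have p0: "p \<noteq> 0" using p by auto
    have "p dvd G"
    proof (rule ccontr)
      assume nG: "\<not> p dvd G"
      obtain e b0 where b: "b = p ^ e * b0" "\<not> p dvd b0"
        using prime_power_cofactor[OF p(3) less.prems] .
      have "e \<noteq> 0" using b p by (metis mult_1 power_0)
      then obtain e' where e: "e = Suc e'" using not0_implies_Suc by blast
      have pb: "pderiv b = p ^ e' * (of_nat e * pderiv p * b0 + p * pderiv b0)"
        by (simp add: b e pderiv_mult pderiv_power_Suc of_nat_poly algebra_simps del: power_Suc)
          (simp add: algebra_simps)
      have "p ^ e' * (p * (b0 * pderiv G - pderiv b0 * G + monom c k * b0 * G - p ^ e' * p * b0\<^sup>2)) =
          p ^ e' * (of_nat e * pderiv p * b0 * G)"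
        using eq unfolding pb by (simp add: b e power2_eq_square algebra_simps)
      then have "p * (b0 * pderiv G - pderiv b0 * G + monom c k * b0 * G - p ^ e' * p * b0\<^sup>2) =
          of_nat e * pderiv p * b0 * G" using p0 by simp
      then have "p dvd of_nat e * pderiv p * b0 * G" by (metis dvd_triv_left)
      then have "p dvd (of_nat e :: 'a poly) \<or> p dvd pderiv p"
        using b(2) nG by (auto simp: prime_elem_dvd_mult_iff[OF p(1)])
      moreover have "\<not> p dvd (of_nat e :: 'a poly)"
      proof
        assume "p dvd (of_nat e :: 'a poly)"
        then have "degree p \<le> degree (of_nat e :: 'a poly)" by (rule dvd_imp_degree_le) (simp add: e del: of_nat_Suc)
        then show False using p(3) by simp
      qed
      ultimately show False using prime_not_dvd_pderiv[OF p(3)] by blast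
    qed
    then obtain G1 where G1: "G = p * G1" by blast
    obtain b1 where b1: "b = p * b1" using p(2) by blast
    have "b1 \<noteq> 0" using less.prems b1 by auto
    have "p\<^sup>2 * (b1 * pderiv G1 - pderiv b1 * G1 + monom c k * b1 * G1) = p\<^sup>2 * b1\<^sup>2"
      using eq by (simp add: b1 G1 pderiv_mult power2_eq_square algebra_simps)
    then have "b1 * pderiv G1 - pderiv b1 * G1 + monom c k * b1 * G1 = b1\<^sup>2" using p0 by simp
    moreover have "degree b1 < degree b" using \<open>b1 \<noteq> 0\<close> p0 p(3) by (simp add: b1 degree_mult_eq)
    ultimately show False using less.hyps \<open>b1 \<noteq> 0\<close> by blast
  qed
qed

text \<open>
  The case \<open>k = 0\<close> does have a solution of \<open>y' + y = 1\<close>, namely \<open>y = 1\<close>. It is the only rational one, since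
  the difference of two solutions satisfies \<open>y' = - y\<close>, which the degrees exclude.
\<close>

lemma exp_rational_primitive_unique:
  fixes b G :: "'a::field_char_0 poly"
  assumes "b \<noteq> 0" and eq: "b * pderiv G - pderiv b * G + b * G = b\<^sup>2"
  shows "G = b"
proof (rule ccontr)
  assume "G \<noteq> b"
  define U where "U = G - b"
  have "U \<noteq> 0" using \<open>G \<noteq> b\<close> by (simp add: U_def)
  have e: "pderiv b * U - pderiv U * b = b * U"
    using eq by (simp add: U_def pderiv_diff power2_eq_square algebra_simps)
  then have "degree (b * U) < degree b + degree U"
    using degree_wronskian_less[of b U] \<open>U \<noteq> 0\<close> \<open>b \<noteq> 0\<close> by simp
  then show False using \<open>U \<noteq> 0\<close> \<open>b \<noteq> 0\<close> by (simp add: degree_mult_eq)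
qed

section \<open>Smooth functions\<close>

lemma infinite_if_open_nonempty:
  fixes E :: "'a::real_normed_field set"
  assumes "open E" "E \<noteq> {}"
  shows "infinite E"
  using assms finite_imp_not_open by blast

lemma open_diff_finite:
  fixes E :: "'a::real_normed_field set"
  assumes "open E" "finite Z"
  shows "open (E - Z)"
  using assms by (simp add: finite_imp_closed open_Diff)

lemma open_minus_poly_roots:
  fixes E :: "'a::real_normed_field set"
  assumes "open E" "E \<noteq> {}" "p \<noteq> 0"
  shows "open (E - {x. poly p x = 0})" "E - {x. poly p x = 0} \<noteq> {}"
proof -
  have fin: "finite {x. poly p x = 0}" using assms(3) by (rule poly_roots_finite)
  then show "open (E - {x. poly p x = 0})" using assms(1) open_diff_finite by blast
  show "E - {x. poly p x = 0} \<noteq> {}"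
    using infinite_if_open_nonempty[OF assms(1,2)] fin by (metis Diff_eq_empty_iff finite_subset)
qed

lemma poly_eq_0_if_zero_on_open:
  fixes E :: "'a::real_normed_field set"
  assumes "open E" "E \<noteq> {}" "\<And>x. x \<in> E \<Longrightarrow> poly p x = 0"
  shows "p = 0"
  using open_minus_poly_roots(2)[OF assms(1,2), of p] assms(3) by blast

lemma higher_deriv_eqI:
  assumes "open D"
    and "\<And>x. x \<in> D \<Longrightarrow> g 0 x = f x"
    and der: "\<And>k x. x \<in> D \<Longrightarrow> (g k has_field_derivative g (Suc k) x) (at x)"
    and "x \<in> D"
  shows "(deriv ^^ k) f x = g k x"
proof -
  have "\<forall>x\<in>D. (deriv ^^ k) f x = g k x"
  proof (induction k)
    case 0
    then show ?case using assms(2) by simp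
  next
    case (Suc k)
    show ?case
    proof
      fix x assume "x \<in> D"
      have "((deriv ^^ k) f has_field_derivative g (Suc k) x) (at x)"
        using has_field_derivative_transform_within_open[OF der[OF \<open>x \<in> D\<close>] \<open>open D\<close> \<open>x \<in> D\<close>]
          Suc.IH by metis
      then show "(deriv ^^ Suc k) f x = g (Suc k) x" by (simp add: DERIV_imp_deriv)
    qed
  qed
  then show ?thesis using \<open>x \<in> D\<close> by blast
qed

lemma smooth_on_has_field_derivative:
  assumes "smooth_on D f" "x \<in> D"
  shows "((deriv ^^ k) f has_field_derivative (deriv ^^ Suc k) f x) (at x)"
  using assms by (simp add: smooth_on_def DERIV_deriv_iff_field_differentiable)

lemma smooth_on_DERIV:
  assumes "smooth_on D f" "x \<in> D"
  shows "(f has_field_derivative deriv f x) (at x)"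
  using smooth_on_has_field_derivative[OF assms, of 0] by simp

lemma smooth_on_subset: "smooth_on D f \<Longrightarrow> E \<subseteq> D \<Longrightarrow> smooth_on E f"
  by (auto simp: smooth_on_def)

lemma smooth_on_deriv: "smooth_on D f \<Longrightarrow> smooth_on D (deriv f)"
  unfolding smooth_on_def by (metis funpow_Suc_right o_apply)

lemma smooth_on_higher_deriv: "smooth_on D f \<Longrightarrow> smooth_on D ((deriv ^^ k) f)"
  by (induction k) (simp_all add: smooth_on_deriv)

lemma smooth_on_continuous_on: "smooth_on D f \<Longrightarrow> continuous_on D f"
  by (meson DERIV_isCont continuous_at_imp_continuous_on smooth_on_DERIV)

lemma smooth_on_cong:
  assumes "smooth_on D f" "open D" "\<And>x. x \<in> D \<Longrightarrow> g x = f x"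
  shows "smooth_on D g"
  using assms(2) by (rule smooth_onI[where g = "\<lambda>k. (deriv ^^ k) f"])
    (use assms smooth_on_has_field_derivative in auto)

lemma higher_deriv_cong:
  assumes "smooth_on D f" "open D" "\<And>x. x \<in> D \<Longrightarrow> g x = f x" "x \<in> D"
  shows "(deriv ^^ k) g x = (deriv ^^ k) f x"
  using assms(2) by (rule higher_deriv_eqI)
    (use assms smooth_on_has_field_derivative in auto)

text \<open>
  Smoothness of compound expressions is proved coinductively: a set of functions that contains, up to
  equality on the open set, the derivative of each of its members consists of smooth functions. Such sets arise as
  closures under sums and products, because the closure inherits the property from its generators.
\<close>

inductive_set sum_prod_closure :: "('a::real_normed_field \<Rightarrow> 'a) set \<Rightarrow> ('a \<Rightarrow> 'a) set"
  for G where
    base: "f \<in> G \<Longrightarrow> f \<in> sum_prod_closure G"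
  | add: "f \<in> sum_prod_closure G \<Longrightarrow> g \<in> sum_prod_closure G \<Longrightarrow> (\<lambda>x. f x + g x) \<in> sum_prod_closure G"
  | mult: "f \<in> sum_prod_closure G \<Longrightarrow> g \<in> sum_prod_closure G \<Longrightarrow> (\<lambda>x. f x * g x) \<in> sum_prod_closure G"

lemma smooth_on_sum_prod_closure:
  assumes "open D"
    and base: "\<And>g. g \<in> G \<Longrightarrow> \<exists>h\<in>sum_prod_closure G. \<forall>x\<in>D. (g has_field_derivative h x) (at x)"
    and "f \<in> sum_prod_closure G"
  shows "smooth_on D f"
proof -
  have "\<exists>h\<in>sum_prod_closure G. \<forall>x\<in>D. (g has_field_derivative h x) (at x)" if "g \<in> sum_prod_closure G" for g
    using that
  proof induction
    case (base f)
    then show ?case by (rule assms(2))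
  next
    case (add f g)
    then obtain f' g' where "f' \<in> sum_prod_closure G" "g' \<in> sum_prod_closure G"
      "\<forall>x\<in>D. (f has_field_derivative f' x) (at x)" "\<forall>x\<in>D. (g has_field_derivative g' x) (at x)" by blast
    then show ?case
      by (intro bexI[of _ "\<lambda>x. f' x + g' x"]) (auto intro: sum_prod_closure.add DERIV_add)
  next
    case (mult f g)
    then obtain f' g' where "f' \<in> sum_prod_closure G" "g' \<in> sum_prod_closure G"
      "\<forall>x\<in>D. (f has_field_derivative f' x) (at x)" "\<forall>x\<in>D. (g has_field_derivative g' x) (at x)" by blast
    then show ?case using mult.hyps
      by (intro bexI[of _ "\<lambda>x. f' x * g x + g' x * f x"])
        (auto intro: sum_prod_closure.add sum_prod_closure.mult DERIV_mult)
  qed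
  then obtain \<delta> where \<delta>: "\<And>g. g \<in> sum_prod_closure G \<Longrightarrow> \<delta> g \<in> sum_prod_closure G"
    "\<And>g x. g \<in> sum_prod_closure G \<Longrightarrow> x \<in> D \<Longrightarrow> (g has_field_derivative \<delta> g x) (at x)"
    by metis
  have "(\<delta> ^^ k) f \<in> sum_prod_closure G" for k
    by (induction k) (use assms(3) \<delta>(1) in auto)
  then show ?thesis
    by (intro smooth_onI[OF assms(1), of "\<lambda>k. (\<delta> ^^ k) f"]) (auto intro: \<delta>(2))
qed

lemma
  assumes "open D" "smooth_on D f" "smooth_on D g"
  shows smooth_on_add: "smooth_on D (\<lambda>x. f x + g x)"
    and smooth_on_mult: "smooth_on D (\<lambda>x. f x * g x)"
proof -
  have base: "\<exists>h\<in>sum_prod_closure {f. smooth_on D f}. \<forall>x\<in>D. (g has_field_derivative h x) (at x)"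
    if "g \<in> {f. smooth_on D f}" for g
    using that by (intro bexI[of _ "deriv g"]) (auto intro: sum_prod_closure.base smooth_on_deriv smooth_on_DERIV)
  have "f \<in> sum_prod_closure {f. smooth_on D f}" "g \<in> sum_prod_closure {f. smooth_on D f}"
    using assms by (auto intro: sum_prod_closure.base)
  then show "smooth_on D (\<lambda>x. f x + g x)" "smooth_on D (\<lambda>x. f x * g x)"
    using smooth_on_sum_prod_closure[OF assms(1) base]
      sum_prod_closure.add[of f _ g] sum_prod_closure.mult[of f _ g] by blast+
qed

text \<open>
  The derivative of \<open>u \<circ> s\<close> is a product of \<open>u' \<circ> s\<close> and a smooth function, so the smooth functions together with all
  compositions with \<open>s\<close> generate a suitable closure.
\<close>

lemma smooth_on_compose:
  assumes "open E" "smooth_on E s" "smooth_on D u" "s ` E \<subseteq> D"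
  shows "smooth_on E (\<lambda>x. u (s x))"
proof -
  define G where "G = {v. smooth_on E v} \<union> {\<lambda>x. u (s x) |u. smooth_on D u}"
  have "\<exists>h\<in>sum_prod_closure G. \<forall>x\<in>E. (g has_field_derivative h x) (at x)" if "g \<in> G" for g
  proof -
    consider "smooth_on E g" | v where "g = (\<lambda>x. v (s x))" "smooth_on D v"
      using \<open>g \<in> G\<close> by (auto simp: G_def)
    then show ?thesis
    proof cases
      case 1
      then show ?thesis
        by (intro bexI[of _ "deriv g"]) (auto simp: G_def intro: sum_prod_closure.base smooth_on_deriv smooth_on_DERIV)
    next
      case 2
      show ?thesis
      proof (rule bexI[of _ "\<lambda>x. deriv v (s x) * deriv s x"])
        show "\<forall>x\<in>E. (g has_field_derivative deriv v (s x) * deriv s x) (at x)"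
        proof
          fix x assume "x \<in> E"
          then have "s x \<in> D" using assms(4) by blast
          show "(g has_field_derivative deriv v (s x) * deriv s x) (at x)"
            unfolding 2(1)
            by (rule DERIV_chain2[OF smooth_on_DERIV[OF 2(2) \<open>s x \<in> D\<close>] smooth_on_DERIV[OF assms(2) \<open>x \<in> E\<close>]])
        qed
        have "(\<lambda>x. deriv v (s x)) \<in> G" "deriv s \<in> G"
          using smooth_on_deriv[OF 2(2)] smooth_on_deriv[OF assms(2)] by (auto simp: G_def)
        then show "(\<lambda>x. deriv v (s x) * deriv s x) \<in> sum_prod_closure G"
          by (intro sum_prod_closure.mult sum_prod_closure.base)
      qed
    qed
  qed
  moreover have "(\<lambda>x. u (s x)) \<in> sum_prod_closure G"
    using assms(3) by (auto simp: G_def intro!: sum_prod_closure.base)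
  ultimately show ?thesis using smooth_on_sum_prod_closure[OF assms(1)] by blast
qed

lemma smooth_on_poly_inverse:
  assumes "open E" "\<And>x. x \<in> E \<Longrightarrow> poly Q x \<noteq> 0"
  shows "smooth_on E (\<lambda>x. poly P x * inverse (poly Q x))"
proof -
  define G where "G = insert (\<lambda>x. inverse (poly Q x)) (range (poly :: 'a poly \<Rightarrow> _))"
  have iG: "(\<lambda>x. inverse (poly Q x)) \<in> sum_prod_closure G" "poly p \<in> sum_prod_closure G" for p
    by (auto simp: G_def intro: sum_prod_closure.base)
  have base: "\<exists>h\<in>sum_prod_closure G. \<forall>x\<in>E. (g has_field_derivative h x) (at x)" if "g \<in> G" for g
  proof -
    consider p where "g = poly p" | "g = (\<lambda>x. inverse (poly Q x))"
      using \<open>g \<in> G\<close> by (auto simp: G_def)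
    then show ?thesis
    proof cases
      case 1
      then show ?thesis by (intro bexI[of _ "poly (pderiv p)"]) (auto intro: iG)
    next
      case 2
      have "(g has_field_derivative poly (- pderiv Q) x * (inverse (poly Q x) * inverse (poly Q x))) (at x)"
        if "x \<in> E" for x
        unfolding 2 using DERIV_inverse'[OF poly_DERIV[of Q x] assms(2)[OF that]] by (simp add: mult_ac)
      moreover have "(\<lambda>x. poly (- pderiv Q) x * (inverse (poly Q x) * inverse (poly Q x))) \<in> sum_prod_closure G"
        by (rule sum_prod_closure.mult[OF iG(2) sum_prod_closure.mult[OF iG(1) iG(1)]])
      ultimately show ?thesis
        by (intro bexI[of _ "\<lambda>x. poly (- pderiv Q) x * (inverse (poly Q x) * inverse (poly Q x))"] ballI)
    qed
  qed
  have prod: "(\<lambda>x. poly P x * inverse (poly Q x)) \<in> sum_prod_closure G"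
    using iG(2) iG(1) by (rule sum_prod_closure.mult)
  show ?thesis
  proof (rule smooth_on_sum_prod_closure[OF assms(1) _ prod])
    fix g assume "g \<in> G"
    then show "\<exists>h\<in>sum_prod_closure G. \<forall>x\<in>E. (g has_field_derivative h x) (at x)"
      by (rule base)
  qed
qed

lemma smooth_on_poly_divide:
  assumes "open E" "\<And>x. x \<in> E \<Longrightarrow> poly Q x \<noteq> 0"
  shows "smooth_on E (\<lambda>x. poly P x / poly Q x)"
  using smooth_on_poly_inverse[OF assms] by (simp add: divide_inverse)

lemma smooth_on_poly: "open E \<Longrightarrow> smooth_on E (poly p)"
  using smooth_on_poly_divide[of E 1 p] by simp

lemma smooth_on_sum:
  assumes "open D" "finite I" "\<And>i. i \<in> I \<Longrightarrow> smooth_on D (f i)"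
  shows "smooth_on D (\<lambda>x. \<Sum>i\<in>I. f i x)"
  using assms(2,3)
proof (induction I rule: finite_induct)
  case empty
  have "poly 0 = (\<lambda>x::'a. 0)" by auto
  then show ?case using smooth_on_poly[OF assms(1), of 0] by simp
next
  case (insert i I)
  then show ?case using smooth_on_add[OF assms(1)] by simp
qed

lemma higher_deriv_sum:
  assumes "open D" "\<And>i. i \<in> I \<Longrightarrow> smooth_on D (f i)" "x \<in> D"
  shows "(deriv ^^ k) (\<lambda>x. \<Sum>i\<in>I. f i x) x = (\<Sum>i\<in>I. (deriv ^^ k) (f i) x)"
proof (rule higher_deriv_eqI[OF assms(1)])
  fix k x assume "x \<in> D"
  then show "((\<lambda>x. \<Sum>i\<in>I. (deriv ^^ k) (f i) x) has_field_derivative (\<Sum>i\<in>I. (deriv ^^ Suc k) (f i) x)) (at x)"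
    using smooth_on_has_field_derivative[OF assms(2)] by (intro DERIV_sum) blast
qed (use assms(3) in simp_all)

lemma higher_deriv_product:
  assumes "open D" "smooth_on D f" "smooth_on D g" "x \<in> D"
  shows "(deriv ^^ k) (\<lambda>x. f x * g x) x =
    (\<Sum>l\<le>k. of_nat (k choose l) * (deriv ^^ (k - l)) f x * (deriv ^^ l) g x)"
  using assms(1)
proof (rule higher_deriv_eqI)
  fix k x assume x: "x \<in> D"
  let ?f = "\<lambda>k. (deriv ^^ k) f x" and ?g = "\<lambda>k. (deriv ^^ k) g x"
  have "(\<Sum>l\<le>k. of_nat (k choose l) * (?f (k - l) * ?g (Suc l) + ?f (Suc k - l) * ?g l)) =
      (\<Sum>l\<le>k. of_nat (k choose l) * ?f (k - l) * ?g (Suc l)) +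
      (\<Sum>l\<le>Suc k. of_nat (k choose l) * ?f (Suc k - l) * ?g l)"
    by (simp add: sum.distrib algebra_simps)
  also have "(\<Sum>l\<le>Suc k. of_nat (k choose l) * ?f (Suc k - l) * ?g l) =
      ?f (Suc k) * ?g 0 + (\<Sum>l\<le>k. of_nat (k choose Suc l) * ?f (k - l) * ?g (Suc l))"
    by (subst sum.atMost_Suc_shift) simp
  also have "(\<Sum>l\<le>k. of_nat (k choose l) * ?f (k - l) * ?g (Suc l)) + \<dots> =
      ?f (Suc k) * ?g 0 + (\<Sum>l\<le>k. of_nat (Suc k choose Suc l) * ?f (k - l) * ?g (Suc l))"
    by (simp add: sum.distrib algebra_simps)
  also have "\<dots> = (\<Sum>l\<le>Suc k. of_nat (Suc k choose l) * ?f (Suc k - l) * ?g l)"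
    by (subst sum.atMost_Suc_shift) simp
  finally have eq: "(\<Sum>l\<le>k. of_nat (k choose l) * (?f (k - l) * ?g (Suc l) + ?f (Suc k - l) * ?g l)) =
      (\<Sum>l\<le>Suc k. of_nat (Suc k choose l) * ?f (Suc k - l) * ?g l)" .
  have "((\<lambda>x. \<Sum>l\<le>k. of_nat (k choose l) * ((deriv ^^ (k - l)) f x * (deriv ^^ l) g x)) has_field_derivative
    (\<Sum>l\<le>k. of_nat (k choose l) * (?f (k - l) * ?g (Suc l) + ?f (Suc k - l) * ?g l))) (at x)"
  proof (intro DERIV_sum DERIV_cmult)
    fix l assume "l \<in> {..k}"
    then have "Suc k - l = Suc (k - l)" by simp
    then show "((\<lambda>x. (deriv ^^ (k - l)) f x * (deriv ^^ l) g x) has_field_derivative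
        ?f (k - l) * ?g (Suc l) + ?f (Suc k - l) * ?g l) (at x)"
      using DERIV_mult[OF smooth_on_has_field_derivative[OF assms(2) x, of "k - l"]
        smooth_on_has_field_derivative[OF assms(3) x, of l]] by (simp only: add.commute mult.commute)
  qed
  then show "((\<lambda>x. \<Sum>l\<le>k. of_nat (k choose l) * (deriv ^^ (k - l)) f x * (deriv ^^ l) g x) has_field_derivative
     (\<Sum>l\<le>Suc k. of_nat (Suc k choose l) * ?f (Suc k - l) * ?g l)) (at x)"
    unfolding eq by (simp only: mult.assoc)
qed (use assms(4) in simp_all)

section \<open>Sums of exponentials of rational functions\<close>

lemma sum_triangle_swap:
  fixes t :: "nat \<Rightarrow> nat \<Rightarrow> 'a::comm_monoid_add"
  shows "(\<Sum>j\<le>n. \<Sum>l\<le>j. t j l) = (\<Sum>l\<le>n. \<Sum>j=l..n. t j l)"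
  unfolding sum.Sigma[OF finite_atMost ballI[OF finite_atMost]]
    sum.Sigma[OF finite_atMost ballI[OF finite_atLeastAtMost]]
  by (rule sum.reindex_bij_witness[of _ "\<lambda>(l, j). (j, l)" "\<lambda>(j, l). (l, j)"]) auto

text \<open>
  A linear differential equation of order \<open>N\<close> has at most \<open>N\<close> solutions that are independent over the
  constants. Reduction of order proves this without an existence or uniqueness theorem: if a solution
  \<open>u\<close> has no zeros, then the derivatives of the quotients \<open>f i / u\<close> of the other solutions satisfy an equation of order
  one less, and a linear relation between these derivatives integrates to a relation between the solutions. The
  open set has to shrink, first to where \<open>u\<close> does not vanish and then to a ball, on which zero derivative
  implies constancy.
\<close>

lemma solutions_dependent_over_constants:
  fixes f :: "'i \<Rightarrow> 'a::real_normed_field \<Rightarrow> 'a"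
  assumes "open E" "E \<noteq> {}" "finite I" "card I > N"
    and "\<And>i. i \<in> I \<Longrightarrow> smooth_on E (f i)"
    and "\<And>x. x \<in> E \<Longrightarrow> c N x \<noteq> 0"
    and "\<And>i x. i \<in> I \<Longrightarrow> x \<in> E \<Longrightarrow> (\<Sum>j\<le>N. c j x * (deriv ^^ j) (f i) x) = 0"
  shows "\<exists>E' a. open E' \<and> E' \<noteq> {} \<and> E' \<subseteq> E \<and> (\<exists>i\<in>I. a i \<noteq> 0) \<and>
    (\<forall>x\<in>E'. (\<Sum>i\<in>I. a i * f i x) = 0)"
  using assms
proof (induction N arbitrary: E I f c)
  case 0
  then obtain i where "i \<in> I" by (metis card.empty ex_in_conv less_irrefl)
  have "f i x = 0" if "x \<in> E" for x
    using "0.prems"(6)[OF that] "0.prems"(7)[OF \<open>i \<in> I\<close> that] by simp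
  then have "(\<Sum>k\<in>I. (if k = i then 1 else 0) * f k x) = 0" if "x \<in> E" for x
    using that by (intro sum.neutral) auto
  then show ?case using "0.prems"(1,2) \<open>i \<in> I\<close>
    by (intro exI[of _ E] exI[of _ "\<lambda>k. if k = i then 1 else 0"]) auto
next
  case (Suc N)
  obtain i0 where i0: "i0 \<in> I" using Suc.prems(4) by (metis card.empty ex_in_conv not_less_zero)
  show ?case
  proof (cases "\<forall>x\<in>E. f i0 x = 0")
    case True
    then have "(\<Sum>k\<in>I. (if k = i0 then 1 else 0) * f k x) = 0" if "x \<in> E" for x
      using that by (intro sum.neutral) auto
    then show ?thesis using Suc.prems(1,2) i0
      by (intro exI[of _ E] exI[of _ "\<lambda>k. if k = i0 then 1 else 0"]) auto
  next
    case False
    define u where "u = f i0"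
    have su: "smooth_on E u" using Suc.prems(5) i0 by (simp add: u_def)
    define E1 where "E1 = E \<inter> u -` (- {0})"
    have E1: "open E1" "E1 \<noteq> {}" "E1 \<subseteq> E" "\<And>x. x \<in> E1 \<Longrightarrow> u x \<noteq> 0"
      using continuous_open_preimage[OF smooth_on_continuous_on[OF su] Suc.prems(1), of "- {0}"] False
      by (auto simp: E1_def u_def)
    have su1: "smooth_on E1 u" using su E1(3) by (rule smooth_on_subset)
    have "smooth_on (- {0}) (\<lambda>y::'a. 1 / y)"
      using smooth_on_poly_divide[of "- {0}" "[:0, 1:]" 1] by (simp add: open_Compl)
    then have sinv: "smooth_on E1 (\<lambda>x. 1 / u x)"
      by (rule smooth_on_compose[OF E1(1) su1]) (use E1(4) in auto)
    define z where "z i x = f i x * (1 / u x)" for i x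
    have sz: "smooth_on E1 (z i)" if "i \<in> I" for i
      unfolding z_def
      using smooth_on_mult[OF E1(1) smooth_on_subset[OF Suc.prems(5)[OF that] E1(3)] sinv] .
    have fz: "f i x = u x * z i x" if "x \<in> E1" for i x
      using E1(4)[OF that] by (simp add: z_def)
    \<comment> \<open>The coefficients of the equation for the quotients \<open>z i\<close>, by the Leibniz rule. The coefficient
      \<open>b 0\<close> vanishes because \<open>u\<close>, that is, the quotient \<open>1\<close>, is a solution.\<close>
    define b where "b l x = (\<Sum>j=l..Suc N. c j x * of_nat (j choose l) * (deriv ^^ (j - l)) u x)" for l x
    have expand: "(\<Sum>j\<le>Suc N. c j x * (deriv ^^ j) (f i) x) = (\<Sum>l\<le>Suc N. b l x * (deriv ^^ l) (z i) x)"
      if "i \<in> I" "x \<in> E1" for i x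
    proof -
      have "(deriv ^^ j) (f i) x = (\<Sum>l\<le>j. of_nat (j choose l) * (deriv ^^ (j - l)) u x * (deriv ^^ l) (z i) x)" for j
        using higher_deriv_cong[OF smooth_on_mult[OF E1(1) su1 sz[OF that(1)]] E1(1) fz that(2)]
          higher_deriv_product[OF E1(1) su1 sz[OF that(1)] that(2)] by metis
      then have "(\<Sum>j\<le>Suc N. c j x * (deriv ^^ j) (f i) x) =
          (\<Sum>j\<le>Suc N. \<Sum>l\<le>j. c j x * of_nat (j choose l) * (deriv ^^ (j - l)) u x * (deriv ^^ l) (z i) x)"
        by (simp add: sum_distrib_left mult.assoc)
      also have "\<dots> = (\<Sum>l\<le>Suc N. \<Sum>j=l..Suc N. c j x * of_nat (j choose l) * (deriv ^^ (j - l)) u x * (deriv ^^ l) (z i) x)"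
        by (rule sum_triangle_swap)
      finally show ?thesis by (simp only: b_def sum_distrib_right)
    qed
    have b0: "b 0 x = 0" if "x \<in> E1" for x
      using Suc.prems(7)[OF i0, of x] that E1(3) by (auto simp: b_def u_def atLeast0AtMost)
    have bN: "b (Suc N) x \<noteq> 0" if "x \<in> E1" for x
      using Suc.prems(6)[of x] that E1(3,4) by (auto simp: b_def)
    define I' where "I' = I - {i0}"
    have "\<exists>E' a. open E' \<and> E' \<noteq> {} \<and> E' \<subseteq> E1 \<and> (\<exists>i\<in>I'. a i \<noteq> 0) \<and>
        (\<forall>x\<in>E'. (\<Sum>i\<in>I'. a i * deriv (z i) x) = 0)"
    proof (rule Suc.IH[where c = "\<lambda>l. b (Suc l)"])
      show "finite I'" "N < card I'" using Suc.prems(3,4) i0 by (auto simp: I'_def)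
      show "smooth_on E1 (deriv (z i))" if "i \<in> I'" for i
        using sz that by (auto simp: I'_def intro: smooth_on_deriv)
      show "(\<Sum>j\<le>N. b (Suc j) x * (deriv ^^ j) (deriv (z i)) x) = 0" if "i \<in> I'" "x \<in> E1" for i x
      proof -
        have "i \<in> I" "x \<in> E" using that E1(3) by (auto simp: I'_def)
        then have "(\<Sum>l\<le>Suc N. b l x * (deriv ^^ l) (z i) x) = 0"
          using Suc.prems(7) by (simp only: expand[OF \<open>i \<in> I\<close> \<open>x \<in> E1\<close>, symmetric])
        then show ?thesis using b0[OF \<open>x \<in> E1\<close>]
          by (subst (asm) sum.atMost_Suc_shift) (simp add: funpow_Suc_right del: funpow.simps)
      qed
    qed (use E1 bN in auto)
    then obtain E2 a where E2: "open E2" "E2 \<noteq> {}" "E2 \<subseteq> E1" and a: "\<exists>i\<in>I'. a i \<noteq> 0"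
      "\<And>x. x \<in> E2 \<Longrightarrow> (\<Sum>i\<in>I'. a i * deriv (z i) x) = 0" by blast
    obtain x0 r where r: "x0 \<in> E2" "r > 0" "ball x0 r \<subseteq> E2"
      using E2 by (meson ex_in_conv openE)
    have "\<exists>C. \<forall>x\<in>ball x0 r. (\<Sum>i\<in>I'. a i * z i x) = C"
    proof (rule has_field_derivative_zero_constant)
      fix x assume x: "x \<in> ball x0 r"
      have "((\<lambda>x. \<Sum>i\<in>I'. a i * z i x) has_field_derivative (\<Sum>i\<in>I'. a i * deriv (z i) x)) (at x)"
      proof (rule DERIV_sum)
        fix i assume "i \<in> I'"
        then have "(z i has_field_derivative deriv (z i) x) (at x)"
          using x r E2 by (intro smooth_on_DERIV[OF sz]) (auto simp: I'_def)
        then show "((\<lambda>x. a i * z i x) has_field_derivative a i * deriv (z i) x) (at x)" by (rule DERIV_cmult)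
      qed
      moreover have "(\<Sum>i\<in>I'. a i * deriv (z i) x) = 0" using a(2) x r by blast
      ultimately show "((\<lambda>x. \<Sum>i\<in>I'. a i * z i x) has_field_derivative 0) (at x within ball x0 r)"
        by (simp only: has_field_derivative_at_within)
    qed auto
    then obtain C where C: "\<And>x. x \<in> ball x0 r \<Longrightarrow> (\<Sum>i\<in>I'. a i * z i x) = C" by blast
    define a' where "a' i = (if i = i0 then - C else a i)" for i
    have "(\<Sum>i\<in>I. a' i * f i x) = 0" if x: "x \<in> ball x0 r" for x
    proof -
      have xE: "x \<in> E1" using x r E2 by blast
      have "(\<Sum>i\<in>I. a' i * f i x) = a' i0 * u x + (\<Sum>i\<in>I'. a' i * f i x)"
        using Suc.prems(3) i0 by (simp add: I'_def sum.remove u_def)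
      also have "(\<Sum>i\<in>I'. a' i * f i x) = u x * (\<Sum>i\<in>I'. a i * z i x)"
        unfolding sum_distrib_left by (intro sum.cong) (auto simp: a'_def I'_def fz[OF xE])
      finally show ?thesis using C[OF x] by (simp add: a'_def)
    qed
    moreover have "\<exists>i\<in>I. a' i \<noteq> 0" using a(1) by (auto simp: a'_def I'_def)
    moreover have "ball x0 r \<subseteq> E" using r E2 E1 by blast
    ultimately show ?thesis using r(2)
      by (intro exI[of _ "ball x0 r"] exI[of _ a']) auto
  qed
qed

lemma has_field_derivative_exp_quotient:
  fixes A B :: "'a::{real_normed_field,banach} poly"
  assumes "poly B x \<noteq> 0"
  shows "((\<lambda>x. poly R x / poly B x ^ n * exp (poly A x / poly B x)) has_field_derivative
    poly (B\<^sup>2 * pderiv R - of_nat n * B * pderiv B * R + (pderiv A * B - A * pderiv B) * R) x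
      / poly B x ^ (n + 2) * exp (poly A x / poly B x)) (at x)"
proof -
  let ?b = "poly B x" and ?w = "poly (pderiv A) x * poly B x - poly A x * poly (pderiv B) x"
  have "((\<lambda>x. poly R x / poly B x ^ n) has_field_derivative
      (poly (pderiv R) x * ?b ^ n - poly R x * (of_nat n * ?b ^ (n - 1) * poly (pderiv B) x)) / (?b ^ n * ?b ^ n)) (at x)"
    using DERIV_divide[OF poly_DERIV[of R x] poly_DERIV[of "B ^ n" x]] assms by (simp add: pderiv_power mult_ac)
  moreover have "(poly (pderiv R) x * ?b ^ n - poly R x * (of_nat n * ?b ^ (n - 1) * poly (pderiv B) x)) / (?b ^ n * ?b ^ n) =
      (?b ^ 2 * poly (pderiv R) x - of_nat n * ?b * poly (pderiv B) x * poly R x) / ?b ^ (n + 2)"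
    using assms by (cases n) (simp_all add: field_simps power2_eq_square)
  ultimately have 1: "((\<lambda>x. poly R x / poly B x ^ n) has_field_derivative
      (?b ^ 2 * poly (pderiv R) x - of_nat n * ?b * poly (pderiv B) x * poly R x) / ?b ^ (n + 2)) (at x)" by simp
  have 2: "((\<lambda>x. exp (poly A x / poly B x)) has_field_derivative exp (poly A x / poly B x) * (?w / (?b * ?b))) (at x)"
    by (rule DERIV_chain2[OF DERIV_exp DERIV_divide[OF poly_DERIV poly_DERIV assms]])
  have "poly (B\<^sup>2 * pderiv R - of_nat n * B * pderiv B * R + (pderiv A * B - A * pderiv B) * R) x =
      (?b ^ 2 * poly (pderiv R) x - of_nat n * ?b * poly (pderiv B) x * poly R x) + ?w * poly R x"
    by (simp add: of_nat_poly)
  moreover have "exp (poly A x / poly B x) * (?w / (?b * ?b)) * (poly R x / ?b ^ n) = ?w * poly R x / ?b ^ (n + 2) * exp (poly A x / poly B x)"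
    by (simp add: power_add power2_eq_square mult_ac)
  ultimately show ?thesis
    using DERIV_mult[OF 1 2] by (simp only: add_divide_distrib distrib_right)
qed

text \<open>
  Linear independence of exponentials over the rational functions, by eliminating one term at a time:
  combining a relation with its derivative so that the term \<open>i\<close> drops out gives a shorter relation,
  whose coefficients vanish by induction. If \<open>b j \<noteq> 0\<close>, this says that the logarithmic
  derivative of \<open>b i / b j\<close> is the derivative of \<open>(A j - A i) / B\<close>, which would then be constant.
\<close>

lemma exponentials_independent_over_polys:
  fixes A :: "'i \<Rightarrow> 'a::{real_normed_field,banach} poly"
  assumes "open E" "E \<noteq> {}" "\<And>x. x \<in> E \<Longrightarrow> poly B x \<noteq> 0" "finite I"
    and "\<And>i j c. i \<in> I \<Longrightarrow> j \<in> I \<Longrightarrow> i \<noteq> j \<Longrightarrow> A i - A j \<noteq> smult c B"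
    and "\<And>x. x \<in> E \<Longrightarrow> (\<Sum>i\<in>I. poly (b i) x * exp (poly (A i) x / poly B x)) = 0"
    and "i \<in> I"
  shows "b i = 0"
  using assms(4,5,6,7)
proof (induction "card I" arbitrary: I b i rule: less_induct)
  case less
  have B0: "B \<noteq> 0" using assms(2,3) by auto
  show ?case
  proof (rule ccontr)
    assume bi: "b i \<noteq> 0"
    define I' where "I' = I - {i}"
    define W where "W j = pderiv (A j) * B - A j * pderiv B" for j
    define d where "d j = B\<^sup>2 * pderiv (b j) + W j * b j" for j
    have d: "(\<Sum>j\<in>I. poly (d j) x * exp (poly (A j) x / poly B x)) = 0" if x: "x \<in> E" for x
    proof -
      have "((\<lambda>x. \<Sum>j\<in>I. poly (b j) x / poly B x ^ 0 * exp (poly (A j) x / poly B x)) has_field_derivative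
         (\<Sum>j\<in>I. poly (B\<^sup>2 * pderiv (b j) - of_nat 0 * B * pderiv B * b j + (pderiv (A j) * B - A j * pderiv B) * b j) x
      / poly B x ^ (0 + 2) * exp (poly (A j) x / poly B x))) (at x)"
        by (intro DERIV_sum has_field_derivative_exp_quotient assms(3) x)
      moreover have "((\<lambda>x. \<Sum>j\<in>I. poly (b j) x / poly B x ^ 0 * exp (poly (A j) x / poly B x)) has_field_derivative 0) (at x)"
        by (rule has_field_derivative_transform_within_open[OF DERIV_const assms(1) x, of 0])
          (use less.prems(3) in simp)
      ultimately have "(\<Sum>j\<in>I. poly (B\<^sup>2 * pderiv (b j) - of_nat 0 * B * pderiv B * b j + (pderiv (A j) * B - A j * pderiv B) * b j) x
      / poly B x ^ (0 + 2) * exp (poly (A j) x / poly B x)) = 0" by (rule DERIV_unique)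
      then have "(\<Sum>j\<in>I. poly (d j) x * exp (poly (A j) x / poly B x) / poly B x ^ 2) = 0"
        by (simp add: d_def W_def power2_eq_square)
      then show ?thesis using assms(3)[OF x] by (simp flip: sum_divide_distrib)
    qed
    have bd: "b i * d j - d i * b j = 0" if j: "j \<in> I'" for j
    proof (rule less.hyps[OF _ _ _ _ j])
      show "card I' < card I" unfolding I'_def using less.prems(1,4) by (rule card_Diff1_less)
      show "finite I'" using less.prems(1) by (simp add: I'_def)
      show "A k - A l \<noteq> smult c B" if "k \<in> I'" "l \<in> I'" "k \<noteq> l" for k l c
        using less.prems(2) that by (simp add: I'_def)
      fix x assume x: "x \<in> E"
      let ?e = "\<lambda>j. exp (poly (A j) x / poly B x)"
      have "(\<Sum>j\<in>I'. poly (b i * d j - d i * b j) x * ?e j) = (\<Sum>j\<in>I. poly (b i * d j - d i * b j) x * ?e j)"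
        using less.prems(1,4) by (simp add: I'_def sum.remove[of I i])
      also have "\<dots> = poly (b i) x * (\<Sum>j\<in>I. poly (d j) x * ?e j) - poly (d i) x * (\<Sum>j\<in>I. poly (b j) x * ?e j)"
        by (simp add: sum_distrib_left sum_subtractf algebra_simps)
      finally show "(\<Sum>j\<in>I'. poly (b i * d j - d i * b j) x * ?e j) = 0"
        using d[OF x] less.prems(3)[OF x] by simp
    qed
    have rel: "(pderiv (b i) * b j - pderiv (b j) * b i) * B\<^sup>2 = b i * b j * (W j - W i)" if "j \<in> I'" for j
      using bd[OF that] by (simp add: d_def algebra_simps)
    have "b j = 0" if j: "j \<in> I'" for j
    proof (rule ccontr)
      assume "b j \<noteq> 0"
      have "(pderiv (b i) * b j - pderiv (b j) * b i) * B\<^sup>2 =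
          b i * b j * (pderiv (A j - A i) * B - (A j - A i) * pderiv B)"
        using rel[OF j] by (simp add: W_def pderiv_diff algebra_simps)
      then have "pderiv (A j - A i) * B = (A j - A i) * pderiv B"
        by (rule log_derivative_eq_rational_derivative_imp_0[OF bi \<open>b j \<noteq> 0\<close> B0])
      then obtain c where "A j - A i = smult c B"
        using wronskian_eq_0_imp_proportional B0 by blast
      then show False using less.prems(2)[of j i c] j less.prems(4) by (auto simp: I'_def)
    qed
    then have "poly (b i) x * exp (poly (A i) x / poly B x) = 0" if "x \<in> E" for x
      using less.prems(3)[OF that] less.prems(1,4) by (simp add: sum.remove[of I i] I'_def)
    then have "b i = 0" by (intro poly_eq_0_if_zero_on_open[OF assms(1,2)]) simp
    then show False using bi by blast
  qed
qed

text \<open>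
  The \<open>j\<close>-th derivative of \<open>R exp (A / B)\<close> is this polynomial times \<open>exp (A / B) / B ^ (2 j)\<close>.
\<close>

primrec exp_quotient_numerator :: "'a::real_normed_field poly \<Rightarrow> 'a poly \<Rightarrow> 'a poly \<Rightarrow> nat \<Rightarrow> 'a poly" where
  "exp_quotient_numerator A B R 0 = R"
| "exp_quotient_numerator A B R (Suc j) =
    B\<^sup>2 * pderiv (exp_quotient_numerator A B R j)
    - of_nat (2 * j) * B * pderiv B * exp_quotient_numerator A B R j
    + (pderiv A * B - A * pderiv B) * exp_quotient_numerator A B R j"

lemma
  fixes A B :: "'a::{real_normed_field,banach} poly"
  assumes "open E" "\<And>x. x \<in> E \<Longrightarrow> poly B x \<noteq> 0"
  shows smooth_on_exp_quotient: "smooth_on E (\<lambda>x. poly R x * exp (poly A x / poly B x))"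
    and higher_deriv_exp_quotient: "x \<in> E \<Longrightarrow> (deriv ^^ j) (\<lambda>x. poly R x * exp (poly A x / poly B x)) x =
      poly (exp_quotient_numerator A B R j) x / poly B x ^ (2 * j) * exp (poly A x / poly B x)"
proof -
  have der: "((\<lambda>x. poly (exp_quotient_numerator A B R j) x / poly B x ^ (2 * j) * exp (poly A x / poly B x))
    has_field_derivative poly (exp_quotient_numerator A B R (Suc j)) x / poly B x ^ (2 * Suc j) * exp (poly A x / poly B x)) (at x)"
    if "x \<in> E" for x j
    using has_field_derivative_exp_quotient[OF assms(2)[OF that], of "exp_quotient_numerator A B R j" "2 * j" A] by simp
  show "smooth_on E (\<lambda>x. poly R x * exp (poly A x / poly B x))"
    using assms(1) by (rule smooth_onI[where g = "\<lambda>j x. poly (exp_quotient_numerator A B R j) x / poly B x ^ (2 * j) * exp (poly A x / poly B x)"])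
      (simp, rule der)
  show "(deriv ^^ j) (\<lambda>x. poly R x * exp (poly A x / poly B x)) x =
      poly (exp_quotient_numerator A B R j) x / poly B x ^ (2 * j) * exp (poly A x / poly B x)" if "x \<in> E"
    using assms(1) by (rule higher_deriv_eqI[where g = "\<lambda>j x. poly (exp_quotient_numerator A B R j) x / poly B x ^ (2 * j) * exp (poly A x / poly B x)"])
      (simp, rule der, use that in simp_all)
qed

text \<open>
  The main lower bound. By independence over the rational functions, an equation for the sum is an equation for each
  of its terms; by independence over the constants, it then has at least as many solutions as there are terms.
\<close>

theorem order_exponential_sum_ge:
  fixes A :: "'i \<Rightarrow> 'a::{real_normed_field,banach} poly"
  assumes "open E" "E \<noteq> {}" "\<And>x. x \<in> E \<Longrightarrow> poly B x \<noteq> 0" "finite I"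
    and A: "\<And>i j c. i \<in> I \<Longrightarrow> j \<in> I \<Longrightarrow> i \<noteq> j \<Longrightarrow> A i - A j \<noteq> smult c B"
    and R: "\<And>i. i \<in> I \<Longrightarrow> R i \<noteq> 0"
    and f: "\<And>x. x \<in> E \<Longrightarrow> f x = (\<Sum>i\<in>I. poly (R i) x * exp (poly (A i) x / poly B x))"
    and ode: "satisfies_simple_ode K E N f"
  shows "card I \<le> N"
proof (rule ccontr)
  assume "\<not> card I \<le> N"
  define g where "g i x = poly (R i) x * exp (poly (A i) x / poly B x)" for i x
  have sg: "smooth_on E (g i)" for i
    unfolding g_def using smooth_on_exp_quotient assms(1,3) by blast
  obtain p where p: "p N \<noteq> 0" "\<And>x. x \<in> E \<Longrightarrow> (\<Sum>k\<le>N. poly (p k) x * (deriv ^^ k) f x) = 0"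
    using ode by (auto simp: satisfies_simple_ode_def)
  let ?e = "\<lambda>i x. exp (poly (A i) x / poly B x)"
  define T where "T i k = exp_quotient_numerator (A i) B (R i) k" for i k
  \<comment> \<open>The coefficient of \<open>exp (A i / B)\<close> after multiplication by the common denominator \<open>B ^ (2 N)\<close>.\<close>
  define b where "b i = (\<Sum>k\<le>N. p k * B ^ (2 * (N - k)) * T i k)" for i
  have dg: "(deriv ^^ k) (g i) x = poly (T i k) x / poly B x ^ (2 * k) * ?e i x" if "x \<in> E" for i k x
    unfolding g_def T_def using higher_deriv_exp_quotient[OF assms(1,3) that] by blast
  have bg: "poly (b i) x * ?e i x = poly B x ^ (2 * N) * (\<Sum>k\<le>N. poly (p k) x * (deriv ^^ k) (g i) x)"
    if "x \<in> E" for i x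
  proof -
    have "poly (p k * B ^ (2 * (N - k)) * T i k) x * ?e i x =
        poly B x ^ (2 * N) * (poly (p k) x * (deriv ^^ k) (g i) x)" if "k \<le> N" for k
    proof -
      have "poly B x ^ (2 * N) = poly B x ^ (2 * (N - k)) * poly B x ^ (2 * k)"
      proof -
        have "2 * N = 2 * (N - k) + 2 * k" using that by simp
        then show ?thesis by (metis power_add)
      qed
      then show ?thesis using dg[OF \<open>x \<in> E\<close>] assms(3)[OF \<open>x \<in> E\<close>] by (simp add: field_simps)
    qed
    then show ?thesis unfolding b_def poly_sum sum_distrib_left sum_distrib_right by (intro sum.cong) auto
  qed
  have "b i = 0" if "i \<in> I" for i
  proof (rule exponentials_independent_over_polys[OF assms(1-4) A _ that])
    fix x assume x: "x \<in> E"
    have "(deriv ^^ k) f x = (\<Sum>i\<in>I. (deriv ^^ k) (g i) x)" for k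
    proof -
      have "(deriv ^^ k) f x = (deriv ^^ k) (\<lambda>x. \<Sum>i\<in>I. g i x) x"
        by (rule higher_deriv_cong[OF smooth_on_sum[OF assms(1,4) sg] assms(1) _ x]) (simp add: f g_def)
      also have "\<dots> = (\<Sum>i\<in>I. (deriv ^^ k) (g i) x)" by (rule higher_deriv_sum[OF assms(1) sg x])
      finally show ?thesis .
    qed
    then have "0 = (\<Sum>k\<le>N. \<Sum>i\<in>I. poly (p k) x * (deriv ^^ k) (g i) x)"
      using p(2)[OF x] by (simp add: sum_distrib_left)
    also have "\<dots> = (\<Sum>i\<in>I. \<Sum>k\<le>N. poly (p k) x * (deriv ^^ k) (g i) x)" by (rule sum.swap)
    finally show "(\<Sum>i\<in>I. poly (b i) x * ?e i x) = 0"
      by (simp add: bg[OF x] flip: sum_distrib_left)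
  qed
  then have ode_g: "(\<Sum>k\<le>N. poly (p k) x * (deriv ^^ k) (g i) x) = 0" if "i \<in> I" "x \<in> E" for i x
    using bg[OF that(2), of i] that assms(3)[OF that(2)] by simp
  define E0 where "E0 = E - {x. poly (p N) x = 0}"
  have E0: "open E0" "E0 \<noteq> {}" "E0 \<subseteq> E"
    using open_minus_poly_roots[OF assms(1,2) p(1)] by (auto simp: E0_def)
  have "\<exists>E' a. open E' \<and> E' \<noteq> {} \<and> E' \<subseteq> E0 \<and> (\<exists>i\<in>I. a i \<noteq> 0) \<and> (\<forall>x\<in>E'. (\<Sum>i\<in>I. a i * g i x) = 0)"
    by (rule solutions_dependent_over_constants[OF E0(1,2) assms(4), where c = "\<lambda>k. poly (p k)" and N = N])
      (use \<open>\<not> card I \<le> N\<close> sg E0(3) ode_g in \<open>auto simp: E0_def intro: smooth_on_subset\<close>)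
  then obtain E' a i where E': "open E'" "E' \<noteq> {}" "E' \<subseteq> E0" and i: "i \<in> I" "a i \<noteq> 0"
    and 0: "\<And>x. x \<in> E' \<Longrightarrow> (\<Sum>i\<in>I. a i * g i x) = 0" by blast
  have "smult (a i) (R i) = 0"
    by (rule exponentials_independent_over_polys[OF E'(1,2) _ assms(4) A _ i(1), where b = "\<lambda>i. smult (a i) (R i)"])
      (use E' E0 0 assms(3) in \<open>auto simp: g_def mult.assoc\<close>)
  then show False using i R by simp
qed

section \<open>Spans over the rational functions\<close>

text \<open>
  More vectors than dimensions, over a subring \<open>R\<close> of an integral domain. One step of fraction-free elimination with the
  pivot \<open>a j0 i0\<close> removes the coordinate \<open>i0\<close> and the vector \<open>j0\<close>.
\<close>

lemma nontrivial_linear_relation: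
  fixes a :: "'j \<Rightarrow> 'i \<Rightarrow> 'r::idom"
  assumes "finite I" "finite J" "card I < card J"
    and R: "0 \<in> R" "1 \<in> R" "\<And>u v. u \<in> R \<Longrightarrow> v \<in> R \<Longrightarrow> u - v \<in> R" "\<And>u v. u \<in> R \<Longrightarrow> v \<in> R \<Longrightarrow> u * v \<in> R"
    and "\<And>i j. i \<in> I \<Longrightarrow> j \<in> J \<Longrightarrow> a j i \<in> R"
  shows "\<exists>c. (\<forall>j\<in>J. c j \<in> R) \<and> (\<exists>j\<in>J. c j \<noteq> 0) \<and> (\<forall>i\<in>I. (\<Sum>j\<in>J. c j * a j i) = 0)"
  using assms(1,2,3,8)
proof (induction I arbitrary: J a rule: finite_induct)
  case empty
  then have "J \<noteq> {}" by auto
  then show ?case using R by (intro exI[of _ "\<lambda>_. 1"]) auto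
next
  case (insert i0 I)
  show ?case
  proof (cases "\<forall>j\<in>J. a j i0 = 0")
    case True
    have "\<exists>c. (\<forall>j\<in>J. c j \<in> R) \<and> (\<exists>j\<in>J. c j \<noteq> 0) \<and> (\<forall>i\<in>I. (\<Sum>j\<in>J. c j * a j i) = 0)"
      by (rule insert.IH) (use insert.prems insert.hyps in auto)
    then show ?thesis using True by auto
  next
    case False
    then obtain j0 where j0: "j0 \<in> J" "a j0 i0 \<noteq> 0" by blast
    define J' where "J' = J - {j0}"
    define a' where "a' j i = a j0 i0 * a j i - a j i0 * a j0 i" for j i
    have "\<exists>c. (\<forall>j\<in>J'. c j \<in> R) \<and> (\<exists>j\<in>J'. c j \<noteq> 0) \<and> (\<forall>i\<in>I. (\<Sum>j\<in>J'. c j * a' j i) = 0)"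
    proof (rule insert.IH)
      show "card I < card J'" using insert.prems insert.hyps j0 by (simp add: J'_def)
      show "a' j i \<in> R" if "i \<in> I" "j \<in> J'" for i j
        using that j0 insert.prems(3) by (auto simp: a'_def J'_def intro!: R)
    qed (use insert.prems in \<open>simp add: J'_def\<close>)
    then obtain c where c: "\<And>j. j \<in> J' \<Longrightarrow> c j \<in> R" "\<exists>j\<in>J'. c j \<noteq> 0"
      "\<And>i. i \<in> I \<Longrightarrow> (\<Sum>j\<in>J'. c j * a' j i) = 0" by blast
    define e where "e j = (if j = j0 then 0 - (\<Sum>j\<in>J'. c j * a j i0) else c j * a j0 i0)" for j
    have sumR: "(\<Sum>j\<in>A. h j) \<in> R" if "\<And>j. j \<in> A \<Longrightarrow> h j \<in> R" "finite A" for A :: "'j set" and h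
      using that(2,1)
    proof (induction A rule: finite_induct)
      case (insert x A)
      have "h x - (0 - sum h A) \<in> R" using insert by (intro R) auto
      then show ?case using insert by simp
    qed (simp add: R)
    have "e j \<in> R" if "j \<in> J" for j
    proof -
      have "finite J'" using insert.prems(1) by (simp add: J'_def)
      then have "(\<Sum>j\<in>J'. c j * a j i0) \<in> R"
        using c(1) insert.prems(3) by (intro sumR R) (auto simp: J'_def)
      then have "e j0 \<in> R" using R(3)[OF R(1)] by (simp add: e_def)
      moreover have "e j \<in> R" if "j \<in> J'"
        using that c(1) insert.prems(3) j0 by (auto simp: e_def J'_def intro!: R)
      ultimately show ?thesis using \<open>j \<in> J\<close> by (cases "j = j0") (auto simp: J'_def)
    qed
    moreover have "\<exists>j\<in>J. e j \<noteq> 0" using c(2) j0 by (auto simp: e_def J'_def)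
    moreover have "(\<Sum>j\<in>J. e j * a j i) = 0" if i: "i \<in> insert i0 I" for i
    proof -
      have "(\<Sum>j\<in>J. e j * a j i) = e j0 * a j0 i + (\<Sum>j\<in>J'. e j * a j i)"
        using insert.prems(1) j0 by (simp add: J'_def sum.remove)
      also have "(\<Sum>j\<in>J'. e j * a j i) = (\<Sum>j\<in>J'. c j * a j0 i0 * a j i)"
        by (intro sum.cong) (auto simp: e_def J'_def)
      also have "e j0 * a j0 i + \<dots> = (\<Sum>j\<in>J'. c j * a' j i)"
        by (simp add: e_def a'_def sum_distrib_left sum_subtractf algebra_simps)
      also have "\<dots> = 0" using i c(3) by (auto simp: a'_def mult.commute)
      finally show ?thesis .
    qed
    ultimately show ?thesis by blast
  qed
qed

text \<open>
  Derivatives and fraction-free elimination stay within any ring that contains the coefficients. The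
  rational factors \<open>p / q\<close> that arise from powers are cleared by multiplying with \<open>q\<close>.
\<close>

locale coefficient_ring =
  fixes K :: "'a::{real_normed_field,banach} set"
  assumes zero_mem: "0 \<in> K" and one_mem: "1 \<in> K"
    and diff_mem: "u \<in> K \<Longrightarrow> v \<in> K \<Longrightarrow> u - v \<in> K"
    and mult_mem: "u \<in> K \<Longrightarrow> v \<in> K \<Longrightarrow> u * v \<in> K"

text \<open>
  Identities between functions on \<open>D\<close> are stated up to finitely many exceptions, so that division by nonzero
  polynomials is harmless. Continuity removes the exceptions at the very end.
\<close>

definition off_finite :: "'a set \<Rightarrow> 'a filter" where
  "off_finite D = inf cofinite (principal D)"

lemma eventually_off_finite: "eventually P (off_finite D) \<longleftrightarrow> finite {x\<in>D. \<not> P x}"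
  by (simp add: off_finite_def eventually_inf_principal eventually_cofinite)

lemma eventually_off_finiteI: "(\<And>x. x \<in> D \<Longrightarrow> P x) \<Longrightarrow> eventually P (off_finite D)"
  by (simp add: eventually_off_finite) (metis (mono_tags, lifting) empty_Collect_eq finite.emptyI)

lemma eventually_off_finite_mem: "eventually (\<lambda>x. x \<in> D) (off_finite D)"
  by (rule eventually_off_finiteI)

lemma eventually_poly_nonzero:
  fixes p :: "'a::idom poly"
  assumes "p \<noteq> 0"
  shows "eventually (\<lambda>x. poly p x \<noteq> 0) (off_finite D)"
  using poly_roots_finite[OF assms] by (auto simp: eventually_off_finite elim: rev_finite_subset)

lemma zero_off_finite_imp_zero:
  fixes h :: "'a::real_normed_field \<Rightarrow> 'a"
  assumes "open D" "continuous_on D h" "eventually (\<lambda>x. h x = 0) (off_finite D)" "x \<in> D"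
  shows "h x = 0"
proof (rule ccontr)
  assume "h x \<noteq> 0"
  have "open (D \<inter> h -` (- {0}))"
    by (rule continuous_open_preimage[OF assms(2,1)]) (simp add: open_Compl)
  moreover have "D \<inter> h -` (- {0}) \<noteq> {}" using assms(4) \<open>h x \<noteq> 0\<close> by auto
  ultimately have "infinite (D \<inter> h -` (- {0}))" by (rule infinite_if_open_nonempty)
  moreover have "D \<inter> h -` (- {0}) = {x\<in>D. h x \<noteq> 0}" by auto
  ultimately show False using assms(3) by (simp add: eventually_off_finite)
qed

context coefficient_ring
begin

lemma uminus_mem: "u \<in> K \<Longrightarrow> - u \<in> K"
  using diff_mem[OF zero_mem, of u] by simp

lemma add_mem: "u \<in> K \<Longrightarrow> v \<in> K \<Longrightarrow> u + v \<in> K"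
  using diff_mem[OF _ uminus_mem, of u v] by simp

lemma sum_mem: "(\<And>i. i \<in> A \<Longrightarrow> u i \<in> K) \<Longrightarrow> (\<Sum>i\<in>A. u i) \<in> K"
  by (induction A rule: infinite_finite_induct) (auto intro: zero_mem add_mem)

lemma of_nat_mem: "of_nat n \<in> K"
  by (induction n) (auto intro: zero_mem one_mem add_mem)

lemma poly_over_0: "poly_over K 0"
  by (simp add: poly_over_def zero_mem)

lemma poly_over_1: "poly_over K 1"
  by (simp add: poly_over_def zero_mem one_mem)

lemma poly_over_diff: "poly_over K p \<Longrightarrow> poly_over K q \<Longrightarrow> poly_over K (p - q)"
  by (simp add: poly_over_def diff_mem)

lemma poly_over_uminus: "poly_over K p \<Longrightarrow> poly_over K (- p)"
  by (simp add: poly_over_def uminus_mem)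

lemma poly_over_add: "poly_over K p \<Longrightarrow> poly_over K q \<Longrightarrow> poly_over K (p + q)"
  by (simp add: poly_over_def add_mem)

lemma poly_over_mult: "poly_over K p \<Longrightarrow> poly_over K q \<Longrightarrow> poly_over K (p * q)"
  by (simp add: poly_over_def coeff_mult sum_mem mult_mem)

lemma poly_over_power: "poly_over K p \<Longrightarrow> poly_over K (p ^ n)"
  by (induction n) (auto intro: poly_over_1 poly_over_mult)

lemma poly_over_sum: "(\<And>i. i \<in> A \<Longrightarrow> poly_over K (p i)) \<Longrightarrow> poly_over K (\<Sum>i\<in>A. p i)"
  by (induction A rule: infinite_finite_induct) (auto intro: poly_over_0 poly_over_add)

lemma poly_over_monom: "c \<in> K \<Longrightarrow> poly_over K (monom c n)"
  by (simp add: poly_over_def zero_mem)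

lemma poly_over_pderiv: "poly_over K p \<Longrightarrow> poly_over K (pderiv p)"
  unfolding poly_over_def coeff_pderiv by (blast intro: mult_mem of_nat_mem)

lemma poly_over_const: "c \<in> K \<Longrightarrow> poly_over K [:c:]"
  using poly_over_monom[of c 0] by (simp add: monom_0)

lemmas poly_over_intros = poly_over_0 poly_over_1 poly_over_diff poly_over_uminus poly_over_add
  poly_over_mult poly_over_power poly_over_sum poly_over_monom poly_over_pderiv

text \<open>
  Membership of \<open>y\<close> in the span of the functions \<open>g i\<close> over the field \<open>K(x)\<close>, with the denominators
  collected in \<open>d\<close>.
\<close>

definition rat_span :: "'a set \<Rightarrow> ('i \<Rightarrow> 'a \<Rightarrow> 'a) \<Rightarrow> 'i set \<Rightarrow> ('a \<Rightarrow> 'a) \<Rightarrow> bool" where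
  "rat_span D g I y \<longleftrightarrow> (\<exists>d a. poly_over K d \<and> d \<noteq> 0 \<and> (\<forall>i\<in>I. poly_over K (a i)) \<and>
     eventually (\<lambda>x. poly d x * y x = (\<Sum>i\<in>I. poly (a i) x * g i x)) (off_finite D))"

lemma rat_spanI:
  assumes "poly_over K d" "d \<noteq> 0" "\<And>i. i \<in> I \<Longrightarrow> poly_over K (a i)"
    and "eventually (\<lambda>x. poly d x * y x = (\<Sum>i\<in>I. poly (a i) x * g i x)) (off_finite D)"
  shows "rat_span D g I y"
  unfolding rat_span_def using assms by blast

lemma rat_span_divide:
  assumes "rat_span D g I z" "poly_over K e" "e \<noteq> 0"
    and "eventually (\<lambda>x. poly e x * y x = z x) (off_finite D)"
  shows "rat_span D g I y"
proof -
  obtain d a where da: "poly_over K d" "d \<noteq> 0" "\<And>i. i \<in> I \<Longrightarrow> poly_over K (a i)"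
    "eventually (\<lambda>x. poly d x * z x = (\<Sum>i\<in>I. poly (a i) x * g i x)) (off_finite D)"
    using assms(1) unfolding rat_span_def by blast
  show ?thesis
  proof (rule rat_spanI[of "d * e" I a])
    show "eventually (\<lambda>x. poly (d * e) x * y x = (\<Sum>i\<in>I. poly (a i) x * g i x)) (off_finite D)"
      using da(4) assms(4) by eventually_elim (simp add: mult.assoc)
  qed (use da assms in \<open>auto intro: poly_over_intros\<close>)
qed

lemma rat_span_cong:
  assumes "rat_span D g I z" "eventually (\<lambda>x. y x = z x) (off_finite D)"
  shows "rat_span D g I y"
  using rat_span_divide[OF assms(1) poly_over_1] assms(2) by simp

lemma rat_span_base:
  assumes "finite I" "i \<in> I"
  shows "rat_span D g I (g i)"
proof (rule rat_spanI[of 1 I "\<lambda>j. if j = i then 1 else 0"])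
  have "(\<Sum>j\<in>I. poly (if j = i then 1 else 0) x * g j x) = (\<Sum>j\<in>I. if j = i then g j x else 0)" for x
    by (intro sum.cong) auto
  then show "eventually (\<lambda>x. poly 1 x * g i x = (\<Sum>j\<in>I. poly (if j = i then 1 else 0) x * g j x)) (off_finite D)"
    using assms by simp
qed (auto intro: poly_over_intros)

lemma rat_span_0: "rat_span D g I (\<lambda>x. 0)"
  by (rule rat_spanI[of 1 I "\<lambda>_. 0"]) (auto intro: poly_over_intros)

lemma rat_span_add:
  assumes "rat_span D g I y" "rat_span D g I z"
  shows "rat_span D g I (\<lambda>x. y x + z x)"
proof -
  obtain d a where da: "poly_over K d" "d \<noteq> 0" "\<And>i. i \<in> I \<Longrightarrow> poly_over K (a i)"
    "eventually (\<lambda>x. poly d x * y x = (\<Sum>i\<in>I. poly (a i) x * g i x)) (off_finite D)"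
    using assms(1) unfolding rat_span_def by blast
  obtain e b where eb: "poly_over K e" "e \<noteq> 0" "\<And>i. i \<in> I \<Longrightarrow> poly_over K (b i)"
    "eventually (\<lambda>x. poly e x * z x = (\<Sum>i\<in>I. poly (b i) x * g i x)) (off_finite D)"
    using assms(2) unfolding rat_span_def by blast
  show ?thesis
  proof (rule rat_spanI[of "d * e" I "\<lambda>i. e * a i + d * b i"])
    show "eventually (\<lambda>x. poly (d * e) x * (y x + z x) = (\<Sum>i\<in>I. poly (e * a i + d * b i) x * g i x)) (off_finite D)"
      using da(4) eb(4)
    proof eventually_elim
      case (elim x)
      have "poly (d * e) x * (y x + z x) = poly e x * (poly d x * y x) + poly d x * (poly e x * z x)"
        by (simp add: algebra_simps)
      then show ?case unfolding elim by (simp add: sum_distrib_left sum.distrib algebra_simps)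
    qed
  qed (use da eb in \<open>auto intro!: poly_over_intros\<close>)
qed

lemma rat_span_poly_mult:
  assumes "rat_span D g I y" "poly_over K p"
  shows "rat_span D g I (\<lambda>x. poly p x * y x)"
proof -
  obtain d a where da: "poly_over K d" "d \<noteq> 0" "\<And>i. i \<in> I \<Longrightarrow> poly_over K (a i)"
    "eventually (\<lambda>x. poly d x * y x = (\<Sum>i\<in>I. poly (a i) x * g i x)) (off_finite D)"
    using assms(1) unfolding rat_span_def by blast
  show ?thesis
  proof (rule rat_spanI[of d I "\<lambda>i. p * a i"])
    show "eventually (\<lambda>x. poly d x * (poly p x * y x) = (\<Sum>i\<in>I. poly (p * a i) x * g i x)) (off_finite D)"
      using da(4)
    proof eventually_elim
      case (elim x)
      have "poly d x * (poly p x * y x) = poly p x * (poly d x * y x)" by (simp add: mult_ac)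
      then show ?case unfolding elim by (simp add: sum_distrib_left mult_ac)
    qed
  qed (use da assms in \<open>auto intro!: poly_over_intros\<close>)
qed

lemma rat_span_sum:
  assumes "\<And>j. j \<in> J \<Longrightarrow> rat_span D g I (y j)"
  shows "rat_span D g I (\<lambda>x. \<Sum>j\<in>J. y j x)"
  using assms by (induction J rule: infinite_finite_induct) (auto intro: rat_span_0 rat_span_add)

lemma rat_span_uminus: "rat_span D g I y \<Longrightarrow> rat_span D g I (\<lambda>x. - y x)"
  using rat_span_poly_mult[of D g I y "- 1"] by (simp add: poly_over_intros)

lemma rat_span_diff: "rat_span D g I y \<Longrightarrow> rat_span D g I z \<Longrightarrow> rat_span D g I (\<lambda>x. y x - z x)"
  using rat_span_add[OF _ rat_span_uminus, of D g I y z] by simp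

lemma rat_span_trans:
  assumes "rat_span D g I y" "\<And>i. i \<in> I \<Longrightarrow> rat_span D h J (g i)"
  shows "rat_span D h J y"
proof -
  obtain d a where da: "poly_over K d" "d \<noteq> 0" "\<And>i. i \<in> I \<Longrightarrow> poly_over K (a i)"
    "eventually (\<lambda>x. poly d x * y x = (\<Sum>i\<in>I. poly (a i) x * g i x)) (off_finite D)"
    using assms(1) unfolding rat_span_def by blast
  show ?thesis
    by (rule rat_span_divide[OF rat_span_sum[OF rat_span_poly_mult[OF assms(2) da(3)]] da(1,2)])
      (use da(4) in auto)
qed

lemma rat_span_mult_right:
  assumes "rat_span D g I y"
  shows "rat_span D (\<lambda>i x. g i x * h x) I (\<lambda>x. y x * h x)"
proof -
  obtain d a where da: "poly_over K d" "d \<noteq> 0" "\<And>i. i \<in> I \<Longrightarrow> poly_over K (a i)"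
    "eventually (\<lambda>x. poly d x * y x = (\<Sum>i\<in>I. poly (a i) x * g i x)) (off_finite D)"
    using assms(1) unfolding rat_span_def by blast
  show ?thesis
  proof (rule rat_spanI[OF da(1-3)])
    show "eventually (\<lambda>x. poly d x * (y x * h x) = (\<Sum>i\<in>I. poly (a i) x * (g i x * h x))) (off_finite D)"
      using da(4) by eventually_elim (simp add: sum_distrib_right flip: mult.assoc)
  qed
qed

lemma rat_span_mult:
  assumes "rat_span D g I y" "rat_span D h J z" "finite I" "finite J"
  shows "rat_span D (\<lambda>(i, j) x. g i x * h j x) (I \<times> J) (\<lambda>x. y x * z x)"
proof (rule rat_span_trans[OF rat_span_mult_right[OF assms(1)]])
  fix i assume i: "i \<in> I"
  have "rat_span D (\<lambda>j x. h j x * g i x) J (\<lambda>x. z x * g i x)"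
    by (rule rat_span_mult_right[OF assms(2)])
  then have "rat_span D (\<lambda>(i, j) x. g i x * h j x) (I \<times> J) (\<lambda>x. z x * g i x)"
  proof (rule rat_span_trans)
    fix j assume "j \<in> J"
    then show "rat_span D (\<lambda>(i, j) x. g i x * h j x) (I \<times> J) (\<lambda>x. h j x * g i x)"
      using rat_span_base[of "I \<times> J" "(i, j)" D "\<lambda>(i, j) x. g i x * h j x"] i assms(3,4)
      by (simp add: mult.commute)
  qed
  then show "rat_span D (\<lambda>(i, j) x. g i x * h j x) (I \<times> J) (\<lambda>x. g i x * z x)"
    by (simp add: mult.commute)
qed

text \<open>
  If the generators have their derivatives in the span, the whole span is closed under differentiation, by the
  Leibniz rule. The exceptional points of the identity for \<open>y\<close> are left out before it is differentiated, which
  is possible because the remaining set is still open.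
\<close>

lemma rat_span_deriv:
  assumes "open D" "smooth_on D y" "\<And>i. i \<in> I \<Longrightarrow> smooth_on D (g i)" "finite I"
    and "\<And>i. i \<in> I \<Longrightarrow> rat_span D g I (deriv (g i))" "rat_span D g I y"
  shows "rat_span D g I (deriv y)"
proof -
  obtain d a where da: "poly_over K d" "d \<noteq> 0" "\<And>i. i \<in> I \<Longrightarrow> poly_over K (a i)"
    "eventually (\<lambda>x. poly d x * y x = (\<Sum>i\<in>I. poly (a i) x * g i x)) (off_finite D)"
    using assms(6) unfolding rat_span_def by blast
  define Z where "Z = {x\<in>D. poly d x * y x \<noteq> (\<Sum>i\<in>I. poly (a i) x * g i x)}"
  have Z: "finite Z" using da(4) by (simp add: eventually_off_finite Z_def)
  have oDZ: "open (D - Z)" using assms(1) Z by (rule open_diff_finite)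
  have eq: "poly d x * deriv y x =
      (\<Sum>i\<in>I. poly (pderiv (a i)) x * g i x + poly (a i) x * deriv (g i) x) - poly (pderiv d) x * y x"
    if x: "x \<in> D - Z" for x
  proof -
    have "((\<lambda>x. \<Sum>i\<in>I. poly (a i) x * g i x) has_field_derivative
        (\<Sum>i\<in>I. poly (pderiv (a i)) x * g i x + deriv (g i) x * poly (a i) x)) (at x)"
    proof (rule DERIV_sum)
      fix i assume "i \<in> I"
      then show "((\<lambda>x. poly (a i) x * g i x) has_field_derivative
          poly (pderiv (a i)) x * g i x + deriv (g i) x * poly (a i) x) (at x)"
        using x by (intro DERIV_mult poly_DERIV smooth_on_DERIV[OF assms(3)]) auto
    qed
    moreover have "((\<lambda>x. poly d x * y x) has_field_derivative poly (pderiv d) x * y x + deriv y x * poly d x) (at x)"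
      using x by (intro DERIV_mult poly_DERIV smooth_on_DERIV[OF assms(2)]) auto
    then have "((\<lambda>x. \<Sum>i\<in>I. poly (a i) x * g i x) has_field_derivative poly (pderiv d) x * y x + deriv y x * poly d x) (at x)"
      by (rule has_field_derivative_transform_within_open[OF _ oDZ x]) (auto simp: Z_def)
    ultimately have "poly (pderiv d) x * y x + deriv y x * poly d x =
      (\<Sum>i\<in>I. poly (pderiv (a i)) x * g i x + deriv (g i) x * poly (a i) x)" by (rule DERIV_unique[symmetric])
    then show ?thesis by (simp add: algebra_simps)
  qed
  have "rat_span D g I (\<lambda>x. (\<Sum>i\<in>I. poly (pderiv (a i)) x * g i x + poly (a i) x * deriv (g i) x) - poly (pderiv d) x * y x)"
    by (intro rat_span_diff rat_span_sum rat_span_add rat_span_poly_mult rat_span_base poly_over_pderiv assms da)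
  then show ?thesis
    by (rule rat_span_divide[OF _ da(1,2)])
      (use eq Z in \<open>auto simp: eventually_off_finite elim!: rev_finite_subset\<close>)
qed

lemma rat_span_dependent:
  assumes "finite I" "\<And>k. k \<le> card I \<Longrightarrow> rat_span D g I (u k)"
  shows "\<exists>c. (\<exists>k\<le>card I. c k \<noteq> 0) \<and> (\<forall>k\<le>card I. poly_over K (c k)) \<and>
    eventually (\<lambda>x. (\<Sum>k\<le>card I. poly (c k) x * u k x) = 0) (off_finite D)"
proof -
  define n where "n = card I"
  define Q where "Q k d a \<longleftrightarrow> poly_over K d \<and> d \<noteq> 0 \<and> (\<forall>i\<in>I. poly_over K (a i)) \<and>
     eventually (\<lambda>x. poly d x * u k x = (\<Sum>i\<in>I. poly (a i) x * g i x)) (off_finite D)" for k d a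
  have "\<exists>d a. Q k d a" if "k \<le> n" for k
    using assms(2)[of k] that unfolding rat_span_def n_def Q_def by blast
  then obtain d a where "\<And>k. k \<le> n \<Longrightarrow> Q k (d k) (a k)" by metis
  then have da: "\<And>k. k \<le> n \<Longrightarrow> poly_over K (d k)" "\<And>k. k \<le> n \<Longrightarrow> d k \<noteq> 0"
     "\<And>k i. k \<le> n \<Longrightarrow> i \<in> I \<Longrightarrow> poly_over K (a k i)"
     "\<And>k. k \<le> n \<Longrightarrow> eventually (\<lambda>x. poly (d k) x * u k x = (\<Sum>i\<in>I. poly (a k i) x * g i x)) (off_finite D)"
    unfolding Q_def by blast+
  have "\<exists>c. (\<forall>k\<in>{..n}. c k \<in> {p. poly_over K p}) \<and> (\<exists>k\<in>{..n}. c k \<noteq> 0) \<and> (\<forall>i\<in>I. (\<Sum>k\<in>{..n}. c k * a k i) = 0)"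
    by (rule nontrivial_linear_relation[OF assms(1)]) (use da in \<open>auto simp: n_def intro: poly_over_intros\<close>)
  then obtain c where c: "\<And>k. k \<le> n \<Longrightarrow> poly_over K (c k)" "\<exists>k\<le>n. c k \<noteq> 0"
    "\<And>i. i \<in> I \<Longrightarrow> (\<Sum>k\<le>n. c k * a k i) = 0" by auto
  have "eventually (\<lambda>x. \<forall>k\<in>{..n}. poly (d k) x * u k x = (\<Sum>i\<in>I. poly (a k i) x * g i x)) (off_finite D)"
    using da(4) by (intro eventually_ball_finite) auto
  then have "eventually (\<lambda>x. (\<Sum>k\<le>n. poly (c k * d k) x * u k x) = 0) (off_finite D)"
  proof eventually_elim
    case (elim x)
    have "(\<Sum>k\<le>n. poly (c k * d k) x * u k x) = (\<Sum>k\<le>n. \<Sum>i\<in>I. poly (c k * a k i) x * g i x)"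
      using elim by (intro sum.cong) (auto simp: sum_distrib_left mult.assoc)
    also have "\<dots> = (\<Sum>i\<in>I. poly (\<Sum>k\<le>n. c k * a k i) x * g i x)"
      by (subst sum.swap) (simp add: poly_sum sum_distrib_right)
    finally show ?case using c(3) by simp
  qed
  moreover have "\<exists>k\<le>n. c k * d k \<noteq> 0" using c(2) da(2) by auto
  moreover have "\<forall>k\<le>n. poly_over K (c k * d k)" using c(1) da(1) by (auto intro: poly_over_mult)
  ultimately show ?thesis unfolding n_def by (intro exI[of _ "\<lambda>k. c k * d k"]) blast
qed

text \<open>
  The source of all upper bounds: the order is at most the dimension of a \<open>K(x)\<close>-space that contains the function
  and is closed under differentiation. The derivatives up to order \<open>card I\<close> are too many to be
  independent, and the largest index with a nonzero coefficient is the order of the resulting equation.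
\<close>

theorem ode_of_rat_span:
  assumes "open D" "smooth_on D y" "finite I" "\<And>i. i \<in> I \<Longrightarrow> smooth_on D (g i)"
    and "\<And>i. i \<in> I \<Longrightarrow> rat_span D g I (deriv (g i))" "rat_span D g I y"
  shows "\<exists>N\<le>card I. satisfies_simple_ode K D N y"
proof -
  have "rat_span D g I ((deriv ^^ k) y)" for k
  proof (induction k)
    case (Suc k)
    have "rat_span D g I (deriv ((deriv ^^ k) y))"
      using rat_span_deriv[OF assms(1) smooth_on_higher_deriv[OF assms(2)] assms(4,3,5) Suc] .
    then show ?case by simp
  qed (use assms in simp)
  then have "\<exists>c. (\<exists>k\<le>card I. c k \<noteq> 0) \<and> (\<forall>k\<le>card I. poly_over K (c k)) \<and>
    eventually (\<lambda>x. (\<Sum>k\<le>card I. poly (c k) x * (deriv ^^ k) y x) = 0) (off_finite D)"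
    by (intro rat_span_dependent[OF assms(3)])
  then obtain c where c: "\<exists>k\<le>card I. c k \<noteq> 0" "\<And>k. k \<le> card I \<Longrightarrow> poly_over K (c k)"
    "eventually (\<lambda>x. (\<Sum>k\<le>card I. poly (c k) x * (deriv ^^ k) y x) = 0) (off_finite D)" by blast
  define N where "N = Max {k. k \<le> card I \<and> c k \<noteq> 0}"
  have fin: "finite {k. k \<le> card I \<and> c k \<noteq> 0}" by simp
  have "N \<in> {k. k \<le> card I \<and> c k \<noteq> 0}"
    unfolding N_def by (rule Max_in[OF fin]) (use c(1) in auto)
  then have N: "N \<le> card I" "c N \<noteq> 0" by auto
  have big: "c k = 0" if "k \<le> card I" "N < k" for k
    using Max_ge[OF fin, of k] that unfolding N_def by (auto simp: not_less [symmetric])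
  have sums: "(\<Sum>k\<le>N. poly (c k) x * (deriv ^^ k) y x) = (\<Sum>k\<le>card I. poly (c k) x * (deriv ^^ k) y x)" for x
    by (rule sum.mono_neutral_left) (use N big in auto)
  have "continuous_on D (\<lambda>x. \<Sum>k\<le>card I. poly (c k) x * (deriv ^^ k) y x)"
    by (intro continuous_on_sum continuous_on_mult smooth_on_continuous_on smooth_on_higher_deriv
        smooth_on_poly assms)
  then have "(\<Sum>k\<le>N. poly (c k) x * (deriv ^^ k) y x) = 0" if "x \<in> D" for x
    using zero_off_finite_imp_zero[OF assms(1) _ c(3) that] by (simp only: sums)
  then have "satisfies_simple_ode K D N y"
    using assms(2) N c(2) by (auto simp: satisfies_simple_ode_def intro!: exI[of _ c])
  then show ?thesis using N by blast
qed

section \<open>Composition with algebraic functions\<close>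

lemma ode_rat_span_higher_derivs:
  assumes "open D" "satisfies_simple_ode K D n f"
  shows "rat_span D (\<lambda>k. (deriv ^^ k) f) {..<n} ((deriv ^^ j) f)"
proof -
  let ?S = "rat_span D (\<lambda>k. (deriv ^^ k) f) {..<n}"
  obtain p where p: "\<And>k. k \<le> n \<Longrightarrow> poly_over K (p k)" "p n \<noteq> 0"
    "\<And>x. x \<in> D \<Longrightarrow> (\<Sum>k\<le>n. poly (p k) x * (deriv ^^ k) f x) = 0" and sf: "smooth_on D f"
    using assms(2) by (auto simp: satisfies_simple_ode_def)
  have top: "?S ((deriv ^^ n) f)"
  proof (rule rat_spanI[of "p n" _ "\<lambda>k. - p k"])
    have "poly (p n) x * (deriv ^^ n) f x = (\<Sum>k<n. poly (- p k) x * (deriv ^^ k) f x)" if "x \<in> D" for x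
      using p(3)[OF that] by (simp add: lessThan_Suc_atMost[symmetric] sum_negf add_eq_0_iff)
    then show "eventually (\<lambda>x. poly (p n) x * (deriv ^^ n) f x = (\<Sum>k<n. poly (- p k) x * (deriv ^^ k) f x)) (off_finite D)"
      by (rule eventually_off_finiteI)
  qed (use p in \<open>auto intro: poly_over_uminus\<close>)
  have low: "?S ((deriv ^^ k) f)" if "k \<le> n" for k
    using that top by (cases "k = n") (auto intro: rat_span_base[of "{..<n}" k D "\<lambda>k. (deriv ^^ k) f"])
  show ?thesis
  proof (cases "j \<le> n")
    case False
    have "?S ((deriv ^^ (n + i)) f)" for i
    proof (induction i)
      case (Suc i)
      have "?S (deriv ((deriv ^^ (n + i)) f))"
      proof (rule rat_span_deriv[OF assms(1)])
        show "?S (deriv ((deriv ^^ k) f))" if "k \<in> {..<n}" for k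
          using low[of "Suc k"] that by simp
      qed (use Suc sf in \<open>auto intro: smooth_on_higher_deriv\<close>)
      then show ?case by simp
    qed (use top in simp)
    from this[of "j - n"] show ?thesis using False by simp
  qed (rule low)
qed

text \<open>
  Composition with a function \<open>s\<close> that is algebraic over \<open>K(x)\<close>. The span \<open>V\<close> of the \<open>g i\<close> plays the role of the
  algebra \<open>K(x)[s]\<close>. The products \<open>f\<^sup>(\<^sup>k\<^sup>) \<circ> s\<close> times \<open>g i\<close> with \<open>k < n\<close> span a space closed
  under differentiation, provided that \<open>f\<^sup>(\<^sup>n\<^sup>) \<circ> s\<close> can be eliminated. For this the leading coefficient
  composed with \<open>s\<close> has to be inverted in \<open>V\<close>. It has only finitely many zeros since \<open>s\<close> has finite
  fibres, and an element of a finite-dimensional algebra that does not divide zero is invertible.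
\<close>

lemma order_compose_le:
  assumes "open D" "satisfies_simple_ode K D n f" "open E" "smooth_on E s" "s ` E \<subseteq> D"
    and I: "finite I" "\<And>i. i \<in> I \<Longrightarrow> smooth_on E (g i)" "\<And>i. i \<in> I \<Longrightarrow> rat_span E g I (deriv (g i))"
      "\<And>i j. i \<in> I \<Longrightarrow> j \<in> I \<Longrightarrow> rat_span E g I (\<lambda>x. g i x * g j x)"
    and s: "rat_span E g I (\<lambda>_. 1)" "rat_span E g I s" "rat_span E g I (deriv s)"
      "\<And>c. finite {x\<in>E. s x = c}"
  shows "\<exists>N\<le>n * card I. satisfies_simple_ode K E N (\<lambda>x. f (s x))"
proof -
  let ?V = "rat_span E g I"
  have Vmult: "?V (\<lambda>x. y x * z x)" if "?V y" "?V z" for y z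
  proof (rule rat_span_trans[OF rat_span_mult[OF that I(1) I(1)]])
    fix ij assume "ij \<in> I \<times> I"
    then show "?V ((\<lambda>(i, j) x. g i x * g j x) ij)" using I(4) by auto
  qed
  have Vpoly: "?V (\<lambda>x. poly p (s x))" if "poly_over K p" for p
    using that
  proof (induction p rule: pCons_induct)
    case 0
    then show ?case by (simp add: rat_span_0)
  next
    case (pCons a p)
    have "poly_over K p" using pCons.prems unfolding poly_over_def by (metis coeff_pCons_Suc)
    then have "?V (\<lambda>x. s x * poly p (s x))" using pCons.IH s(2) by (intro Vmult)
    moreover have "a \<in> K" using pCons.prems unfolding poly_over_def by (metis coeff_pCons_0)
    then have "?V (\<lambda>x. poly [:a:] x * 1)" by (intro rat_span_poly_mult s(1) poly_over_const)
    ultimately show ?case using rat_span_add by fastforce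
  qed
  have Vpow: "?V (\<lambda>x. u x ^ k)" if "?V u" for u k
    by (induction k) (use s(1) Vmult[OF that] in auto)
  have Vinv: "\<exists>w c. ?V w \<and> poly_over K c \<and> c \<noteq> 0 \<and> eventually (\<lambda>x. w x * u x = poly c x) (off_finite E)"
    if u: "?V u" "eventually (\<lambda>x. u x \<noteq> 0) (off_finite E)" for u
  proof -
    have "\<exists>c. (\<exists>k\<le>card I. c k \<noteq> 0) \<and> (\<forall>k\<le>card I. poly_over K (c k)) \<and>
        eventually (\<lambda>x. (\<Sum>k\<le>card I. poly (c k) x * u x ^ k) = 0) (off_finite E)"
      by (rule rat_span_dependent[OF I(1) Vpow[OF u(1)]])
    then obtain c where c: "\<exists>k\<le>card I. c k \<noteq> 0" "\<And>k. k \<le> card I \<Longrightarrow> poly_over K (c k)"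
      "eventually (\<lambda>x. (\<Sum>k\<le>card I. poly (c k) x * u x ^ k) = 0) (off_finite E)" by blast
    \<comment> \<open>Dividing a relation between the powers of \<open>u\<close> by its lowest power of \<open>u\<close> expresses
      \<open>c l\<close> as a multiple of \<open>u\<close>.\<close>
    define l where "l = (LEAST k. k \<le> card I \<and> c k \<noteq> 0)"
    have l: "l \<le> card I" "c l \<noteq> 0"
      using LeastI_ex[of "\<lambda>k. k \<le> card I \<and> c k \<noteq> 0"] c(1) by (auto simp: l_def)
    have low: "c k = 0" if "k < l" for k
      using not_less_Least[of k "\<lambda>k. k \<le> card I \<and> c k \<noteq> 0"] that l(1) by (auto simp: l_def)
    define w where "w x = - (\<Sum>k=Suc l..card I. poly (c k) x * u x ^ (k - Suc l))" for x
    have "?V w" unfolding w_def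
      by (intro rat_span_uminus rat_span_sum rat_span_poly_mult Vpow u(1) c(2)) auto
    moreover have "eventually (\<lambda>x. w x * u x = poly (c l) x) (off_finite E)"
      using c(3) u(2)
    proof eventually_elim
      case (elim x)
      have "(\<Sum>k\<le>card I. poly (c k) x * u x ^ k) = (\<Sum>k=l..card I. poly (c k) x * u x ^ k)"
        by (rule sum.mono_neutral_right) (use low in auto)
      also have "\<dots> = poly (c l) x * u x ^ l + (\<Sum>k=Suc l..card I. poly (c k) x * u x ^ k)"
        using l(1) by (simp add: sum.atLeast_Suc_atMost)
      also have "(\<Sum>k=Suc l..card I. poly (c k) x * u x ^ k) =
          u x ^ Suc l * (\<Sum>k=Suc l..card I. poly (c k) x * u x ^ (k - Suc l))"
        unfolding sum_distrib_left
      proof (intro sum.cong refl)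
        fix k assume "k \<in> {Suc l..card I}"
        then have "u x ^ k = u x ^ Suc l * u x ^ (k - Suc l)" by (simp flip: power_add del: power_Suc)
        then show "poly (c k) x * u x ^ k = u x ^ Suc l * (poly (c k) x * u x ^ (k - Suc l))"
          by (simp only: mult.left_commute)
      qed
      finally have "u x ^ l * (poly (c l) x - w x * u x) = 0"
        using elim(1) by (simp add: w_def algebra_simps)
      then show ?case using elim(2) by simp
    qed
    ultimately show ?thesis using l c(2) by blast
  qed
  obtain p where p: "\<And>k. k \<le> n \<Longrightarrow> poly_over K (p k)" "p n \<noteq> 0"
    "\<And>x. x \<in> D \<Longrightarrow> (\<Sum>k\<le>n. poly (p k) x * (deriv ^^ k) f x) = 0" and sf: "smooth_on D f"
    using assms(2) by (auto simp: satisfies_simple_ode_def)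
  have "eventually (\<lambda>x. poly (p n) (s x) \<noteq> 0) (off_finite E)"
  proof -
    have "finite (\<Union>c\<in>{c. poly (p n) c = 0}. {x\<in>E. s x = c})"
      using poly_roots_finite[OF p(2)] s(4) by blast
    then show ?thesis unfolding eventually_off_finite by (rule rev_finite_subset) auto
  qed
  then obtain w c where w: "?V w" "poly_over K c" "c \<noteq> 0"
    "eventually (\<lambda>x. w x * poly (p n) (s x) = poly c x) (off_finite E)"
    using Vinv[OF Vpoly[OF p(1)[OF order_refl]]] by blast
  define f' where "f' k x = (deriv ^^ k) f (s x)" for k x
  define G where "G = (\<lambda>(k, i) x. f' k x * g i x)"
  let ?J = "{..<n} \<times> I"
  let ?W = "rat_span E G ?J"
  have Wlow: "?W (\<lambda>x. v x * f' k x)" if "?V v" "k < n" for v k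
  proof (rule rat_span_trans[OF rat_span_mult_right[OF that(1)]])
    fix i assume "i \<in> I"
    then show "?W (\<lambda>x. g i x * f' k x)"
      using rat_span_base[of ?J "(k, i)" E G] I(1) that(2) by (simp add: G_def mult.commute)
  qed
  have W: "?W (\<lambda>x. v x * f' k x)" if v: "?V v" and k: "k \<le> n" for v k
  proof (cases "k < n")
    case False
    then have "k = n" using k by simp
    have "?W (\<lambda>x. - (\<Sum>k<n. (v x * (w x * poly (p k) (s x))) * f' k x))"
    proof (intro rat_span_uminus rat_span_sum)
      fix k assume "k \<in> {..<n}"
      then show "?W (\<lambda>x. (v x * (w x * poly (p k) (s x))) * f' k x)"
        by (intro Wlow Vmult v w(1) Vpoly p(1)) auto
    qed
    then show ?thesis unfolding \<open>k = n\<close>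
    proof (rule rat_span_divide[OF _ w(2,3)])
      show "eventually (\<lambda>x. poly c x * (v x * f' n x) = - (\<Sum>k<n. (v x * (w x * poly (p k) (s x))) * f' k x)) (off_finite E)"
        using w(4) eventually_off_finite_mem
      proof eventually_elim
        case (elim x)
        then have "s x \<in> D" using assms(5) by blast
        then have "poly (p n) (s x) * f' n x = - (\<Sum>k<n. poly (p k) (s x) * f' k x)"
          using p(3) by (simp add: f'_def lessThan_Suc_atMost[symmetric] add_eq_0_iff)
        moreover have "poly c x * (v x * f' n x) = v x * w x * (poly (p n) (s x) * f' n x)"
          by (simp add: elim(1)[symmetric] mult_ac)
        ultimately show ?case by (simp add: sum_distrib_left mult_ac)
      qed
    qed
  qed (use Wlow v in blast)
  have sf': "smooth_on E (f' k)" for k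
    unfolding f'_def by (rule smooth_on_compose[OF assms(3,4) smooth_on_higher_deriv[OF sf] assms(5)])
  have df': "deriv (f' k) x = f' (Suc k) x * deriv s x" if "x \<in> E" for k x
  proof -
    have "s x \<in> D" using that assms(5) by blast
    then show ?thesis unfolding f'_def
      by (intro DERIV_imp_deriv DERIV_chain2[OF smooth_on_has_field_derivative[OF sf] smooth_on_DERIV[OF assms(4) that]])
  qed
  have sG: "smooth_on E (G ki)" if "ki \<in> ?J" for ki
    using that unfolding G_def by (auto intro!: smooth_on_mult assms(3) sf' I(2))
  have dG: "?W (deriv (G ki))" if kiJ: "ki \<in> ?J" for ki
  proof -
    obtain k i where ki: "ki = (k, i)" "k < n" "i \<in> I" using kiJ by auto
    have "?W (\<lambda>x. (deriv s x * g i x) * f' (Suc k) x + deriv (g i) x * f' k x)"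
      by (intro rat_span_add W Vmult s(3) rat_span_base I ki) (use ki in auto)
    then show ?thesis
    proof (rule rat_span_cong[OF _ eventually_off_finiteI])
      fix x assume x: "x \<in> E"
      have "deriv (\<lambda>x. f' k x * g i x) x = deriv (f' k) x * g i x + deriv (g i) x * f' k x"
        by (intro DERIV_imp_deriv DERIV_mult smooth_on_DERIV[OF sf' x] smooth_on_DERIV[OF I(2)[OF ki(3)] x])
      then show "deriv (G ki) x = (deriv s x * g i x) * f' (Suc k) x + deriv (g i) x * f' k x"
        by (simp add: G_def ki(1) df'[OF x] mult_ac)
    qed
  qed
  have "?W (\<lambda>x. f (s x))" using W[OF s(1), of 0] by (simp add: f'_def)
  then have "\<exists>N\<le>card ?J. satisfies_simple_ode K E N (\<lambda>x. f (s x))"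
    using I(1) by (intro ode_of_rat_span[OF assms(3) smooth_on_compose[OF assms(3,4) sf assms(5)] _ sG dG]) auto
  then show ?thesis by (simp add: card_cartesian_product)
qed

end

section \<open>Antiderivatives of exponentials of powers\<close>

text \<open>
  The Taylor coefficients of \<open>exp (x ^ k)\<close> at \<open>0\<close>. Integrating this everywhere convergent series term by term gives a
  primitive over the real and the complex numbers alike.
\<close>

definition exp_power_coeff :: "nat \<Rightarrow> nat \<Rightarrow> 'a::{real_normed_field,banach}" where
  "exp_power_coeff k i = (if k dvd i then inverse (fact (i div k)) else 0)"

lemma exp_power_sums:
  fixes x :: "'a::{real_normed_field,banach}"
  assumes "k \<ge> 1"
  shows "(\<lambda>i. exp_power_coeff k i * x ^ i) sums exp (x ^ k)"
proof -
  have "strict_mono (\<lambda>i. i * k)" using assms by (auto intro: strict_monoI)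
  moreover have "exp_power_coeff k i * x ^ i = 0" if "i \<notin> range (\<lambda>i. i * k)" for i
    using that by (auto simp: exp_power_coeff_def dvd_def mult.commute)
  ultimately have "(\<lambda>i. exp_power_coeff k (i * k) * x ^ (i * k)) sums exp (x ^ k) \<longleftrightarrow>
      (\<lambda>i. exp_power_coeff k i * x ^ i) sums exp (x ^ k)"
    by (rule sums_mono_reindex)
  moreover have "(\<lambda>i. exp_power_coeff k (i * k) * x ^ (i * k)) sums exp (x ^ k)"
    using exp_converges[of "x ^ k"] assms
    by (simp add: exp_power_coeff_def scaleR_conv_of_real divide_inverse power_mult[symmetric] mult.commute)
  ultimately show ?thesis by blast
qed

lemma exp_power_has_primitive:
  assumes "k \<ge> 1"
  shows "\<exists>F. \<forall>x::'a::{real_normed_field,banach}. (F has_field_derivative exp (x ^ k)) (at x)"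
proof -
  define C :: "nat \<Rightarrow> 'a" where "C i = (case i of 0 \<Rightarrow> 0 | Suc j \<Rightarrow> exp_power_coeff k j / of_nat (Suc j))" for i
  have "summable (\<lambda>i. C i * y ^ i)" for y
  proof -
    have 1: "summable (\<lambda>i. norm y * (exp_power_coeff k i * norm y ^ i))"
      by (intro summable_mult sums_summable[OF exp_power_sums[OF assms]])
    have 2: "norm (C (Suc i) * y ^ Suc i) \<le> norm y * (exp_power_coeff k i * norm y ^ i)" for i
    proof -
      have "norm (C (Suc i)) \<le> (exp_power_coeff k i :: real)"
        by (auto simp: C_def exp_power_coeff_def norm_divide norm_inverse divide_le_eq simp del: of_nat_Suc)
      then have "norm (C (Suc i)) * norm y ^ Suc i \<le> exp_power_coeff k i * norm y ^ Suc i"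
        by (rule mult_right_mono) simp
      then show ?thesis by (simp add: norm_mult norm_power mult_ac)
    qed
    have "summable (\<lambda>i. C (Suc i) * y ^ Suc i)"
      by (rule summable_comparison_test'[OF 1, of 0]) (rule 2)
    then show ?thesis using summable_Suc_iff[of "\<lambda>i. C i * y ^ i"] by simp
  qed
  from termdiffs_strong_converges_everywhere[OF this]
  have "((\<lambda>x. \<Sum>n. C n * x ^ n) has_field_derivative (\<Sum>n. diffs C n * x ^ n)) (at x)" for x .
  moreover have "diffs C = exp_power_coeff k"
    by (rule ext) (simp add: diffs_def C_def del: of_nat_Suc)
  ultimately have "((\<lambda>x. \<Sum>n. C n * x ^ n) has_field_derivative exp (x ^ k)) (at x)" for x
    using sums_unique[OF exp_power_sums[OF assms, of x]] by simp
  then show ?thesis by blast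
qed

section \<open>Newton polygons and branches of powers\<close>

lemma max_degree_attained_twice:
  fixes g :: "nat \<Rightarrow> 'a::comm_ring_1 poly"
  assumes "finite S" "S \<noteq> {}" "\<And>j. j \<in> S \<Longrightarrow> g j \<noteq> 0" "(\<Sum>j\<in>S. g j) = 0"
  shows "\<exists>i\<in>S. \<exists>j\<in>S. i < j \<and> degree (g i) = degree (g j) \<and> (\<forall>l\<in>S. degree (g l) \<le> degree (g j))"
proof -
  define M where "M = Max ((\<lambda>j. degree (g j)) ` S)"
  have M: "degree (g l) \<le> M" if "l \<in> S" for l using that assms(1) by (simp add: M_def)
  have "M \<in> (\<lambda>j. degree (g j)) ` S" unfolding M_def using assms(1,2) by (intro Max_in) auto
  then obtain j0 where j0: "j0 \<in> S" "degree (g j0) = M" by auto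
  have "\<exists>i\<in>S. i \<noteq> j0 \<and> degree (g i) = M"
  proof (rule ccontr)
    assume "\<not> ?thesis"
    then have "coeff (g i) M = 0" if "i \<in> S - {j0}" for i
      using that M[of i] by (intro coeff_eq_0) force
    then have "coeff (\<Sum>j\<in>S. g j) M = coeff (g j0) M"
      using assms(1) j0(1) by (simp add: coeff_sum sum.remove)
    then show False using assms(3,4) j0 by auto
  qed
  then obtain i where i: "i \<in> S" "i \<noteq> j0" "degree (g i) = M" by blast
  then show ?thesis using j0 M by (cases "i < j0") (metis, metis linorder_neqE_nat)
qed

text \<open>
  The lengths of the edges of a Newton polygon add up. Here \<open>\<phi> k j\<close> is the degree of the \<open>j\<close>-th term of a vanishing
  sum when the solution of type \<open>k\<close> is inserted, and the indices where it is maximal lie on an edge whose slope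
  depends on \<open>k\<close>. Since the slopes increase with \<open>k\<close>, each edge starts no earlier than the preceding one ends.
\<close>

lemma newton_polygon_length:
  fixes \<phi> :: "nat \<Rightarrow> nat \<Rightarrow> nat"
  assumes "S \<noteq> {}"
    and shift: "\<And>k l. \<phi> (Suc k) l = \<phi> k l + l * \<delta>" and "\<delta> > 0"
    and edge: "\<And>k. 1 \<le> k \<Longrightarrow> k \<le> n \<Longrightarrow> \<exists>i\<in>S. \<exists>j\<in>S. i + q \<le> j \<and> \<phi> k i = \<phi> k j \<and> (\<forall>l\<in>S. \<phi> k l \<le> \<phi> k j)"
  shows "\<exists>j\<in>S. n * q \<le> j"
proof -
  have "\<exists>j\<in>S. k * q \<le> j \<and> (k \<ge> 1 \<longrightarrow> (\<forall>l\<in>S. \<phi> k l \<le> \<phi> k j))" if "k \<le> n" for k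
    using that
  proof (induction k)
    case 0
    then show ?case using assms(1) by auto
  next
    case (Suc k)
    then obtain j0 where j0: "j0 \<in> S" "k * q \<le> j0" "k \<ge> 1 \<Longrightarrow> \<forall>l\<in>S. \<phi> k l \<le> \<phi> k j0" by auto
    obtain i j where ij: "i \<in> S" "j \<in> S" "i + q \<le> j" "\<phi> (Suc k) i = \<phi> (Suc k) j"
      "\<forall>l\<in>S. \<phi> (Suc k) l \<le> \<phi> (Suc k) j" using edge[of "Suc k"] Suc.prems by auto
    have "k * q \<le> i"
    proof (cases "k = 0")
      case False
      have "j0 \<le> i"
      proof (rule ccontr)
        assume "\<not> j0 \<le> i"
        then have "i * \<delta> < j0 * \<delta>" using \<open>\<delta> > 0\<close> by simp
        moreover have "\<phi> k i \<le> \<phi> k j0" using j0(3) ij(1) False by auto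
        ultimately have "\<phi> (Suc k) i < \<phi> (Suc k) j0"
          unfolding shift by (intro add_le_less_mono)
        then show False using ij(4,5) j0(1) by (metis not_le)
      qed
      then show ?thesis using j0(2) by linarith
    qed simp
    then show ?case using ij by (intro bexI[of _ j]) auto
  qed
  from this[of n] show ?thesis by blast
qed

text \<open>
  If \<open>h' = \<alpha> h / x\<close>, that is, if \<open>h\<close> is a branch of \<open>x\<^sup>\<alpha>\<close> up to a constant factor, then the \<open>j\<close>-th derivative
  of \<open>exp h\<close> is \<open>exp h / x ^ j\<close> times this polynomial in \<open>h\<close>. Its degree is \<open>j\<close>, so it carries exactly the growth that the Newton
  polygon records.
\<close>

primrec exp_power_numerator :: "'a::real_normed_field \<Rightarrow> nat \<Rightarrow> 'a poly" where
  "exp_power_numerator \<alpha> 0 = 1"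
| "exp_power_numerator \<alpha> (Suc j) =
    [:0, \<alpha>:] * (exp_power_numerator \<alpha> j + pderiv (exp_power_numerator \<alpha> j))
    - smult (of_nat j) (exp_power_numerator \<alpha> j)"

lemma degree_exp_power_numerator:
  assumes "\<alpha> \<noteq> 0"
  shows "exp_power_numerator \<alpha> j \<noteq> 0 \<and> degree (exp_power_numerator \<alpha> j) = j"
proof (induction j)
  case (Suc j)
  define T where "T = exp_power_numerator \<alpha> j"
  have T: "T \<noteq> 0" "degree T = j" using Suc by (auto simp: T_def)
  have *: "degree (T + pderiv T) = j \<and> T + pderiv T \<noteq> 0"
  proof (cases "j = 0")
    case True
    then have "pderiv T = 0" using T(2) by (simp add: pderiv_eq_0_iff)
    then show ?thesis using T by simp
  next
    case False
    then have "degree (pderiv T) < degree T" using T by (simp add: degree_pderiv)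
    then have "degree (T + pderiv T) = degree T" by (rule degree_add_eq_left)
    then show ?thesis using T False by auto
  qed
  then have "degree ([:0, \<alpha>:] * (T + pderiv T)) = Suc j"
    using assms by (subst degree_mult_eq) auto
  moreover have "degree (- smult (of_nat j) T) < Suc j"
    using degree_smult_le[of "of_nat j" T] T(2) by simp
  ultimately have "degree ([:0, \<alpha>:] * (T + pderiv T) + - smult (of_nat j) T) = Suc j"
    by (subst degree_add_eq_left) auto
  then have "degree (exp_power_numerator \<alpha> (Suc j)) = Suc j" by (simp add: T_def)
  then show ?case by (metis degree_0 nat.distinct(1))
qed simp

lemma has_field_derivative_exp_power:
  fixes h :: "'a::{real_normed_field,banach} \<Rightarrow> 'a"
  assumes "(h has_field_derivative \<alpha> * h x / x) (at x)" "x \<noteq> 0"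
  shows "((\<lambda>x. poly (exp_power_numerator \<alpha> j) (h x) / x ^ j * exp (h x)) has_field_derivative
    poly (exp_power_numerator \<alpha> (Suc j)) (h x) / x ^ Suc j * exp (h x)) (at x)"
proof -
  let ?T = "exp_power_numerator \<alpha> j"
  have 1: "((\<lambda>x. poly ?T (h x)) has_field_derivative poly (pderiv ?T) (h x) * (\<alpha> * h x / x)) (at x)"
    by (rule DERIV_chain2[OF poly_DERIV assms(1)])
  have 2: "((\<lambda>x. exp (h x)) has_field_derivative exp (h x) * (\<alpha> * h x / x)) (at x)"
    by (rule DERIV_chain2[OF DERIV_exp assms(1)])
  have 3: "((\<lambda>x. x ^ j) has_field_derivative of_nat j * x ^ (j - 1)) (at x)"
    by (auto intro!: derivative_eq_intros)
  have eq: "((poly (pderiv ?T) (h x) * (\<alpha> * h x / x)) * x ^ j - poly ?T (h x) * (of_nat j * x ^ (j - 1))) / (x ^ j * x ^ j) * exp (h x)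
      + exp (h x) * (\<alpha> * h x / x) * (poly ?T (h x) / x ^ j) =
      poly (exp_power_numerator \<alpha> (Suc j)) (h x) / x ^ Suc j * exp (h x)"
    using assms(2) by (cases j) (simp_all add: field_simps)
  show ?thesis
    using DERIV_mult[OF DERIV_divide[OF 1 3] 2] assms(2) unfolding eq by simp
qed

lemma power_branch_deriv:
  assumes "power_branch p q E s" "q \<ge> 1" "open E" "x \<in> E" "x \<noteq> 0"
  shows "deriv s x = of_int p / of_nat q * s x / x"
proof -
  have s: "smooth_on E s" "\<And>x. x \<in> E \<Longrightarrow> s x ^ q = x powi p"
    using assms(1) by (auto simp: power_branch_def)
  have "q > 0" using assms(2) by simp
  then have sx: "s x \<noteq> 0" using s(2)[OF assms(4)] assms(5) by (auto simp: power_0_left)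
  have "((\<lambda>x. s x ^ q) has_field_derivative of_nat q * (deriv s x * s x ^ (q - 1))) (at x)"
    using DERIV_power[OF smooth_on_DERIV[OF s(1) assms(4)], of q] by simp
  then have "((\<lambda>x. x powi p) has_field_derivative of_nat q * (deriv s x * s x ^ (q - 1))) (at x)"
    by (rule has_field_derivative_transform_within_open[OF _ assms(3,4)]) (simp add: s(2))
  moreover have "((\<lambda>x. x powi p) has_field_derivative of_int p * x powi (p - 1)) (at x)"
    using assms(5) by (auto intro!: derivative_eq_intros)
  ultimately have "of_nat q * (deriv s x * s x ^ (q - 1)) = of_int p * x powi (p - 1)" by (rule DERIV_unique)
  then have "of_nat q * (deriv s x * s x ^ (q - 1)) * (s x * x) = of_int p * (x powi (p - 1) * x) * s x"
    by simp
  also have "x powi (p - 1) * x = s x ^ q"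
    using assms(5) s(2)[OF assms(4)] by (simp add: power_int_diff)
  finally have "(of_nat q * deriv s x * x) * (s x ^ (q - 1) * s x) = (of_int p * s x) * s x ^ q"
    by (simp only: mult_ac)
  moreover have "s x ^ (q - 1) * s x = s x ^ q" using \<open>q > 0\<close> by (rule power_minus_mult)
  ultimately have "(of_nat q * deriv s x * x) * s x ^ q = (of_int p * s x) * s x ^ q" by (simp only:)
  then have "of_nat q * deriv s x * x = of_int p * s x" using sx by simp
  then show ?thesis using assms(2,5) by (simp add: field_simps)
qed

text \<open>
  A branch \<open>s\<close> of \<open>x ^ (p / q)\<close> is uniformized by \<open>x = w ^ q\<close> and \<open>s = w ^ p\<close>, which turns algebraic functions
  into polynomials. The quotient \<open>s (w ^ q) / w ^ p\<close> is always a \<open>q\<close>-th root of unity. There are finitely many of these, so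
  by continuity the set where it equals \<open>1\<close> is open.
\<close>

lemma open_parametrization_of_power_branch:
  fixes s :: "'a::real_normed_field \<Rightarrow> 'a"
  assumes "open E" "E \<noteq> {}" "0 \<notin> E" "power_branch (int p) q E s" "p \<ge> 1" "q \<ge> 1" "coprime p q"
  shows "\<exists>W. open W \<and> W \<noteq> {} \<and> (\<forall>w\<in>W. w ^ q \<in> E \<and> s (w ^ q) = w ^ p)"
proof -
  have s: "smooth_on E s" "\<And>x. x \<in> E \<Longrightarrow> s x ^ q = x ^ p"
    using assms(4) by (auto simp: power_branch_def)
  have q0: "q > 0" using assms(6) by simp
  define E2 where "E2 = (\<lambda>w. w ^ q) -` E"
  have E2: "open E2" unfolding E2_def
    by (rule open_vimage[OF assms(1)]) (intro continuous_intros)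
  have E20: "w \<noteq> 0" if "w \<in> E2" for w using that assms(3) q0 by (auto simp: E2_def power_0_left)
  define v where "v w = s (w ^ q) / w ^ p" for w
  have vq: "v w ^ q = 1" if "w \<in> E2" for w
    using s(2)[of "w ^ q"] that E20[OF that] by (simp add: v_def E2_def power_divide flip: power_mult)
      (simp add: mult.commute)
  define R where "R = {r::'a. r ^ q = 1 \<and> r \<noteq> 1}"
  have "finite {r::'a. poly (monom 1 q - 1) r = 0}"
    using assms(6) by (intro poly_roots_finite) (metis degree_1 degree_monom_eq diff_eq_eq add_0 not_one_le_zero zero_neq_one)
  then have "finite R" by (rule rev_finite_subset) (auto simp: R_def poly_monom)
  have "continuous_on E2 v" unfolding v_def
    by (intro continuous_on_divide continuous_on_compose2[OF smooth_on_continuous_on[OF s(1)]] continuous_intros)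
      (use E20 in \<open>auto simp: E2_def\<close>)
  then have oW: "open (E2 \<inter> v -` (- R))"
    by (rule continuous_open_preimage[OF _ E2]) (use \<open>finite R\<close> in \<open>simp add: finite_imp_closed open_Compl\<close>)
  obtain x where x: "x \<in> E" using assms(2) by blast
  have x0: "x \<noteq> 0" using x assms(3) by auto
  have sx0: "s x \<noteq> 0" using s(2)[OF x] x0 q0 by (auto simp: power_0_left)
  \<comment> \<open>A point of that set over a given \<open>x\<close> is the product of powers of \<open>x\<close> and \<open>s x\<close> with Bezout coefficients as exponents.\<close>
  obtain a b where ab: "a * int q + b * int p = 1"
    using assms(7) bezout_int[of "int q" "int p"] by (auto simp: gcd.commute coprime_iff_gcd_eq_1)
  define t where "t = x powi a * s x powi b"
  have sq: "s x powi (c * int q) = x powi (c * int p)" for c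
    using s(2)[OF x] by (simp add: power_int_mult mult.commute[of c])
  have "t powi int q = x powi (a * int q) * s x powi (b * int q)"
    by (simp only: t_def power_int_mult_distrib power_int_mult)
  also have "\<dots> = x powi (a * int q + b * int p)"
    using x0 by (simp add: sq power_int_add)
  finally have tq: "t ^ q = x" by (simp add: ab)
  have "t powi int p = x powi (a * int p) * s x powi (b * int p)"
    by (simp only: t_def power_int_mult_distrib power_int_mult)
  also have "\<dots> = s x powi (a * int q + b * int p)"
    using sx0 by (simp add: sq[symmetric] power_int_add)
  finally have tp: "t ^ p = s x" by (simp add: ab)
  have "t \<in> E2 \<inter> v -` (- R)"
    using x tq tp sx0 by (auto simp: E2_def v_def R_def)
  moreover have "w ^ q \<in> E \<and> s (w ^ q) = w ^ p" if "w \<in> E2 \<inter> v -` (- R)" for w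
  proof -
    have "v w = 1" using that vq[of w] by (auto simp: R_def)
    then show ?thesis using that E20[of w] by (auto simp: v_def E2_def)
  qed
  ultimately show ?thesis using oW by blast
qed

text \<open>
  In the parameter \<open>w\<close>, the terms of the sum become \<open>exp (w ^ m k)\<close> with \<open>m k = p (k q + 1)\<close>, and an equation for the
  sum holds for each of them, by independence of exponentials. The coefficients of the equation are polynomials in
  \<open>w ^ q\<close>, whereas \<open>m k\<close> is coprime to \<open>q\<close>. Two terms \<open>i < j\<close> of the \<open>k\<close>-th relation can therefore have the same degree
  only if \<open>q\<close> divides \<open>j - i\<close>. So each of the \<open>n\<close> edges of the Newton polygon has length at least \<open>q\<close>. Over
  the complex numbers one could instead use the \<open>n q\<close> solutions that arise from the branches of the power; the
  argument by degrees does not need roots of unity and covers the real case as well.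
\<close>

theorem order_exp_sum_mult_power_branch_ge:
  fixes s :: "'a::{real_normed_field,banach} \<Rightarrow> 'a"
  assumes "open E" "E \<noteq> {}" "power_branch (int p) q E s" "p \<ge> 1" "q \<ge> 1" "coprime p q"
    and ode: "satisfies_simple_ode K E N (\<lambda>x. exp_sum_mult n q (s x))"
  shows "n * q \<le> N"
proof -
  define E1 where "E1 = E - {0}"
  have E1: "open E1" "0 \<notin> E1" "E1 \<subseteq> E" using assms(1) by (auto simp: E1_def)
  have "E1 \<noteq> {}" using infinite_if_open_nonempty[OF assms(1,2)] finite_subset[of E "{0}"]
    by (auto simp: E1_def)
  have pb: "power_branch (int p) q E1 s"
    using assms(3) E1(3) by (auto simp: power_branch_def intro: smooth_on_subset)
  then have ss: "smooth_on E1 s" by (simp add: power_branch_def)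
  obtain W where W: "open W" "W \<noteq> {}" "\<And>w. w \<in> W \<Longrightarrow> w ^ q \<in> E1" "\<And>w. w \<in> W \<Longrightarrow> s (w ^ q) = w ^ p"
    using open_parametrization_of_power_branch[OF E1(1) \<open>E1 \<noteq> {}\<close> E1(2) pb assms(4-6)] by blast
  define m where "m k = p * (k * q + 1)" for k
  define \<alpha> :: "nat \<Rightarrow> 'a" where "\<alpha> k = of_nat (m k) / of_nat q" for k
  define h where "h k x = s x ^ (k * q + 1)" for k x
  have m0: "m k > 0" for k using assms(4) by (simp add: m_def)
  have \<alpha>0: "\<alpha> k \<noteq> 0" for k using m0[of k] assms(5) by (simp add: \<alpha>_def)
  have dh: "(h k has_field_derivative \<alpha> k * h k x / x) (at x)" if x: "x \<in> E1" for k x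
  proof -
    have "x \<noteq> 0" using x E1 by auto
    have "(h k has_field_derivative of_nat (k * q + 1) * (deriv s x * s x ^ (k * q + 1 - 1))) (at x)"
      unfolding h_def [abs_def] using DERIV_power[OF smooth_on_DERIV[OF ss x], of "k * q + 1"] by simp
    also have "deriv s x = of_nat p / of_nat q * s x / x"
      using power_branch_deriv[OF pb assms(5) E1(1) x \<open>x \<noteq> 0\<close>] by simp
    also have "of_nat (k * q + 1) * (of_nat p / of_nat q * s x / x * s x ^ (k * q + 1 - 1)) = \<alpha> k * h k x / x"
      by (simp add: h_def \<alpha>_def m_def algebra_simps)
    finally show ?thesis .
  qed
  define T where "T k = exp_power_numerator (\<alpha> k)" for k
  define y where "y x = exp_sum_mult n q (s x)" for x
  have dy: "(deriv ^^ j) y x = (\<Sum>k=1..n. poly (T k j) (h k x) / x ^ j * exp (h k x))" if x: "x \<in> E1" for j x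
    using E1(1)
  proof (rule higher_deriv_eqI[where g = "\<lambda>j x. \<Sum>k=1..n. poly (T k j) (h k x) / x ^ j * exp (h k x)"])
    fix j x assume x: "x \<in> E1"
    then have "x \<noteq> 0" using E1(2) by auto
    then show "((\<lambda>x. \<Sum>k=1..n. poly (T k j) (h k x) / x ^ j * exp (h k x)) has_field_derivative
      (\<Sum>k=1..n. poly (T k (Suc j)) (h k x) / x ^ Suc j * exp (h k x))) (at x)"
      unfolding T_def by (intro DERIV_sum has_field_derivative_exp_power dh x)
  qed (use x in \<open>simp_all add: T_def h_def y_def exp_sum_mult_def\<close>)
  obtain c where c: "c N \<noteq> 0" "\<And>x. x \<in> E \<Longrightarrow> (\<Sum>j\<le>N. poly (c j) x * (deriv ^^ j) y x) = 0"
    using ode by (auto simp: satisfies_simple_ode_def y_def [abs_def])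
  \<comment> \<open>The \<open>j\<close>-th term of the equation for \<open>exp (w ^ m k)\<close>, multiplied by \<open>w ^ (q N)\<close> to clear the powers of \<open>x\<close> in the denominators.\<close>
  define g where "g k j = pcompose (c j) (monom 1 q) * monom 1 (q * (N - j)) * pcompose (T k j) (monom 1 (m k))" for k j
  have "(\<Sum>j\<le>N. g k j) = 0" if "k \<in> {1..n}" for k
  proof (rule exponentials_independent_over_polys[OF W(1,2), where B = 1 and A = "\<lambda>k. monom 1 (m k)" and I = "{1..n}"
        and b = "\<lambda>k. \<Sum>j\<le>N. g k j"])
    show "monom 1 (m i) - monom 1 (m j) \<noteq> smult d (1 :: 'a poly)" if "i \<noteq> j" for i j d
    proof
      assume "monom 1 (m i) - monom 1 (m j) = smult d (1 :: 'a poly)"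
      then have "coeff (monom 1 (m i) - monom 1 (m j)) (m i) = coeff (smult d (1 :: 'a poly)) (m i)" by simp
      moreover have "m i \<noteq> m j" "m i \<noteq> 0" using that assms(4,5) by (auto simp: m_def)
      ultimately show False by (simp add: coeff_pCons split: nat.splits)
    qed
    fix w assume w: "w \<in> W"
    have w0: "w \<noteq> 0" using W(3)[OF w] E1(2) assms(5) by (auto simp: power_0_left)
    have hw: "h k (w ^ q) = w ^ m k" for k
      by (simp only: h_def W(4)[OF w] m_def power_mult)
    have gw: "poly (g k j) w = w ^ (q * N) * (poly (c j) (w ^ q) * (poly (T k j) (w ^ m k) / (w ^ q) ^ j))" if "j \<le> N" for k j
    proof -
      have "q * N = q * (N - j) + q * j" using that by (simp flip: add_mult_distrib2)
      then have "w ^ (q * N) = w ^ (q * (N - j)) * (w ^ q) ^ j" by (simp only: power_add power_mult)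
      then show ?thesis using w0 by (simp add: g_def poly_pcompose poly_monom)
    qed
    have "(\<Sum>k=1..n. poly (\<Sum>j\<le>N. g k j) w * exp (w ^ m k)) =
        (\<Sum>k=1..n. \<Sum>j\<le>N. w ^ (q * N) * (poly (c j) (w ^ q) * (poly (T k j) (w ^ m k) / (w ^ q) ^ j)) * exp (w ^ m k))"
      by (simp add: poly_sum gw sum_distrib_right)
    also have "\<dots> = (\<Sum>j\<le>N. \<Sum>k=1..n. w ^ (q * N) * (poly (c j) (w ^ q) * (poly (T k j) (w ^ m k) / (w ^ q) ^ j)) * exp (w ^ m k))"
      by (rule sum.swap)
    also have "\<dots> = w ^ (q * N) * (\<Sum>j\<le>N. poly (c j) (w ^ q) * (deriv ^^ j) y (w ^ q))"
      by (simp add: dy[OF W(3)[OF w]] hw sum_distrib_left mult.assoc)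
    also have "\<dots> = 0" using c(2) W(3)[OF w] E1(3) by auto
    finally show "(\<Sum>k=1..n. poly (\<Sum>j\<le>N. g k j) w * exp (poly (monom 1 (m k)) w / poly 1 w)) = 0"
      by (simp add: poly_monom)
  qed (use that in auto)
  define S where "S = {j. j \<le> N \<and> c j \<noteq> 0}"
  have S: "finite S" "S \<noteq> {}" "S \<subseteq> {..N}" using c(1) by (auto simp: S_def)
  define \<phi> where "\<phi> k j = q * degree (c j) + q * (N - j) + j * m k" for k j
  have g: "g k j \<noteq> 0" "degree (g k j) = \<phi> k j" if "j \<in> S" for k j
  proof -
    have T: "T k j \<noteq> 0" "degree (T k j) = j" using degree_exp_power_numerator[OF \<alpha>0] by (auto simp: T_def)
    have "m k > 0" using assms(4) by (simp add: m_def)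
    then have nz: "pcompose (c j) (monom 1 q) \<noteq> 0" "pcompose (T k j) (monom 1 (m k)) \<noteq> 0" "monom (1::'a) (q * (N - j)) \<noteq> 0"
      using T(1) that assms(5) by (auto simp: S_def pcompose_eq_0_iff degree_monom_eq)
    then show "g k j \<noteq> 0" by (simp add: g_def)
    show "degree (g k j) = \<phi> k j"
      using nz T(2) by (simp add: g_def degree_mult_eq degree_pcompose degree_monom_eq \<phi>_def mult.commute)
  qed
  have "\<exists>j\<in>S. n * q \<le> j"
  proof (rule newton_polygon_length[of S \<phi> "p * q"])
    show "\<phi> (Suc k) l = \<phi> k l + l * (p * q)" for k l
      by (simp add: \<phi>_def m_def algebra_simps)
    show "p * q > 0" using assms(4,5) by simp
    fix k assume k: "1 \<le> k" "k \<le> n"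
    have "(\<Sum>j\<in>S. g k j) = (\<Sum>j\<le>N. g k j)"
      by (rule sum.mono_neutral_left) (use S in \<open>auto simp: S_def g_def\<close>)
    also have "\<dots> = 0" using \<open>\<And>k. k \<in> {1..n} \<Longrightarrow> (\<Sum>j\<le>N. g k j) = 0\<close> k by simp
    finally obtain i j where ij: "i \<in> S" "j \<in> S" "i < j" "\<phi> k i = \<phi> k j" "\<forall>l\<in>S. \<phi> k l \<le> \<phi> k j"
      using max_degree_attained_twice[OF S(1,2), of "g k"] g by auto
    have "int q dvd int (m k) * (int j - int i)"
    proof
      have "i \<le> N" "j \<le> N" using ij S by auto
      then have "int q * int (degree (c i)) + int q * (int N - int i) + int i * int (m k) =
          int q * int (degree (c j)) + int q * (int N - int j) + int j * int (m k)"
        using arg_cong[OF ij(4), of int] by (simp add: \<phi>_def of_nat_diff)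
      then show "int (m k) * (int j - int i) = int q * (int (degree (c i)) - int (degree (c j)) + int j - int i)"
        by (simp add: algebra_simps)
    qed
    moreover have "coprime q (m k)"
    proof -
      have "coprime q (k * q + 1)"
        by (metis coprime_add_one_right coprime_mult_left_iff mult.commute)
      then show ?thesis using assms(6) unfolding m_def coprime_mult_right_iff by (simp only: coprime_commute)
    qed
    ultimately have "int q dvd int j - int i"
      by (simp add: coprime_dvd_mult_right_iff)
    then have "int q \<le> int j - int i" using ij(3) by (intro zdvd_imp_le) auto
    then have "i + q \<le> j" by simp
    then show "\<exists>i\<in>S. \<exists>j\<in>S. i + q \<le> j \<and> \<phi> k i = \<phi> k j \<and> (\<forall>l\<in>S. \<phi> k l \<le> \<phi> k j)"
      using ij by blast
  qed (rule S(2))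
  then show ?thesis using S(3) by fastforce
qed

section \<open>Upper bounds\<close>

lemma simple_of_order_leI:
  assumes "\<exists>N\<le>n. satisfies_simple_ode K D N f"
  shows "simple_of_order_le K D n f"
proof -
  obtain N where N: "N \<le> n" "satisfies_simple_ode K D N f" using assms by blast
  then have "simple_order K D f \<le> N" by (auto simp: simple_order_def intro: Least_le)
  then show ?thesis using N by (auto simp: simple_of_order_le_def simple_def)
qed

lemma simple_of_order_imp_ode:
  assumes "simple_of_order K D n f"
  shows "satisfies_simple_ode K D n f"
  using assms unfolding simple_of_order_def simple_def simple_order_def by (metis LeastI)

lemma simple_of_orderI:
  assumes "simple_of_order_le K D n f" "\<And>N. satisfies_simple_ode K D N f \<Longrightarrow> n \<le> N"
  shows "simple_of_order K D n f"
proof -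
  have "satisfies_simple_ode K D (simple_order K D f) f"
    using assms(1) unfolding simple_of_order_le_def simple_def simple_order_def by (metis LeastI)
  then show ?thesis
    using assms by (auto simp: simple_of_order_def simple_of_order_le_def intro: le_antisym)
qed

lemma finite_rational_fibre:
  fixes P Q :: "'a::field poly"
  assumes "\<And>c. P \<noteq> smult c Q" "\<And>x. x \<in> E \<Longrightarrow> poly Q x \<noteq> 0"
  shows "finite {x\<in>E. poly P x / poly Q x = c}"
proof -
  have "P - smult c Q \<noteq> 0" using assms(1) by simp
  then have "finite {x. poly (P - smult c Q) x = 0}" by (rule poly_roots_finite)
  then show ?thesis by (rule rev_finite_subset) (use assms(2) in \<open>auto simp: field_simps\<close>)
qed

lemma finite_power_branch_fibre:
  fixes s :: "'a::real_normed_field \<Rightarrow> 'a"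
  assumes "power_branch p q E s" "p \<noteq> 0"
  shows "finite {x\<in>E. s x = c}"
proof (cases "p > 0")
  case True
  define n where "n = nat p"
  have n: "p = int n" "n > 0" using True by (auto simp: n_def)
  have "coeff (monom 1 n - [:c ^ q:]) n = 1" using n(2) by (simp add: coeff_pCons split: nat.splits)
  then have "monom 1 n - [:c ^ q:] \<noteq> 0" by (metis coeff_0 zero_neq_one)
  then have "finite {x. poly (monom 1 n - [:c ^ q:]) x = 0}" by (rule poly_roots_finite)
  then show ?thesis
    by (rule rev_finite_subset) (use assms(1) n in \<open>auto simp: power_branch_def poly_monom\<close>)
next
  case False
  define n where "n = nat (- p)"
  have n: "p = - int n" "n > 0" using False assms(2) by (auto simp: n_def)
  have "coeff (monom (c ^ q) n - 1) 0 = - 1" using n(2) by simp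
  then have "monom (c ^ q) n - 1 \<noteq> 0" by (metis coeff_0 neg_equal_0_iff_equal zero_neq_one)
  then have "finite {x. poly (monom (c ^ q) n - 1) x = 0}" by (rule poly_roots_finite)
  moreover have "{x\<in>E. s x = c} \<subseteq> {x. poly (monom (c ^ q) n - 1) x = 0}"
  proof clarify
    fix x assume x: "x \<in> E" "c = s x"
    then have "x \<noteq> 0" "s x ^ q = x powi p" using assms(1) n by (auto simp: power_branch_def)
    then show "poly (monom (s x ^ q) n - 1) x = 0"
      by (simp add: poly_monom n(1) power_int_minus)
  qed
  ultimately show ?thesis by (rule rev_finite_subset)
qed

context coefficient_ring
begin

lemma rat_span_derivs:
  assumes "open D" "satisfies_simple_ode K D n f" "k < n"
  shows "rat_span D (\<lambda>k. (deriv ^^ k) f) {..<n} (deriv ((deriv ^^ k) f))"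
  using ode_rat_span_higher_derivs[OF assms(1,2), of "Suc k"] by simp

text \<open>
  Adding \<open>F\<close> itself as one more generator to the derivatives of \<open>f\<close> keeps the span closed.
\<close>

lemma antiderivative_order_le:
  assumes "open D" "satisfies_simple_ode K D n f" "antiderivative_on D f F"
  shows "\<exists>N\<le>n + 1. satisfies_simple_ode K D N F"
proof -
  have sf: "smooth_on D f" using assms(2) by (simp add: satisfies_simple_ode_def)
  have F: "(F has_field_derivative f x) (at x)" if "x \<in> D" for x
    using assms(3) that by (simp add: antiderivative_on_def)
  have sF: "smooth_on D F"
    using assms(1)
  proof (rule smooth_onI[where g = "\<lambda>k. case k of 0 \<Rightarrow> F | Suc j \<Rightarrow> (deriv ^^ j) f"])
    show "((case k of 0 \<Rightarrow> F | Suc j \<Rightarrow> (deriv ^^ j) f) has_field_derivative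
        (case Suc k of 0 \<Rightarrow> F | Suc j \<Rightarrow> (deriv ^^ j) f) x) (at x)" if "x \<in> D" for k x
      using F[OF that] smooth_on_has_field_derivative[OF sf that] by (cases k) auto
  qed simp
  define g where "g k = (if k < n then (deriv ^^ k) f else F)" for k
  have base: "rat_span D g {..n} ((deriv ^^ k) f)" if "k < n" for k
  proof -
    have "g k = (deriv ^^ k) f" using that by (simp add: g_def)
    then show ?thesis using rat_span_base[of "{..n}" k D g] that by simp
  qed
  have lift: "rat_span D g {..n} ((deriv ^^ j) f)" for j
    by (rule rat_span_trans[OF ode_rat_span_higher_derivs[OF assms(1,2)]]) (use base in auto)
  have dF: "rat_span D g {..n} (deriv F)"
    by (rule rat_span_cong[OF lift[of 0] eventually_off_finiteI]) (use F DERIV_imp_deriv in auto)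
  have "\<exists>N\<le>card {..n}. satisfies_simple_ode K D N F"
  proof (rule ode_of_rat_span[OF assms(1) sF])
    show "smooth_on D (g k)" for k using sf sF by (simp add: g_def smooth_on_higher_deriv)
    show "rat_span D g {..n} (deriv (g k))" for k
      using lift[of "Suc k"] dF by (simp add: g_def)
    show "rat_span D g {..n} F"
      using rat_span_base[of "{..n}" n D g] by (simp add: g_def)
  qed simp
  then show ?thesis by simp
qed

lemma deriv_order_le:
  assumes "open D" "satisfies_simple_ode K D n f"
  shows "\<exists>N\<le>n. satisfies_simple_ode K D N (deriv f)"
proof -
  have sf: "smooth_on D f" using assms(2) by (simp add: satisfies_simple_ode_def)
  have "\<exists>N\<le>card {..<n}. satisfies_simple_ode K D N (deriv f)"
    by (rule ode_of_rat_span[OF assms(1) smooth_on_deriv[OF sf], where g = "\<lambda>k. (deriv ^^ k) f"])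
      (use sf rat_span_derivs[OF assms] ode_rat_span_higher_derivs[OF assms, of 1]
        in \<open>auto intro: smooth_on_higher_deriv\<close>)
  then show ?thesis by simp
qed

lemma add_order_le:
  assumes "open D" "satisfies_simple_ode K D n f" "satisfies_simple_ode K D m h"
  shows "\<exists>N\<le>n + m. satisfies_simple_ode K D N (\<lambda>x. f x + h x)"
proof -
  have sm: "smooth_on D f" "smooth_on D h" using assms(2,3) by (simp_all add: satisfies_simple_ode_def)
  define I where "I = {..<n} <+> {..<m}"
  define g where "g = case_sum (\<lambda>k. (deriv ^^ k) f) (\<lambda>k. (deriv ^^ k) h)"
  have I: "finite I" "card I = n + m" by (simp_all add: I_def card_Plus)
  have f: "rat_span D g I ((deriv ^^ j) f)" for j
  proof (rule rat_span_trans[OF ode_rat_span_higher_derivs[OF assms(1,2)]])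
    show "rat_span D g I ((deriv ^^ k) f)" if "k \<in> {..<n}" for k
      using rat_span_base[OF I(1), of "Inl k" D g] that by (auto simp: I_def g_def)
  qed
  have h: "rat_span D g I ((deriv ^^ j) h)" for j
  proof (rule rat_span_trans[OF ode_rat_span_higher_derivs[OF assms(1,3)]])
    show "rat_span D g I ((deriv ^^ k) h)" if "k \<in> {..<m}" for k
      using rat_span_base[OF I(1), of "Inr k" D g] that by (auto simp: I_def g_def)
  qed
  have "\<exists>N\<le>card I. satisfies_simple_ode K D N (\<lambda>x. f x + h x)"
  proof (rule ode_of_rat_span[OF assms(1) smooth_on_add[OF assms(1) sm] I(1)])
    show "smooth_on D (g i)" for i using sm by (cases i) (auto simp: g_def smooth_on_higher_deriv)
    show "rat_span D g I (deriv (g i))" for i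
      using f[of "Suc k" for k] h[of "Suc k" for k] by (cases i) (auto simp: g_def)
    show "rat_span D g I (\<lambda>x. f x + h x)" using rat_span_add[OF f[of 0] h[of 0]] by simp
  qed
  then show ?thesis by (simp add: I(2))
qed

lemma mult_order_le:
  assumes "open D" "satisfies_simple_ode K D n f" "satisfies_simple_ode K D m h"
  shows "\<exists>N\<le>n * m. satisfies_simple_ode K D N (\<lambda>x. f x * h x)"
proof -
  have sm: "smooth_on D f" "smooth_on D h" using assms(2,3) by (simp_all add: satisfies_simple_ode_def)
  define I where "I = {..<n} \<times> {..<m}"
  define g where "g = (\<lambda>(i, j) x. (deriv ^^ i) f x * (deriv ^^ j) h x)"
  have I: "finite I" "card I = n * m" by (simp_all add: I_def card_cartesian_product)
  have prod: "rat_span D g I (\<lambda>x. (deriv ^^ i) f x * (deriv ^^ j) h x)" for i j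
    unfolding g_def I_def
    by (rule rat_span_mult[OF ode_rat_span_higher_derivs[OF assms(1,2)] ode_rat_span_higher_derivs[OF assms(1,3)]]) auto
  have "\<exists>N\<le>card I. satisfies_simple_ode K D N (\<lambda>x. f x * h x)"
  proof (rule ode_of_rat_span[OF assms(1) smooth_on_mult[OF assms(1) sm] I(1)])
    fix ij assume "ij \<in> I"
    obtain i j where ij: "ij = (i, j)" by fastforce
    show "smooth_on D (g ij)" using sm assms(1) by (auto simp: g_def ij intro: smooth_on_mult smooth_on_higher_deriv)
    have d: "deriv (g ij) x = (deriv ^^ Suc i) f x * (deriv ^^ j) h x + (deriv ^^ i) f x * (deriv ^^ Suc j) h x" if "x \<in> D" for x
      unfolding g_def ij
      using DERIV_imp_deriv[OF DERIV_mult[OF smooth_on_has_field_derivative[OF sm(1) that, of i]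
        smooth_on_has_field_derivative[OF sm(2) that, of j]]] by (simp add: mult.commute)
    show "rat_span D g I (deriv (g ij))"
      by (rule rat_span_cong[OF rat_span_add[OF prod[of "Suc i" j] prod[of i "Suc j"]] eventually_off_finiteI]) (rule d)
  qed (use prod[of 0 0] in simp)
  then show ?thesis by (simp add: I(2))
qed

lemma locally_constant_order_le:
  assumes "open E" "smooth_on E y" "\<And>x. x \<in> E \<Longrightarrow> deriv y x = 0"
  shows "satisfies_simple_ode K E 1 y"
  unfolding satisfies_simple_ode_def
  using assms(2,3) by (intro conjI exI[of _ "\<lambda>k. if k = 1 then 1 else 0"]) (auto simp: poly_over_intros)

lemma ode_order_0:
  assumes "open D" "satisfies_simple_ode K D 0 f" "x \<in> D"
  shows "f x = 0"
proof -
  obtain p where p: "p \<noteq> 0" "\<And>x. x \<in> D \<Longrightarrow> poly p x * f x = 0" and "smooth_on D f"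
    using assms(2) by (auto simp: satisfies_simple_ode_def)
  have "eventually (\<lambda>x. f x = 0) (off_finite D)"
    using eventually_poly_nonzero[OF p(1)] eventually_off_finite_mem by eventually_elim (use p(2) in auto)
  then show ?thesis
    using zero_off_finite_imp_zero assms smooth_on_continuous_on \<open>smooth_on D f\<close> by blast
qed

text \<open>
  Constant substitutions are treated separately: the leading coefficient may vanish identically after the
  substitution, but then the composite has derivative \<open>0\<close>. As \<open>E\<close> may be disconnected, \<open>s\<close> need not be constant on all of \<open>E\<close>.
\<close>

lemma compose_locally_constant_order_le:
  assumes "open D" "satisfies_simple_ode K D n f" "open E" "smooth_on E s" "s ` E \<subseteq> D"
    and "\<And>x. x \<in> E \<Longrightarrow> deriv s x = 0"
  shows "\<exists>N\<le>n. satisfies_simple_ode K E N (\<lambda>x. f (s x))"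
proof -
  have sf: "smooth_on D f" using assms(2) by (simp add: satisfies_simple_ode_def)
  have sm: "smooth_on E (\<lambda>x. f (s x))" by (rule smooth_on_compose[OF assms(3,4) sf assms(5)])
  show ?thesis
  proof (cases "n = 0")
    case True
    then have "f (s x) = 0" if "x \<in> E" for x using ode_order_0 assms(1,2,5) that by blast
    then have "satisfies_simple_ode K E 0 (\<lambda>x. f (s x))"
      unfolding satisfies_simple_ode_def using sm
      by (intro conjI exI[of _ "\<lambda>_. 1"]) (auto simp: poly_over_intros)
    then show ?thesis by blast
  next
    case False
    have "deriv (\<lambda>x. f (s x)) x = 0" if x: "x \<in> E" for x
    proof -
      have "s x \<in> D" using assms(5) x by blast
      then show ?thesis
        using DERIV_imp_deriv[OF DERIV_chain2[OF smooth_on_DERIV[OF sf] smooth_on_DERIV[OF assms(4) x]]] assms(6)[OF x]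
        by simp
    qed
    from locally_constant_order_le[OF assms(3) sm this] show ?thesis using False by (intro exI[of _ 1]) simp
  qed
qed

lemma compose_rational_order_le:
  assumes "open D" "satisfies_simple_ode K D n f" "open E"
    and PQ: "poly_over K P" "poly_over K Q" "\<And>x. x \<in> E \<Longrightarrow> poly Q x \<noteq> 0" "\<And>x. x \<in> E \<Longrightarrow> poly P x / poly Q x \<in> D"
    and "Q \<noteq> 0"
  shows "\<exists>N\<le>n. satisfies_simple_ode K E N (\<lambda>x. f (poly P x / poly Q x))"
proof -
  define s where "s x = poly P x / poly Q x" for x
  have ss: "smooth_on E s" unfolding s_def by (rule smooth_on_poly_divide[OF assms(3) PQ(3)])
  have sD: "s ` E \<subseteq> D" using PQ(4) by (auto simp: s_def)
  have ds: "deriv s x = (poly (pderiv P) x * poly Q x - poly P x * poly (pderiv Q) x) / (poly Q x * poly Q x)"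
    if "x \<in> E" for x
    unfolding s_def by (rule DERIV_imp_deriv[OF DERIV_divide[OF poly_DERIV poly_DERIV PQ(3)[OF that]]])
  show ?thesis
  proof (cases "\<exists>c. P = smult c Q")
    case True
    then obtain c where "P = smult c Q" by blast
    then have "deriv s x = 0" if "x \<in> E" for x using ds[OF that] by (simp add: pderiv_smult)
    from compose_locally_constant_order_le[OF assms(1-3) ss sD this] show ?thesis by (simp add: s_def)
  next
    case False
    let ?V = "rat_span E (\<lambda>(_::unit) _. 1) UNIV"
    have rat: "?V y" if "poly_over K d" "d \<noteq> 0" "poly_over K a" "\<And>x. x \<in> E \<Longrightarrow> poly d x * y x = poly a x" for d a y
      by (rule rat_spanI[of d _ "\<lambda>_. a"]) (use that in \<open>auto intro: eventually_off_finiteI\<close>)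
    have "\<exists>N\<le>n * card (UNIV :: unit set). satisfies_simple_ode K E N (\<lambda>x. f (s x))"
    proof (rule order_compose_le[OF assms(1-3) ss sD])
      have "smooth_on E (poly 1 :: 'a \<Rightarrow> 'a)" by (rule smooth_on_poly[OF assms(3)])
      moreover have "poly 1 = (\<lambda>x::'a. 1)" by auto
      ultimately show "smooth_on E (\<lambda>x. 1)" by simp
      show "?V (deriv (\<lambda>_. 1))" by (rule rat[of 1 0]) (auto intro: poly_over_intros)
      show "?V (\<lambda>x. 1 * 1)" "?V (\<lambda>x. 1)" by (rule rat[of 1 1]; auto intro: poly_over_intros)+
      show "?V s" by (rule rat[of Q P]) (use PQ assms(8) in \<open>auto simp: s_def\<close>)
      show "?V (deriv s)"
        by (rule rat[of "Q * Q" "pderiv P * Q - P * pderiv Q"])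
          (use PQ assms(8) ds in \<open>auto intro: poly_over_intros\<close>)
      show "finite {x \<in> E. s x = c}" for c
        unfolding s_def by (rule finite_rational_fibre) (use False PQ(3) in auto)
    qed simp
    then show ?thesis by (simp add: s_def)
  qed
qed

text \<open>
  The algebra \<open>K(x)[s]\<close> is spanned by \<open>1, s, \<dots>, s ^ (q - 1)\<close>, because \<open>s ^ q = x powi p\<close>, and it is closed under
  differentiation, because \<open>q x s' = p s\<close>.
\<close>

lemma compose_power_branch_order_le:
  assumes "open D" "satisfies_simple_ode K D n f" "open E"
    and "power_branch p q E s" "q \<ge> 1" "s ` E \<subseteq> D"
  shows "\<exists>N\<le>n * q. satisfies_simple_ode K E N (\<lambda>x. f (s x))"
proof -
  have ss: "smooth_on E s" and sq: "\<And>x. x \<in> E \<Longrightarrow> s x ^ q = x powi p" and "p < 0 \<Longrightarrow> 0 \<notin> E"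
    using assms(4) by (auto simp: power_branch_def)
  have q0: "q > 0" using assms(5) by simp
  have nz: "eventually (\<lambda>x. x \<in> E \<and> x \<noteq> 0) (off_finite E)"
  proof -
    have "[:0, 1:] \<noteq> (0 :: 'a poly)" by simp
    from eventually_off_finite_mem[of E] eventually_poly_nonzero[OF this, of E]
    show ?thesis by eventually_elim simp
  qed
  show ?thesis
  proof (cases "p = 0")
    case True
    have "deriv s x = 0" if x: "x \<in> E" for x
    proof -
      have "((\<lambda>x. s x ^ q) has_field_derivative of_nat q * (deriv s x * s x ^ (q - 1))) (at x)"
        using DERIV_power[OF smooth_on_DERIV[OF ss x], of q] by simp
      moreover have "((\<lambda>x. s x ^ q) has_field_derivative 0) (at x)"
        by (rule has_field_derivative_transform_within_open[OF DERIV_const[of 1] assms(3) x]) (simp add: sq True)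
      ultimately have "of_nat q * (deriv s x * s x ^ (q - 1)) = 0" by (rule DERIV_unique)
      moreover have "s x \<noteq> 0" using sq[OF x] q0 by (auto simp: True power_0_left)
      ultimately show ?thesis using q0 by simp
    qed
    from compose_locally_constant_order_le[OF assms(1-3) ss assms(6) this]
    obtain N where "N \<le> n" "satisfies_simple_ode K E N (\<lambda>x. f (s x))" by blast
    moreover have "n \<le> n * q" using q0 by simp
    ultimately show ?thesis using le_trans by blast
  next
    case False
    define g where "g i x = s x ^ i" for i x
    let ?V = "rat_span E g {..<q}"
    have sg: "smooth_on E (g i)" for i
    proof -
      have "smooth_on E (\<lambda>x. poly (monom 1 i) (s x))"
        by (rule smooth_on_compose[OF assms(3) ss smooth_on_poly[OF open_UNIV]]) simp
      then show ?thesis by (simp add: g_def [abs_def] poly_monom)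
    qed
    have low: "?V (g i)" if "i < q" for i using that by (intro rat_span_base) auto
    have pw: "?V (g i)" for i
    proof (induction i rule: less_induct)
      case (less i)
      show ?case
      proof (cases "i < q")
        case False
        then have i: "?V (g (i - q))" using less q0 by simp
        have gi: "g i x = x powi p * g (i - q) x" if "x \<in> E" for x
          using False by (simp add: g_def sq[OF that, symmetric] flip: power_add)
        show ?thesis
        proof (cases "p \<ge> 0")
          case True
          have "?V (\<lambda>x. poly (monom 1 (nat p)) x * g (i - q) x)"
            by (intro rat_span_poly_mult i poly_over_monom one_mem)
          then show ?thesis
            by (rule rat_span_cong[OF _ eventually_off_finiteI]) (simp add: gi poly_monom power_int_def True)
        next
          case False
          show ?thesis
          proof (rule rat_span_divide[OF i poly_over_monom[OF one_mem]])
            show "eventually (\<lambda>x. poly (monom 1 (nat (- p))) x * g i x = g (i - q) x) (off_finite E)"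
              using nz by eventually_elim (use False in \<open>simp add: gi poly_monom power_int_def field_simps\<close>)
          qed simp
        qed
      qed (rule low)
    qed
    have ds: "deriv s x = of_int p / of_nat q * s x / x" if "x \<in> E" "x \<noteq> 0" for x
      by (rule power_branch_deriv[OF assms(4,5,3) that])
    have pK: "of_int p \<in> K"
      using of_nat_mem[of "nat p"] uminus_mem[OF of_nat_mem[of "nat (- p)"]] by (cases "p \<ge> 0") simp_all
    have dg: "?V (deriv (g i))" for i
    proof (rule rat_span_divide[OF rat_span_poly_mult[OF pw[of i] poly_over_const]])
      show "of_nat i * of_int p \<in> K" by (intro mult_mem of_nat_mem pK)
      show "poly_over K (monom (of_nat q) 1)" by (intro poly_over_monom of_nat_mem)
      show "monom (of_nat q) 1 \<noteq> (0 :: 'a poly)" using q0 by simp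
      show "eventually (\<lambda>x. poly (monom (of_nat q) 1) x * deriv (g i) x = poly [:of_nat i * of_int p:] x * g i x) (off_finite E)"
        using nz
      proof eventually_elim
        case (elim x)
        then have "deriv (g i) x = of_nat i * (deriv s x * s x ^ (i - 1))"
          unfolding g_def [abs_def] using DERIV_imp_deriv[OF DERIV_power[OF smooth_on_DERIV[OF ss], of x i]] by simp
        also have "\<dots> = of_nat i * of_int p / (of_nat q * x) * g i x"
          using elim by (cases i) (simp_all add: ds g_def field_simps)
        finally show ?case using elim q0 by (simp add: poly_monom)
      qed
    qed
    have "g 1 = s" by (simp add: g_def [abs_def])
    have "\<exists>N\<le>n * card {..<q}. satisfies_simple_ode K E N (\<lambda>x. f (s x))"
    proof (rule order_compose_le[OF assms(1-3) ss assms(6) finite_lessThan sg dg])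
      show "?V (\<lambda>x. g i x * g j x)" for i j
        using pw[of "i + j"] by (simp add: g_def [abs_def] power_add)
      show "?V (\<lambda>_. 1)" using pw[of 0] by (simp add: g_def [abs_def])
      show "?V s" "?V (deriv s)" using pw[of 1] dg[of 1] \<open>g 1 = s\<close> by simp_all
      show "finite {x\<in>E. s x = c}" for c
        by (rule finite_power_branch_fibre[OF assms(4) False])
    qed
    then show ?thesis by simp
  qed
qed

end

section \<open>Orders of the examples\<close>

lemma monom_diff_ne_const:
  assumes "a \<noteq> b" "a > 0"
  shows "monom 1 a - monom 1 b \<noteq> smult c (1 :: 'a::comm_ring_1 poly)"
proof
  assume "monom 1 a - monom 1 b = smult c (1 :: 'a poly)"
  then have "coeff (monom 1 a - monom 1 b) a = coeff (smult c (1 :: 'a poly)) a" by simp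
  then show False using assms by (simp add: coeff_pCons split: nat.splits)
qed

lemma monom_pair_diff_ne_const:
  assumes "k \<le> n" "n < l" "k' \<le> n" "n < l'" "1 \<le> k" "1 \<le> k'" "(k, l) \<noteq> (k', l')"
  shows "(monom 1 k + monom 1 l) - (monom 1 k' + monom 1 l') \<noteq> smult c (1 :: 'a::comm_ring_1 poly)"
proof
  assume eq: "(monom 1 k + monom 1 l) - (monom 1 k' + monom 1 l') = smult c (1 :: 'a poly)"
  have "coeff ((monom 1 k + monom 1 l) - (monom 1 k' + monom 1 l')) i = coeff (smult c (1 :: 'a poly)) i" for i
    by (simp add: eq)
  from this[of k] this[of l] assms show False
    by (auto simp: coeff_pCons split: nat.splits if_splits)
qed

text \<open>
  Otherwise the rational function \<open>P / Q\<close> would take only values that are roots of \<open>X ^ i - X ^ j - c\<close>. These are finitely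
  many, and a nonconstant rational function takes each of them only finitely often.
\<close>

lemma rational_powers_diff_ne_const:
  fixes P Q :: "'a::real_normed_field poly"
  assumes "open E" "E \<noteq> {}" "\<And>x. x \<in> E \<Longrightarrow> poly Q x \<noteq> 0" "\<And>c. P \<noteq> smult c Q"
    and "i \<noteq> j" "i \<le> n" "j \<le> n" "i > 0"
  shows "P ^ i * Q ^ (n - i) - P ^ j * Q ^ (n - j) \<noteq> smult c (Q ^ n)"
proof
  assume eq: "P ^ i * Q ^ (n - i) - P ^ j * Q ^ (n - j) = smult c (Q ^ n)"
  define f where "f = monom 1 i - monom 1 j - [:c:]"
  have "coeff f i = 1" using assms(5,8) by (simp add: f_def coeff_pCons split: nat.splits)
  then have "f \<noteq> 0" by auto
  have "poly f (poly P x / poly Q x) = 0" if "x \<in> E" for x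
  proof -
    have Q: "poly Q x \<noteq> 0" using assms(3) that .
    have pw: "poly Q x ^ n = poly Q x ^ l * poly Q x ^ (n - l)" if "l \<le> n" for l
      using that by (simp flip: power_add)
    have "poly P x ^ l * poly Q x ^ (n - l) = (poly P x / poly Q x) ^ l * poly Q x ^ n" if "l \<le> n" for l
      using Q by (simp add: pw[OF that] power_divide)
    then have "(poly P x / poly Q x) ^ i * poly Q x ^ n - (poly P x / poly Q x) ^ j * poly Q x ^ n = c * poly Q x ^ n"
      using arg_cong[OF eq, of "\<lambda>p. poly p x"] assms(6,7) by simp
    then have "((poly P x / poly Q x) ^ i - (poly P x / poly Q x) ^ j - c) * poly Q x ^ n = 0"
      by (simp only: left_diff_distrib) simp
    then show ?thesis using Q by (simp add: f_def poly_monom)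
  qed
  then have "E \<subseteq> (\<Union>v\<in>{v. poly f v = 0}. {x\<in>E. poly P x / poly Q x = v})" by auto
  moreover have "finite (\<Union>v\<in>{v. poly f v = 0}. {x\<in>E. poly P x / poly Q x = v})"
    using poly_roots_finite[OF \<open>f \<noteq> 0\<close>] finite_rational_fibre[OF assms(4,3)] by blast
  ultimately show False using infinite_if_open_nonempty[OF assms(1,2)] finite_subset by blast
qed

lemma exp_sum_eq_exponential_sum:
  "exp_sum n x = (\<Sum>k=1..n. poly 1 x * exp (poly (monom 1 k) x / poly 1 x))"
  by (simp add: exp_sum_def poly_monom)

context coefficient_ring
begin

theorem simple_of_order_exponential_sum:
  assumes "open E" "E \<noteq> {}" "\<And>x. x \<in> E \<Longrightarrow> poly B x \<noteq> 0" "finite I"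
    and A: "\<And>i j c. i \<in> I \<Longrightarrow> j \<in> I \<Longrightarrow> i \<noteq> j \<Longrightarrow> A i - A j \<noteq> smult c B"
    and R: "\<And>i. i \<in> I \<Longrightarrow> R i \<noteq> 0"
    and K: "poly_over K B" "\<And>i. i \<in> I \<Longrightarrow> poly_over K (A i)" "\<And>i. i \<in> I \<Longrightarrow> poly_over K (R i)"
    and f: "\<And>x. x \<in> E \<Longrightarrow> f x = (\<Sum>i\<in>I. poly (R i) x * exp (poly (A i) x / poly B x))"
  shows "simple_of_order K E (card I) f"
proof (rule simple_of_orderI[OF simple_of_order_leI])
  show "card I \<le> N" if "satisfies_simple_ode K E N f" for N
    by (rule order_exponential_sum_ge[OF assms(1-6) f that])
  define g where "g i x = exp (poly (A i) x / poly B x)" for i x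
  have sRg: "smooth_on E (\<lambda>x. poly p x * g i x)" for p i
    unfolding g_def by (rule smooth_on_exp_quotient[OF assms(1,3)])
  have sg: "smooth_on E (g i)" for i using sRg[of 1 i] by simp
  have "B \<noteq> 0" using assms(2,3) by auto
  show "\<exists>N\<le>card I. satisfies_simple_ode K E N f"
  proof (rule ode_of_rat_span[OF assms(1) _ assms(4) sg])
    show "smooth_on E f"
      by (rule smooth_on_cong[OF smooth_on_sum[OF assms(1,4) sRg] assms(1)]) (simp add: f g_def)
    have "rat_span E g I (\<lambda>x. \<Sum>i\<in>I. poly (R i) x * g i x)"
      by (intro rat_span_sum rat_span_poly_mult rat_span_base assms(4) K(3))
    then show "rat_span E g I f"
      by (rule rat_span_cong[OF _ eventually_off_finiteI]) (simp add: f g_def)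
    show "rat_span E g I (deriv (g i))" if i: "i \<in> I" for i
    proof (rule rat_span_divide[OF rat_span_poly_mult[OF rat_span_base[OF assms(4) i]]])
      show "poly_over K (pderiv (A i) * B - A i * pderiv B)" "poly_over K (B * B)"
        using K i by (auto intro: poly_over_intros)
      show "B * B \<noteq> 0" using \<open>B \<noteq> 0\<close> by simp
      show "eventually (\<lambda>x. poly (B * B) x * deriv (g i) x = poly (pderiv (A i) * B - A i * pderiv B) x * g i x) (off_finite E)"
      proof (rule eventually_off_finiteI)
        fix x assume x: "x \<in> E"
        have "(g i has_field_derivative g i x * ((poly (pderiv (A i)) x * poly B x - poly (A i) x * poly (pderiv B) x) / (poly B x * poly B x))) (at x)"
          unfolding g_def [abs_def]
          by (rule DERIV_chain2[OF DERIV_exp DERIV_divide[OF poly_DERIV poly_DERIV assms(3)[OF x]]])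
        then have "deriv (g i) x = g i x * ((poly (pderiv (A i)) x * poly B x - poly (A i) x * poly (pderiv B) x) / (poly B x * poly B x))"
          by (rule DERIV_imp_deriv)
        then show "poly (B * B) x * deriv (g i) x = poly (pderiv (A i) * B - A i * pderiv B) x * g i x"
          using assms(3)[OF x] by (simp add: field_simps)
      qed
    qed
  qed
qed

lemma simple_of_order_power_exponentials:
  assumes "open E" "E \<noteq> {}" "finite I" "inj_on e I" "\<And>i. i \<in> I \<Longrightarrow> e i > 0"
    and "\<And>i. i \<in> I \<Longrightarrow> poly_over K (R i)" "\<And>i. i \<in> I \<Longrightarrow> R i \<noteq> 0"
    and "\<And>x. x \<in> E \<Longrightarrow> f x = (\<Sum>i\<in>I. poly (R i) x * exp (x ^ e i))"
  shows "simple_of_order K E (card I) f"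
proof (rule simple_of_order_exponential_sum[OF assms(1,2), where B = 1 and A = "\<lambda>i. monom 1 (e i)" and R = R])
  show "monom 1 (e i) - monom 1 (e j) \<noteq> smult c (1 :: 'a poly)" if "i \<in> I" "j \<in> I" "i \<noteq> j" for i j c
  proof (rule monom_diff_ne_const)
    show "e i \<noteq> e j" using that assms(4) by (auto dest: inj_onD)
  qed (use that assms(5) in blast)
qed (use assms in \<open>auto simp: poly_monom intro: poly_over_intros one_mem\<close>)

lemma simple_of_order_exp_sum:
  assumes "open D" "D \<noteq> {}"
  shows "simple_of_order K D n (exp_sum n)"
  using simple_of_order_power_exponentials[OF assms, of "{1..n}" "\<lambda>k. k" "\<lambda>_. 1" "exp_sum n"]
  by (simp add: exp_sum_def poly_over_1)

lemma simple_of_order_exp_sum_tail: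
  assumes "open D" "D \<noteq> {}"
  shows "simple_of_order K D m (\<lambda>x. \<Sum>k=n+1..n+m. exp (x ^ k))"
  using simple_of_order_power_exponentials[OF assms, of "{n+1..n+m}" "\<lambda>k. k" "\<lambda>_. 1"]
  by (simp add: poly_over_1)

lemma simple_of_order_exp_sum_add_tail:
  assumes "open D" "D \<noteq> {}"
  shows "simple_of_order K D (n + m) (\<lambda>x. exp_sum n x + (\<Sum>k=n+1..n+m. exp (x ^ k)))"
proof -
  have "{1..n+m} = {1..n} \<union> {n+1..n+m}" by auto
  then have "(\<Sum>k=1..n+m. exp (x ^ k)) = exp_sum n x + (\<Sum>k=n+1..n+m. exp (x ^ k))" for x :: 'a
    by (simp add: exp_sum_def sum.union_disjoint)
  then show ?thesis
    using simple_of_order_power_exponentials[OF assms, of "{1..n+m}" "\<lambda>k. k" "\<lambda>_. 1"]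
    by (simp add: poly_over_1)
qed

lemma simple_of_order_deriv_exp_sum:
  assumes "open D" "D \<noteq> {}"
  shows "simple_of_order K D n (deriv (exp_sum n))"
proof -
  have "(exp_sum n has_field_derivative (\<Sum>k=1..n. poly (monom (of_nat k) (k - 1)) x * exp (x ^ k))) (at x)" for x :: 'a
    unfolding exp_sum_def [abs_def]
  proof (rule DERIV_sum)
    fix k
    have "((\<lambda>x. exp (x ^ k)) has_field_derivative exp (x ^ k) * (of_nat k * x ^ (k - 1))) (at x)"
      by (rule DERIV_chain2[OF DERIV_exp]) (auto intro!: derivative_eq_intros)
    then show "((\<lambda>x. exp (x ^ k)) has_field_derivative poly (monom (of_nat k) (k - 1)) x * exp (x ^ k)) (at x)"
      by (simp add: poly_monom mult_ac)
  qed
  then have d: "deriv (exp_sum n) x = (\<Sum>k=1..n. poly (monom (of_nat k) (k - 1)) x * exp (x ^ k))" for x :: 'a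
    by (rule DERIV_imp_deriv)
  have "simple_of_order K D (card {1..n}) (deriv (exp_sum n))"
    by (rule simple_of_order_power_exponentials[OF assms, where e = "\<lambda>k. k" and R = "\<lambda>k. monom (of_nat k) (k - 1)"])
      (auto simp: d intro: poly_over_monom of_nat_mem)
  then show ?thesis by simp
qed

lemma simple_of_order_exp_sum_mult_tail:
  assumes "open D" "D \<noteq> {}"
  shows "simple_of_order K D (n * m) (\<lambda>x. exp_sum n x * (\<Sum>k=n+1..n+m. exp (x ^ k)))"
proof -
  let ?I = "{1..n} \<times> {n+1..n+m}"
  have "simple_of_order K D (card ?I) (\<lambda>x. exp_sum n x * (\<Sum>k=n+1..n+m. exp (x ^ k)))"
  proof (rule simple_of_order_exponential_sum[OF assms, where B = 1 and A = "\<lambda>(k, l). monom 1 k + monom 1 l" and R = "\<lambda>_. 1"])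
    fix i j c assume "i \<in> ?I" "j \<in> ?I" "i \<noteq> j"
    then show "(case i of (k, l) \<Rightarrow> monom 1 k + monom 1 l) - (case j of (k, l) \<Rightarrow> monom 1 k + monom 1 l) \<noteq> smult c (1 :: 'a poly)"
      by (cases i; cases j; simp only: prod.case) (rule monom_pair_diff_ne_const, auto)
  next
    fix x :: 'a
    show "exp_sum n x * (\<Sum>k=n+1..n+m. exp (x ^ k)) =
      (\<Sum>i\<in>?I. poly 1 x * exp (poly (case i of (k, l) \<Rightarrow> monom 1 k + monom 1 l) x / poly 1 x))"
      by (simp add: exp_sum_def sum_product sum.cartesian_product exp_add poly_monom case_prod_unfold)
  qed (auto intro: poly_over_intros one_mem)
  then show ?thesis by (simp add: card_cartesian_product)
qed

lemma simple_of_order_exp_sum_rational: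
  assumes "open E" "E \<noteq> {}" "\<And>x. x \<in> E \<Longrightarrow> poly Q x \<noteq> 0" "poly_over K P" "poly_over K Q"
    and "n = 1 \<or> \<not> (\<exists>c. P = smult c Q)"
  shows "simple_of_order K E n (\<lambda>x. exp_sum n (poly P x / poly Q x))"
proof -
  have "simple_of_order K E (card {1..n}) (\<lambda>x. exp_sum n (poly P x / poly Q x))"
  proof (rule simple_of_order_exponential_sum[OF assms(1,2),
        where B = "Q ^ n" and A = "\<lambda>k. P ^ k * Q ^ (n - k)" and R = "\<lambda>_. 1"])
    show "poly (Q ^ n) x \<noteq> 0" if "x \<in> E" for x using assms(3)[OF that] by simp
    show "P ^ i * Q ^ (n - i) - P ^ j * Q ^ (n - j) \<noteq> smult c (Q ^ n)"
      if "i \<in> {1..n}" "j \<in> {1..n}" "i \<noteq> j" for i j c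
      using that assms(6) by (intro rational_powers_diff_ne_const[OF assms(1-3)]) auto
    fix x assume "x \<in> E"
    then have Q: "poly Q x \<noteq> 0" by (rule assms(3))
    have "(poly P x / poly Q x) ^ k = poly (P ^ k * Q ^ (n - k)) x / poly (Q ^ n) x" if "k \<in> {1..n}" for k
    proof -
      have "poly Q x ^ n = poly Q x ^ k * poly Q x ^ (n - k)" using that by (simp flip: power_add)
      then show ?thesis using Q by (simp add: power_divide)
    qed
    then show "exp_sum n (poly P x / poly Q x) =
        (\<Sum>k\<in>{1..n}. poly 1 x * exp (poly (P ^ k * Q ^ (n - k)) x / poly (Q ^ n) x))"
      by (simp add: exp_sum_def)
  qed (use assms in \<open>auto intro: poly_over_intros\<close>)
  then show ?thesis by simp
qed

lemma simple_of_order_exp_sum_mult: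
  assumes "open D" "D \<noteq> {}" "q \<ge> 1"
  shows "simple_of_order K D n (exp_sum_mult n q)"
  using simple_of_order_power_exponentials[OF assms(1,2), of "{1..n}" "\<lambda>k. k * q + 1" "\<lambda>_. 1" "exp_sum_mult n q"] assms(3)
  by (simp add: exp_sum_mult_def poly_over_1 inj_on_def)

lemma simple_of_order_exp_sum_mult_power_branch:
  assumes "open E" "E \<noteq> {}" "power_branch (int p) q E s" "p \<ge> 1" "q \<ge> 1" "coprime p q"
  shows "simple_of_order K E (n * q) (\<lambda>x. exp_sum_mult n q (s x))"
proof (rule simple_of_orderI[OF simple_of_order_leI])
  have "satisfies_simple_ode K UNIV n (exp_sum_mult n q)"
    by (intro simple_of_order_imp_ode simple_of_order_exp_sum_mult assms) auto
  then show "\<exists>N\<le>n * q. satisfies_simple_ode K E N (\<lambda>x. exp_sum_mult n q (s x))"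
    by (rule compose_power_branch_order_le[OF open_UNIV _ assms(1,3,5)]) simp
  show "n * q \<le> N" if "satisfies_simple_ode K E N (\<lambda>x. exp_sum_mult n q (s x))" for N
    using order_exp_sum_mult_power_branch_ge[OF assms that] .
qed

end

text \<open>
  If the coefficient \<open>c 0\<close> of \<open>F\<close> in an equation for \<open>F\<close> vanishes, the rest is an equation of order one less for \<open>exp_sum n\<close>.
  Otherwise \<open>F\<close> is a combination of the exponentials \<open>exp (x ^ k)\<close> with rational coefficients \<open>G k / c 0\<close>. Differentiation and
  independence give \<open>y' + k x ^ (k - 1) y = 1\<close> for \<open>y = G k / c 0\<close>. For \<open>k \<ge> 2\<close> this has no rational solution, and for
  \<open>n = 1\<close> it leaves \<open>F = exp\<close> as the single exception.
\<close>

lemma order_antiderivative_exp_sum_ge: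
  fixes F :: "'a::{real_normed_field,banach} \<Rightarrow> 'a"
  assumes "open D" "D \<noteq> {}" "n \<ge> 1" "antiderivative_on D (exp_sum n) F"
    and "\<not> (n = 1 \<and> (\<forall>x\<in>D. F x = exp x))" and ode: "satisfies_simple_ode K D N F"
  shows "n + 1 \<le> N"
proof -
  obtain c where c: "c N \<noteq> 0" "\<And>k. k \<le> N \<Longrightarrow> poly_over K (c k)"
    "\<And>x. x \<in> D \<Longrightarrow> (\<Sum>k\<le>N. poly (c k) x * (deriv ^^ k) F x) = 0" and sF: "smooth_on D F"
    using ode by (auto simp: satisfies_simple_ode_def)
  have DF: "(F has_field_derivative exp_sum n x) (at x)" if "x \<in> D" for x
    using assms(4) that by (simp add: antiderivative_on_def)
  define g where "g k x = poly 1 x * exp (poly (monom 1 k) x / poly 1 x :: 'a)" for k x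
  have gx: "g k x = exp (x ^ k)" for k x by (simp add: g_def poly_monom)
  have sg: "smooth_on D (g k)" for k
    unfolding g_def by (rule smooth_on_exp_quotient[OF assms(1)]) simp
  have fg: "exp_sum n x = (\<Sum>k\<in>{1..n}. g k x)" for x by (simp add: exp_sum_def gx)
  have sf: "smooth_on D (exp_sum n)"
    by (rule smooth_on_cong[OF smooth_on_sum[OF assms(1) _ sg] assms(1) fg]) simp
  have dF: "(deriv ^^ Suc j) F x = (deriv ^^ j) (exp_sum n) x" if "x \<in> D" for j x
    unfolding funpow_Suc_right o_apply
    by (rule higher_deriv_cong[OF sf assms(1) _ that]) (rule DERIV_imp_deriv[OF DF])
  have order_f: "n \<le> M" if "satisfies_simple_ode K D M (exp_sum n)" for M
  proof -
    have "card {1..n} \<le> M"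
    proof (rule order_exponential_sum_ge[OF assms(1,2) _ _ _ _ exp_sum_eq_exponential_sum that])
      show "monom 1 i - monom 1 j \<noteq> smult c (1 :: 'a poly)"
        if "i \<in> {1..n}" "i \<noteq> j" for i j :: nat and c
        using that by (intro monom_diff_ne_const) auto
    qed simp_all
    then show ?thesis by simp
  qed
  show ?thesis
  proof (cases "c 0 = 0")
    case True
    then obtain M where M: "N = Suc M" using c(1) by (cases N) auto
    have "(\<Sum>j\<le>M. poly (c (Suc j)) x * (deriv ^^ j) (exp_sum n) x) = 0" if "x \<in> D" for x
      using c(3)[OF that] unfolding M by (subst (asm) sum.atMost_Suc_shift) (simp add: True dF[OF that] del: funpow.simps)
    then have "satisfies_simple_ode K D M (exp_sum n)"
      using sf c(1,2) M by (auto simp: satisfies_simple_ode_def intro!: exI[of _ "\<lambda>j. c (Suc j)"])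
    then show ?thesis using order_f M by fastforce
  next
    case False
    define T :: "nat \<Rightarrow> nat \<Rightarrow> 'a poly" where "T k j = exp_quotient_numerator (monom 1 k) 1 1 j" for k j
    define G where "G k = - (\<Sum>j<N. c (Suc j) * T k j)" for k
    have dg: "(deriv ^^ j) (g k) x = poly (T k j) x * g k x" if "x \<in> D" for j k x
      using higher_deriv_exp_quotient[OF assms(1) _ that, where R = 1 and B = 1 and A = "monom 1 k" and j = j]
      by (simp add: g_def [abs_def] T_def)
    have cF: "poly (c 0) x * F x = (\<Sum>k=1..n. poly (G k) x * g k x)" if x: "x \<in> D" for x
    proof -
      have df: "(deriv ^^ j) (exp_sum n) x = (\<Sum>k=1..n. poly (T k j) x * g k x)" for j
      proof -
        have "(deriv ^^ j) (exp_sum n) x = (deriv ^^ j) (\<lambda>x. \<Sum>k=1..n. g k x) x"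
          by (rule higher_deriv_cong[OF smooth_on_sum[OF assms(1) _ sg] assms(1) fg x]) simp
        also have "\<dots> = (\<Sum>k=1..n. (deriv ^^ j) (g k) x)"
          by (rule higher_deriv_sum[OF assms(1) sg x])
        finally show ?thesis by (simp add: dg[OF x])
      qed
      have "0 = (\<Sum>k<Suc N. poly (c k) x * (deriv ^^ k) F x)" using c(3)[OF x] by (simp add: lessThan_Suc_atMost)
      also have "\<dots> = poly (c 0) x * F x + (\<Sum>j<N. poly (c (Suc j)) x * (deriv ^^ Suc j) F x)"
        by (subst sum.lessThan_Suc_shift) simp
      also have "(\<Sum>j<N. poly (c (Suc j)) x * (deriv ^^ Suc j) F x) =
          (\<Sum>j<N. \<Sum>k=1..n. poly (c (Suc j) * T k j) x * g k x)"
        by (simp only: dF[OF x] df) (simp add: sum_distrib_left mult.assoc)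
      also have "\<dots> = (\<Sum>k=1..n. \<Sum>j<N. poly (c (Suc j) * T k j) x * g k x)" by (rule sum.swap)
      also have "\<dots> = - (\<Sum>k=1..n. poly (G k) x * g k x)"
        by (simp add: G_def poly_sum sum_distrib_right sum_negf)
      finally have "poly (c 0) x * F x - (\<Sum>k=1..n. poly (G k) x * g k x) = 0"
        by (simp only: diff_conv_add_uminus)
      then show ?thesis by (simp only: right_minus_eq)
    qed
    have risch: "c 0 * pderiv (G k) - pderiv (c 0) * G k + monom (of_nat k) (k - 1) * c 0 * G k = (c 0)\<^sup>2"
      if "k \<in> {1..n}" for k
    proof -
      let ?b = "\<lambda>k. c 0 * pderiv (G k) - pderiv (c 0) * G k + monom (of_nat k) (k - 1) * c 0 * G k - (c 0)\<^sup>2"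
      have "?b k = 0"
      proof (rule exponentials_independent_over_polys[OF assms(1,2), where B = 1 and I = "{1..n}" and A = "monom 1" and b = ?b])
        fix x assume x: "x \<in> D"
        have "((\<lambda>x. \<Sum>k=1..n. poly (G k) x * g k x) has_field_derivative
            (\<Sum>k=1..n. poly (pderiv (G k)) x * g k x + (g k x * (of_nat k * x ^ (k - 1))) * poly (G k) x)) (at x)"
        proof (intro DERIV_sum DERIV_mult poly_DERIV)
          fix k
          show "(g k has_field_derivative g k x * (of_nat k * x ^ (k - 1))) (at x)"
            unfolding gx [abs_def] by (rule DERIV_chain2[OF DERIV_exp]) (auto intro!: derivative_eq_intros)
        qed
        moreover have "((\<lambda>x. \<Sum>k=1..n. poly (G k) x * g k x) has_field_derivative
            poly (pderiv (c 0)) x * F x + exp_sum n x * poly (c 0) x) (at x)"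
          by (rule has_field_derivative_transform_within_open[OF DERIV_mult[OF poly_DERIV DF[OF x]] assms(1) x cF])
        ultimately have "(\<Sum>k=1..n. poly (pderiv (G k)) x * g k x + (g k x * (of_nat k * x ^ (k - 1))) * poly (G k) x) =
            poly (pderiv (c 0)) x * F x + exp_sum n x * poly (c 0) x" by (rule DERIV_unique)
        then have "poly (c 0) x * (\<Sum>k=1..n. poly (pderiv (G k)) x * g k x + (g k x * (of_nat k * x ^ (k - 1))) * poly (G k) x) =
            poly (pderiv (c 0)) x * (poly (c 0) x * F x) + (poly (c 0) x)\<^sup>2 * exp_sum n x"
          by (simp add: algebra_simps power2_eq_square)
        then have "(\<Sum>k=1..n. poly (c 0) x * (poly (pderiv (G k)) x * g k x + (g k x * (of_nat k * x ^ (k - 1))) * poly (G k) x)) -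
            (\<Sum>k=1..n. poly (pderiv (c 0)) x * (poly (G k) x * g k x)) - (\<Sum>k=1..n. (poly (c 0) x)\<^sup>2 * g k x) = 0"
          unfolding cF[OF x] fg sum_distrib_left by simp
        then show "(\<Sum>k=1..n. poly (?b k) x * exp (poly (monom 1 k) x / poly 1 x)) = 0"
          unfolding sum_subtractf [symmetric] by (simp add: gx poly_monom algebra_simps)
      next
        show "monom 1 i - monom 1 j \<noteq> smult d (1 :: 'a poly)"
          if "i \<in> {1..n}" "i \<noteq> j" for i j :: nat and d
          using that by (intro monom_diff_ne_const) auto
      qed (use that in simp_all)
      then show ?thesis by simp
    qed
    show ?thesis
    proof (cases "n = 1")
      case False
      then have "n - 1 \<ge> 1" "(of_nat n :: 'a) \<noteq> 0" using assms(3) by auto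
      from exp_monomial_no_rational_primitive[OF \<open>c 0 \<noteq> 0\<close> this(2,1)] risch[of n] assms(3)
      show ?thesis by auto
    next
      case True
      have "G 1 = c 0"
        by (rule exp_rational_primitive_unique[OF \<open>c 0 \<noteq> 0\<close>]) (use risch[of 1] True in simp)
      have "F x = exp x" if "x \<in> D" for x
      proof -
        have "F x - exp x = 0"
        proof (rule zero_off_finite_imp_zero[OF assms(1) _ _ that])
          show "continuous_on D (\<lambda>x. F x - exp x)"
            by (intro continuous_intros smooth_on_continuous_on sF)
          show "eventually (\<lambda>x. F x - exp x = 0) (off_finite D)"
            using eventually_poly_nonzero[OF \<open>c 0 \<noteq> 0\<close>] eventually_off_finite_mem
            by eventually_elim (use cF \<open>G 1 = c 0\<close> True in \<open>auto simp: gx\<close>)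
        qed
        then show ?thesis by simp
      qed
      then show ?thesis using assms(5) True by blast
    qed
  qed
qed

lemma exp_sum_has_antiderivative:
  fixes D :: "'a::{real_normed_field,banach} set"
  assumes "D \<noteq> {}"
  shows "\<exists>F. antiderivative_on D (exp_sum n) F \<and> \<not> (n = 1 \<and> (\<forall>x\<in>D. F x = exp x))"
proof -
  have "\<forall>k. \<exists>F. k \<ge> 1 \<longrightarrow> (\<forall>x::'a. (F has_field_derivative exp (x ^ k)) (at x))"
    using exp_power_has_primitive by blast
  then obtain F where F: "\<And>k x. k \<ge> 1 \<Longrightarrow> (F k has_field_derivative exp (x ^ k)) (at (x::'a))"
    by metis
  define H where "H c x = (\<Sum>k=1..n. F k x) + c" for c x
  have anti: "antiderivative_on D (exp_sum n) (H c)" for c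
    unfolding antiderivative_on_def H_def [abs_def] exp_sum_def
    using DERIV_add[OF DERIV_sum DERIV_const] F by (auto intro!: derivative_eq_intros)
  obtain x where "x \<in> D" using assms by blast
  \<comment> \<open>Two antiderivatives with different constants of integration do not both agree with \<open>exp\<close>.\<close>
  have "H 0 x \<noteq> exp x \<or> H 1 x \<noteq> exp x" by (auto simp: H_def)
  then show ?thesis using anti \<open>x \<in> D\<close> by blast
qed

lemma coefficient_ring_rationals_reals_UNIV:
  fixes K :: "'a::{real_normed_field,banach} set"
  assumes "K \<in> {\<rat>, \<real>, UNIV}"
  shows "coefficient_ring K"
  by standard (use assms in auto)

theorem theorem6:
  fixes K :: "'a::{real_normed_field,banach} set"
  assumes "K \<in> {\<rat>, \<real>, UNIV}"
  shows
    "(\<forall>D f n F. open D \<and> D \<noteq> {} \<and> simple_of_order K D n f \<and> antiderivative_on D f F \<longrightarrow>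
        simple_of_order_le K D (n + 1) F) \<and>
     (\<forall>D f n. open D \<and> D \<noteq> {} \<and> simple_of_order K D n f \<longrightarrow>
        simple_of_order_le K D n (deriv f)) \<and>
     (\<forall>D f g n m. open D \<and> D \<noteq> {} \<and> simple_of_order K D n f \<and> simple_of_order K D m g \<longrightarrow>
        simple_of_order_le K D (n + m) (\<lambda>x. f x + g x)) \<and>
     (\<forall>D f g n m. open D \<and> D \<noteq> {} \<and> simple_of_order K D n f \<and> simple_of_order K D m g \<longrightarrow>
        simple_of_order_le K D (n * m) (\<lambda>x. f x * g x)) \<and>
     (\<forall>D f n P Q E. open D \<and> D \<noteq> {} \<and> simple_of_order K D n f \<and>
        poly_over K P \<and> poly_over K Q \<and> Q \<noteq> 0 \<and>
        open E \<and> E \<noteq> {} \<and> (\<forall>x\<in>E. poly Q x \<noteq> 0 \<and> poly P x / poly Q x \<in> D) \<longrightarrow>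
        simple_of_order_le K E n (\<lambda>x. f (poly P x / poly Q x))) \<and>
     (\<forall>D f n p q E s. open D \<and> D \<noteq> {} \<and> simple_of_order K D n f \<and> q \<ge> 1 \<and>
        open E \<and> E \<noteq> {} \<and> power_branch p q E s \<and> s ` E \<subseteq> D \<longrightarrow>
        simple_of_order_le K E (n * q) (\<lambda>x. f (s x))) \<and>
     (\<forall>D n. open D \<and> D \<noteq> {} \<and> n \<ge> 1 \<longrightarrow>
        simple_of_order K D n (exp_sum n) \<and>
        (\<exists>F. antiderivative_on D (exp_sum n) F \<and> simple_of_order K D (n + 1) F) \<and>
        (\<forall>F. antiderivative_on D (exp_sum n) F \<and> \<not> (n = 1 \<and> (\<forall>x\<in>D. F x = exp x)) \<longrightarrow>
           simple_of_order K D (n + 1) F)) \<and>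
     (\<forall>D n. open D \<and> D \<noteq> {} \<and> n \<ge> 1 \<longrightarrow>
        simple_of_order K D n (exp_sum n) \<and>
        simple_of_order K D n (deriv (exp_sum n))) \<and>
     (\<forall>D n m. open D \<and> D \<noteq> {} \<and> n \<ge> 1 \<and> m \<ge> 1 \<longrightarrow>
        simple_of_order K D n (exp_sum n) \<and>
        simple_of_order K D m (\<lambda>x. \<Sum>k=n+1..n+m. exp (x ^ k)) \<and>
        simple_of_order K D (n + m) (\<lambda>x. exp_sum n x + (\<Sum>k=n+1..n+m. exp (x ^ k)))) \<and>
     (\<forall>D n m. open D \<and> D \<noteq> {} \<and> n \<ge> 1 \<and> m \<ge> 1 \<longrightarrow>
        simple_of_order K D n (exp_sum n) \<and>
        simple_of_order K D m (\<lambda>x. \<Sum>k=n+1..n+m. exp (x ^ k)) \<and>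
        simple_of_order K D (n * m) (\<lambda>x. exp_sum n x * (\<Sum>k=n+1..n+m. exp (x ^ k)))) \<and>
     (\<forall>D n. open D \<and> D \<noteq> {} \<and> n \<ge> 1 \<longrightarrow>
        simple_of_order K D n (exp_sum n) \<and>
        (\<forall>P Q E. poly_over K P \<and> poly_over K Q \<and> Q \<noteq> 0 \<and>
           (n = 1 \<or> \<not> (\<exists>c. P = smult c Q)) \<and>
           open E \<and> E \<noteq> {} \<and> (\<forall>x\<in>E. poly Q x \<noteq> 0) \<longrightarrow>
           simple_of_order K E n (\<lambda>x. exp_sum n (poly P x / poly Q x)))) \<and>
     (\<forall>D n q. open D \<and> D \<noteq> {} \<and> n \<ge> 1 \<and> q \<ge> 1 \<longrightarrow>
        simple_of_order K D n (exp_sum_mult n q) \<and>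
        (\<forall>p E s. p \<ge> 1 \<and> coprime p q \<and> open E \<and> E \<noteq> {} \<and>
           power_branch (int p) q E s \<longrightarrow>
           simple_of_order K E (n * q) (\<lambda>x. exp_sum_mult n q (s x))))"
proof -
  interpret coefficient_ring K by (rule coefficient_ring_rationals_reals_UNIV[OF assms])
  note ode = simple_of_order_imp_ode
  note le = simple_of_order_leI
  have antiderivative: "simple_of_order K D (n + 1) F"
    if "open D" "D \<noteq> {}" "n \<ge> 1" "antiderivative_on D (exp_sum n) F" "\<not> (n = 1 \<and> (\<forall>x\<in>D. F x = exp x))"
    for D :: "'a set" and n F
    by (rule simple_of_orderI[OF le[OF antiderivative_order_le[OF that(1) ode[OF simple_of_order_exp_sum[OF that(1,2)]] that(4)]]])
      (rule order_antiderivative_exp_sum_ge[OF that])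
  show ?thesis
  proof (intro conjI allI impI; (elim conjE)?)
    show "simple_of_order_le K D (n + 1) F"
      if "open D" "simple_of_order K D n f" "antiderivative_on D f F" for D f n F
      by (rule le[OF antiderivative_order_le[OF that(1) ode[OF that(2)] that(3)]])
    show "simple_of_order_le K D n (deriv f)" if "open D" "simple_of_order K D n f" for D f n
      by (rule le[OF deriv_order_le[OF that(1) ode[OF that(2)]]])
    show "simple_of_order_le K D (n + m) (\<lambda>x. f x + g x)"
      if "open D" "simple_of_order K D n f" "simple_of_order K D m g" for D f g n m
      by (rule le[OF add_order_le[OF that(1) ode[OF that(2)] ode[OF that(3)]]])
    show "simple_of_order_le K D (n * m) (\<lambda>x. f x * g x)"
      if "open D" "simple_of_order K D n f" "simple_of_order K D m g" for D f g n m
      by (rule le[OF mult_order_le[OF that(1) ode[OF that(2)] ode[OF that(3)]]])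
    show "simple_of_order_le K E n (\<lambda>x. f (poly P x / poly Q x))"
      if "open D" "simple_of_order K D n f" "poly_over K P" "poly_over K Q" "Q \<noteq> 0" "open E"
        "\<forall>x\<in>E. poly Q x \<noteq> 0 \<and> poly P x / poly Q x \<in> D" for D f n P Q E
      using that by (intro le compose_rational_order_le[OF that(1) ode[OF that(2)]]) auto
    show "simple_of_order_le K E (n * q) (\<lambda>x. f (s x))"
      if "open D" "simple_of_order K D n f" "q \<ge> 1" "open E" "power_branch p q E s" "s ` E \<subseteq> D"
      for D f n p q E s
      using that by (intro le compose_power_branch_order_le[OF that(1) ode[OF that(2)]])
    show "\<exists>F. antiderivative_on D (exp_sum n) F \<and> simple_of_order K D (n + 1) F"
      if "open D" "D \<noteq> {}" "n \<ge> 1" for D :: "'a set" and n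
      using exp_sum_has_antiderivative[OF that(2), of n] antiderivative[OF that] by blast
    show "simple_of_order K D (n + 1) F"
      if "open D" "D \<noteq> {}" "n \<ge> 1" "antiderivative_on D (exp_sum n) F" "\<not> (n = 1 \<and> (\<forall>x\<in>D. F x = exp x))"
      for D n F
      using that by (rule antiderivative)
  qed (blast intro: simple_of_order_exp_sum simple_of_order_deriv_exp_sum simple_of_order_exp_sum_tail
      simple_of_order_exp_sum_add_tail simple_of_order_exp_sum_mult_tail simple_of_order_exp_sum_mult
      simple_of_order_exp_sum_rational simple_of_order_exp_sum_mult_power_branch)+
qed

end
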